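(* Let $J(\lambda)$ be a continuous real function supported on the set $B\cup G$, differentiable at all points except possibly the boundary points of $B$, satisfying $$\lambda-\langle a_0\rangle-\mathrm{p.v.}\!\int_{-\infty}^{\infty}\frac{J(\mu)}{\lambda-\mu}\,d\mu=0\quad(\lambda\in B),$$ $$J(\lambda)=c_k=\text{const.}\quad(\lambda\in G_k,\ k=1,\dots,g),\qquad J(\lambda)=0\quad(\lambda\notin B\cup G),$$ where $\langle a_0\rangle$ is a real constant (the constants $c_k$ are not prescribed). Then $J(\lambda)+iHJ(\lambda)$ is the limiting value, as $z\to\lambda+i0$, of the analytic function $$f(z)=\frac{-i}{\pi}\int_z^{\infty}\left(1-\frac{P(z')}{R(z')}\right)dz',\qquad \mathrm{Im}\,z\neq0 .$$ Precisely, $$J(\lambda)=\frac1\pi\,\mathrm{Im}\int_\lambda^\infty\left(1-\frac{P(\mu)}{R(\mu)}\right)d\mu,$$ $$HJ(\lambda)=\frac1\pi\,\mathrm{p.v.}\!\int_{-\infty}^\infty\frac{J(\mu)}{\lambda-\mu}\,d\mu=-\frac1\pi\,\mathrm{Re}\int_\lambda^\infty\left(1-\frac{P(\mu)}{R(\mu)}\right)d\mu .$$ The endpoints of $B$ satisfy the compatibility condition $$q_{g+1}+\int_{q_{g+1}}^\infty\left(1-\frac{P(\lambda)}{R(\lambda)}\right)d\lambda=\langle a_0\rangle .$$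
   Context: Let $g\ge 0$ be an integer and let real points $p_0<q_1<p_1<q_2<p_2<\dots<p_g<q_{g+1}$ be given. The set of bands is $B=[p_0,q_1]\cup[p_1,q_2]\cup\dots\cup[p_g,q_{g+1}]$; the gaps are $G_k=(q_k,p_k)$, $k=1,\dots,g$, and $G=\bigcup_{k=1}^gG_k$. $R(\lambda)=\left\{\prod_{k=0}^g(\lambda-p_k)(\lambda-q_{k+1})\right\}^{1/2}$ is the branch analytic on $\mathbb C\setminus B$ (branch cuts along $B$) with $R(\lambda)>0$ as $\lambda\to+\infty$; on $B$, $R(\lambda)$ means the limiting value from the upper half plane. $P(\lambda)=\prod_{i=1}^{g+1}(\lambda-\sigma_i)$ is the monic polynomial with $\sigma_i\in\mathbb R$ uniquely determined by the $g+1$ relations $$\int_{G_k}\frac{P(\lambda)}{R(\lambda)}\,d\lambda=0\quad(k=1,\dots,g),\qquad \int_B\frac{P(\lambda)}{R(\lambda)}\,d\lambda=0 .$$ (It follows that $P/R=1+O(\lambda^{-2})$ as $\lambda\to\infty$.) The symbol p.v. denotes the Cauchy principal value, and $H$ is the Hilbert transform $HJ(\lambda)=\frac1\pi\mathrm{p.v.}\int_{-\infty}^{\infty}\frac{J(\mu)}{\lambda-\mu}d\mu$. In $f(z)$ the path of integration runs from $z$ to $+\infty$ without crossing the real axis. *)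

theory Defs
  imports "HOL-Complex_Analysis.Complex_Analysis"
begin

definition bands :: "nat \<Rightarrow> (nat \<Rightarrow> real) \<Rightarrow> (nat \<Rightarrow> real) \<Rightarrow> real set" where
  "bands g p q = (\<Union>k\<in>{0..g}. {p k..q (k + 1)})"

definition gap :: "(nat \<Rightarrow> real) \<Rightarrow> (nat \<Rightarrow> real) \<Rightarrow> nat \<Rightarrow> real set" where
  "gap p q k = {q k<..<p k}"

definition gaps :: "nat \<Rightarrow> (nat \<Rightarrow> real) \<Rightarrow> (nat \<Rightarrow> real) \<Rightarrow> real set" where
  "gaps g p q = (\<Union>k\<in>{1..g}. gap p q k)"

text \<open>The four clauses determine \<open>R\<close> uniquely: the first three fix the branch off the bands, and
  the last one says that on the bands \<open>R\<close> is its own limit from the upper half plane.\<close>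

definition band_sqrt ::
  "nat \<Rightarrow> (nat \<Rightarrow> real) \<Rightarrow> (nat \<Rightarrow> real) \<Rightarrow> (complex \<Rightarrow> complex) \<Rightarrow> bool" where
  "band_sqrt g p q R \<longleftrightarrow>
     R holomorphic_on - (complex_of_real ` bands g p q) \<and>
     (\<forall>z. z \<notin> complex_of_real ` bands g p q \<longrightarrow>
        (R z)\<^sup>2 = (\<Prod>k=0..g. (z - of_real (p k)) * (z - of_real (q (k + 1))))) \<and>
     (\<forall>\<^sub>F x in at_top. Im (R (of_real x)) = 0 \<and> Re (R (of_real x)) > 0) \<and>
     (\<forall>x\<in>bands g p q. (R \<longlongrightarrow> R (of_real x)) (at (of_real x) within {z. Im z > 0}))"

text \<open>Cauchy principal value over the real line, with respect to a singularity at \<open>x\<close>. Away from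
  \<open>x\<close> absolute integrability is required, including at infinity.\<close>

definition has_principal_value :: "(real \<Rightarrow> real) \<Rightarrow> real \<Rightarrow> real \<Rightarrow> bool" where
  "has_principal_value h x I \<longleftrightarrow>
     (\<forall>\<epsilon>>0. set_integrable lborel {\<mu>. \<epsilon> \<le> \<bar>\<mu> - x\<bar>} h) \<and>
     ((\<lambda>\<epsilon>. LINT \<mu>:{\<mu>. \<epsilon> \<le> \<bar>\<mu> - x\<bar>}|lborel. h \<mu>) \<longlongrightarrow> I) (at_right 0)"

definition principal_value :: "(real \<Rightarrow> real) \<Rightarrow> real \<Rightarrow> real" where
  "principal_value h x = (THE I. has_principal_value h x I)"

definition hilbert_transform :: "(real \<Rightarrow> real) \<Rightarrow> real \<Rightarrow> real" where
  "hilbert_transform J x = 1 / pi * principal_value (\<lambda>\<mu>. J \<mu> / (x - \<mu>)) x"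

definition path_to_infinity :: "complex \<Rightarrow> (real \<Rightarrow> complex) \<Rightarrow> bool" where
  "path_to_infinity z \<gamma> \<longleftrightarrow>
     \<gamma> 0 = z \<and>
     (\<forall>T>0. \<gamma> piecewise_C1_differentiable_on {0..T}) \<and>
     (\<forall>t\<ge>0. Im (\<gamma> t) \<noteq> 0) \<and>
     filterlim (\<lambda>t. Re (\<gamma> t)) at_top at_top"

text \<open>The improper contour integral of \<open>F\<close> from \<open>z\<close> to \<open>+\<infinity>\<close> off the real axis: the same value
  has to be obtained along every admissible path. For \<open>Im z \<noteq> 0\<close> the horizontal ray from \<open>z\<close>
  is admissible, so the value is unique.\<close>

definition has_integral_to_infinity :: "(complex \<Rightarrow> complex) \<Rightarrow> complex \<Rightarrow> complex \<Rightarrow> bool" where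
  "has_integral_to_infinity F z I \<longleftrightarrow>
     (\<forall>\<gamma>. path_to_infinity z \<gamma> \<longrightarrow>
        (\<forall>T>0. F contour_integrable_on subpath 0 T \<gamma>) \<and>
        ((\<lambda>T. contour_integral (subpath 0 T \<gamma>) F) \<longlongrightarrow> I) at_top)"

definition integral_to_infinity :: "(complex \<Rightarrow> complex) \<Rightarrow> complex \<Rightarrow> complex" where
  "integral_to_infinity F z = (THE I. has_integral_to_infinity F z I)"

end

theory Submission imports Defs begin

text \<open>
Let $F(z) = \int J(\mu)/(z-\mu)\,d\mu$ be the Cauchy transform of the density. Its limit from the upper
half-plane at a real point has imaginary part $-\pi J$ and the principal value $\pi HJ$ as real part, so
$(i/\pi)F$ has the boundary values claimed for $f$. As $F$ vanishes at infinity, everything follows from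
the identity $F' = 1 - P/R$.

The idea behind this identity is that $R\,(1-F')$ is a polynomial. On a band the equation for $J$ says
that $\mathrm{Re}\, F = x - \langle a_0\rangle$, so there $1-F'$ is purely imaginary, and so is $R$. On a
gap, and outside the outermost endpoints, $J$ is constant, so $1-F'$ is real, and so is $R$. Hence
$R\,(1-F')$ is real on the real line and continues by reflection to the plane without the endpoints
(\<open>reflected_product\<close>). At an endpoint $e$ it grows at most like
$|z-e|^{1/2}/|\mathrm{Im}\, z|$, which excludes a pole (\<open>removable_of_axis_bound\<close>). At infinity it
behaves like $z^{g+1}$, so it is a monic polynomial of degree $g+1$
(\<open>entire_product_polynomial\<close>). Its quotient by $R$ has the primitive $z - F$, whose values at the
endpoints are prescribed, so its integrals over the gaps and over the union of the bands vanish.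
Finally, $P$ is the only monic polynomial of degree $g+1$ with these properties: the difference of two of
them has a zero in each gap, and then its quotient by $R$ is a constant times a function of one sign on
the bands (\<open>abelian_differential_unique\<close>).

The reflection needs care, because the equation on the bands holds pointwise and gives no control of $F$
near the line. It is applied to a primitive $\Phi$ of $F$. Since $F$ grows at most like
$|\mathrm{Im}\, z|^{-1/2}$, this primitive extends continuously to the line. Along the line the derivative
of $\mathrm{Re}\, \Phi$ at $x$ is the principal value at $x$, whenever that exists
(\<open>potential_has_boundary_derivative\<close>). So $\mathrm{Re}\, \Phi$ is a quadratic polynomial on each
band, and $F' = \Phi''$ continues across it. Once $F'$ is known to be 1 minus a polynomial divided by $R$,
it has only inverse square root singularities. Then $F$ itself is continuous up to the line, and the
remaining claims are instances of the fundamental theorem of calculus.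
\<close>

section \<open>Kernels and approximate identities\<close>

lemma has_vector_derivative_along_line:
  assumes "(G has_field_derivative D) (at (w + of_real t * v))"
  shows "((\<lambda>t. G (w + of_real t * v)) has_vector_derivative v * D) (at t)"
proof -
  have "((\<lambda>t. w + of_real t * v) has_vector_derivative v) (at t)"
    by (auto intro!: derivative_eq_intros)
  from field_vector_diff_chain_at[OF this assms] show ?thesis by (simp add: o_def)
qed

lemma integral_derivative_real_line:
  fixes G h :: "real \<Rightarrow> 'a::euclidean_space"
  assumes G: "\<And>x. (G has_vector_derivative h x) (at x)" and h: "continuous_on UNIV h"
    and int: "integrable lborel h" and top: "(G \<longlongrightarrow> B) at_top" and bot: "(G \<longlongrightarrow> A) at_bot"
  shows "integral\<^sup>L lborel h = B - A"
proof -
  have "(LBINT x=-\<infinity>..\<infinity>. h x) = B - A"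
  proof (rule interval_integral_FTC_integrable)
    show "isCont h x" for x using h by (simp add: continuous_on_eq_continuous_at)
    show "set_integrable lborel (einterval (- \<infinity>) \<infinity>) h"
      using int by (simp add: set_integrable_def einterval_def)
    show "((G \<circ> real_of_ereal) \<longlongrightarrow> A) (at_right (- \<infinity>))"
      using bot by (simp add: ereal_tendsto_simps)
    show "((G \<circ> real_of_ereal) \<longlongrightarrow> B) (at_left \<infinity>)"
      using top by (simp add: ereal_tendsto_simps)
  qed (use G in auto)
  then show ?thesis
    by (simp add: interval_lebesgue_integral_def einterval_def set_lebesgue_integral_def)
qed

lemma poisson_kernel:
  shows integrable_poisson_kernel: "integrable lborel (\<lambda>t::real. 1 / (1 + t\<^sup>2))"
    and integral_poisson_kernel: "(LINT t|lborel. 1 / (1 + t\<^sup>2) :: real) = pi"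
proof -
  have nz: "1 + t\<^sup>2 \<noteq> 0" for t :: real
    by (metis add_eq_0_iff2 neg_le_0_iff_le not_one_le_zero zero_le_power2)
  have d: "(arctan has_real_derivative 1 / (1 + t\<^sup>2)) (at t)" for t
    by (auto intro!: derivative_eq_intros simp: divide_simps)
  have c: "isCont (\<lambda>t::real. 1 / (1 + t\<^sup>2)) t" for t
    by (intro continuous_intros) (use nz in auto)
  have "set_integrable lborel (einterval (- \<infinity>) \<infinity>) (\<lambda>t::real. 1 / (1 + t\<^sup>2))"
    by (rule interval_integral_FTC_nonneg[where F=arctan and A="-(pi/2)" and B="pi/2"])
       (use d c tendsto_arctan_at_top tendsto_arctan_at_bot in \<open>auto simp: ereal_tendsto_simps\<close>)
  then show i: "integrable lborel (\<lambda>t::real. 1 / (1 + t\<^sup>2))"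
    by (simp add: set_integrable_def einterval_def)
  have "(LINT t|lborel. 1 / (1 + t\<^sup>2) :: real) = pi/2 - (-(pi/2))"
    by (rule integral_derivative_real_line[where G=arctan])
       (use d c i tendsto_arctan_at_top tendsto_arctan_at_bot in
         \<open>auto simp: has_real_derivative_iff_has_vector_derivative continuous_on_eq_continuous_at\<close>)
  then show "(LINT t|lborel. 1 / (1 + t\<^sup>2) :: real) = pi" by simp
qed

text \<open>The kernels of the approximate identities are compared with the Poisson kernel, whose decay $1/t^2$ is what makes the
rescaled integrals converge.\<close>

lemma integrable_of_poisson_bound:
  fixes K :: "real \<Rightarrow> 'a::{banach,second_countable_topology}"
  assumes "K \<in> borel_measurable borel" and "\<And>t. norm (K t) \<le> C / (1 + t\<^sup>2)"
  shows "integrable lborel K"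
proof (rule Bochner_Integration.integrable_bound)
  show "integrable lborel (\<lambda>t. C * (1 / (1 + t\<^sup>2)))"
    by (intro integrable_mult_right integrable_poisson_kernel)
  show "AE t in lborel. norm (K t) \<le> norm (C * (1 / (1 + t\<^sup>2)))"
  proof (intro AE_I2)
    fix t
    have "norm (K t) \<le> C * (1 / (1 + t\<^sup>2))" using assms(2)[of t] by simp
    also have "\<dots> \<le> norm (C * (1 / (1 + t\<^sup>2)))" by (simp only: real_norm_def abs_ge_self)
    finally show "norm (K t) \<le> norm (C * (1 / (1 + t\<^sup>2)))" .
  qed
qed (use assms in simp)

lemma integral_odd_real_line:
  fixes K :: "real \<Rightarrow> real"
  assumes "\<And>t. K (- t) = - K t"
  shows "integral\<^sup>L lborel K = 0"
proof -
  have "integral\<^sup>L lborel K = \<bar>-1\<bar> *\<^sub>R (LINT t|lborel. K (0 + (-1) * t))"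
    by (rule lborel_integral_real_affine) simp
  also have "\<dots> = - integral\<^sup>L lborel K"
    using assms by simp
  finally show ?thesis by simp
qed

lemma norm_of_real_plus_i_sq: "(cmod (of_real t + \<i>))\<^sup>2 = 1 + t\<^sup>2"
  by (simp add: cmod_power2)

text \<open>The kernel of the derivative of the Cauchy transform. Its integral vanishes, so after rescaling it
annihilates the leading term of a continuous density.\<close>

lemma cauchy_square_kernel:
  shows integrable_cauchy_square_kernel: "integrable lborel (\<lambda>t::real. 1 / (complex_of_real t + \<i>)\<^sup>2)"
    and integral_cauchy_square_kernel: "(LINT t|lborel. 1 / (complex_of_real t + \<i>)\<^sup>2) = 0"
proof -
  have nz: "complex_of_real t + \<i> \<noteq> 0" for t
    by (simp add: complex_eq_iff)
  have c: "continuous_on UNIV (\<lambda>t::real. 1 / (complex_of_real t + \<i>)\<^sup>2)"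
    by (intro continuous_intros) (use nz in auto)
  show i: "integrable lborel (\<lambda>t::real. 1 / (complex_of_real t + \<i>)\<^sup>2)"
  proof (rule integrable_of_poisson_bound)
    show "(\<lambda>t::real. 1 / (complex_of_real t + \<i>)\<^sup>2) \<in> borel_measurable borel"
      using c by (rule borel_measurable_continuous_onI)
    show "norm (1 / (complex_of_real t + \<i>)\<^sup>2) \<le> 1 / (1 + t\<^sup>2)" for t
      using norm_of_real_plus_i_sq[of t] by (simp add: norm_divide norm_power)
  qed
  have z: "((\<lambda>t. - (1 / (complex_of_real t + \<i>))) \<longlongrightarrow> 0) F" if "filterlim (\<lambda>t::real. complex_of_real t) at_infinity F" for F
  proof -
    have "filterlim (\<lambda>t. complex_of_real t + \<i>) at_infinity F"
      using that by (intro tendsto_add_filterlim_at_infinity') auto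
    from tendsto_minus[OF tendsto_divide_0[OF tendsto_const this, of 1]] show ?thesis by simp
  qed
  have "(LINT t|lborel. 1 / (complex_of_real t + \<i>)\<^sup>2) = 0 - 0"
  proof (rule integral_derivative_real_line[where G="\<lambda>t. - (1 / (complex_of_real t + \<i>))"])
    show "((\<lambda>t. - (1 / (complex_of_real t + \<i>))) has_vector_derivative 1 / (complex_of_real t + \<i>)\<^sup>2) (at t)" for t
    proof -
      have "((\<lambda>z. - (1 / (z + \<i>))) has_field_derivative 1 / (complex_of_real t + \<i>)\<^sup>2) (at (of_real t))"
        using nz[of t] by (auto intro!: derivative_eq_intros simp: power2_eq_square)
      then show ?thesis
        using has_vector_derivative_along_line[where w=0 and v=1 and t=t] by simp
    qed
    show "((\<lambda>t. - (1 / (complex_of_real t + \<i>))) \<longlongrightarrow> 0) at_top"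
      by (intro z filterlim_of_real_at_infinity)
    show "((\<lambda>t. - (1 / (complex_of_real t + \<i>))) \<longlongrightarrow> 0) at_bot"
      by (intro z) (simp add: filterlim_at_infinity_conv_norm_at_top filterlim_at_bot_mirror filterlim_abs_real)
  qed (use c i in auto)
  then show "(LINT t|lborel. 1 / (complex_of_real t + \<i>)\<^sup>2) = 0" by simp
qed

text \<open>The real part of the Cauchy kernel at height 1 minus the kernel of the principal value truncated
at distance 1. Each of the two has a non-integrable tail $1/t$; these tails cancel.\<close>

definition truncation_kernel :: "real \<Rightarrow> real" where
  "truncation_kernel t = t / (1 + t\<^sup>2) - (if 1 \<le> \<bar>t\<bar> then 1 / t else 0)"

lemma truncation_kernel:
  shows integrable_truncation_kernel: "integrable lborel truncation_kernel"
    and integral_truncation_kernel: "integral\<^sup>L lborel truncation_kernel = 0"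
proof -
  show "integrable lborel truncation_kernel"
  proof (rule integrable_of_poisson_bound)
    show "truncation_kernel \<in> borel_measurable borel"
      unfolding truncation_kernel_def by measurable
    show "norm (truncation_kernel t) \<le> 1 / (1 + t\<^sup>2)" for t
    proof (cases "1 \<le> \<bar>t\<bar>")
      case True
      then have t: "t \<noteq> 0" by auto
      have p: "1 + t\<^sup>2 > 0" by (smt (verit) zero_le_power2)
      have "truncation_kernel t = - (1 / (t * (1 + t\<^sup>2)))"
        using True t p unfolding truncation_kernel_def
        by (simp add: field_simps power2_eq_square) 
      then have "norm (truncation_kernel t) = 1 / \<bar>t\<bar> * (1 / (1 + t\<^sup>2))"
        using p by (simp add: abs_mult)
      also have "\<dots> \<le> 1 * (1 / (1 + t\<^sup>2))"
        by (rule mult_right_mono) (use True p in auto)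
      finally show ?thesis by simp
    next
      case False
      then show ?thesis
        by (simp add: truncation_kernel_def abs_mult divide_right_mono abs_divide)
    qed
  qed
  show "integral\<^sup>L lborel truncation_kernel = 0"
    by (rule integral_odd_real_line) (simp add: truncation_kernel_def)
qed

text \<open>The point and the scale vary together, so that the conclusion is a full limit in the upper
half-plane rather than a limit along vertical lines.\<close>

lemma approximate_identity:
  fixes J :: "real \<Rightarrow> real" and K :: "real \<Rightarrow> 'a::{banach,second_countable_topology}"
  assumes J: "continuous_on UNIV J" and B: "\<And>x. \<bar>J x\<bar> \<le> B" and K: "integrable lborel K"
    and X: "X \<longlonglongrightarrow> x" and Y: "Y \<longlonglongrightarrow> 0"
  shows "(\<lambda>n. LINT t|lborel. J (X n - Y n * t) *\<^sub>R K t) \<longlonglongrightarrow> J x *\<^sub>R integral\<^sup>L lborel K"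
proof -
  have [measurable]: "J \<in> borel_measurable borel"
    using J by (rule borel_measurable_continuous_onI)
  have [measurable]: "K \<in> borel_measurable borel"
    using K by auto
  have "(\<lambda>n. LINT t|lborel. J (X n - Y n * t) *\<^sub>R K t) \<longlonglongrightarrow> (LINT t|lborel. J x *\<^sub>R K t)"
  proof (rule integral_dominated_convergence[where w="\<lambda>t. B * norm (K t)"])
    show "AE t in lborel. (\<lambda>n. J (X n - Y n * t) *\<^sub>R K t) \<longlonglongrightarrow> J x *\<^sub>R K t"
    proof (intro AE_I2 tendsto_scaleR tendsto_const)
      fix t :: real
      have "(\<lambda>n. X n - Y n * t) \<longlonglongrightarrow> x - 0 * t"
        by (intro tendsto_intros X Y)
      from continuous_on_tendsto_compose[OF J this]
      show "(\<lambda>n. J (X n - Y n * t)) \<longlonglongrightarrow> J x" by simp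
    qed
    show "integrable lborel (\<lambda>t. B * norm (K t))" using K by auto
    show "AE t in lborel. norm (J (X n - Y n * t) *\<^sub>R K t) \<le> B * norm (K t)" for n
      using B by (auto intro!: mult_right_mono)
  qed measurable
  then show ?thesis using K by simp
qed

lemma set_integrable_inverse_sqrt:
  fixes e u v :: real
  shows "set_integrable lborel {u..v} (\<lambda>x. 1 / sqrt \<bar>x - e\<bar>)"
proof -
  define N where "N = \<bar>u\<bar> + \<bar>v\<bar> + \<bar>e\<bar>"
  have "(\<lambda>x. x powr (-1/2)) integrable_on {0..N}"
    by (rule integrable_on_powr_from_0) (auto simp: N_def)
  then have "(\<lambda>x. x powr (-1/2)) absolutely_integrable_on {0..N}"
    by (intro nonnegative_absolutely_integrable_1) auto
  then have "integrable lborel (\<lambda>x. indicator {0..N} x *\<^sub>R (x powr (-1/2)))"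
    unfolding set_integrable_def by (subst (asm) integrable_completion) auto
  then have 1: "integrable lborel (\<lambda>x. indicator {0..N} x *\<^sub>R (1 / sqrt \<bar>x\<bar>))" (is "integrable _ ?k")
    by (rule Bochner_Integration.integrable_cong[THEN iffD1, rotated 2])
       (auto simp: indicator_def powr_minus powr_half_sqrt divide_simps)
  have 2: "integrable lborel (\<lambda>x. ?k (-e + 1 * x))" "integrable lborel (\<lambda>x. ?k (e + (-1) * x))"
    by (rule lborel_integrable_real_affine[OF 1]; simp)+
  show ?thesis
    unfolding set_integrable_def
  proof (rule Bochner_Integration.integrable_bound)
    show "integrable lborel (\<lambda>x. ?k (-e + 1 * x) + ?k (e + (-1) * x))"
      using 2 by (rule Bochner_Integration.integrable_add)
    show "AE x in lborel. norm (indicat_real {u..v} x *\<^sub>R (1 / sqrt \<bar>x - e\<bar>))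
        \<le> norm (?k (-e + 1 * x) + ?k (e + (-1) * x))"
    proof (intro AE_I2)
      fix x :: real
      have "- e + x = x - e" "\<bar>e - x\<bar> = \<bar>x - e\<bar>" by auto
      then show "norm (indicat_real {u..v} x *\<^sub>R (1 / sqrt \<bar>x - e\<bar>))
        \<le> norm (?k (-e + 1 * x) + ?k (e + (-1) * x))"
        by (auto simp: N_def indicator_def split: if_splits)
    qed
  qed measurable
qed

lemma set_integrable_sum_inverse_sqrt:
  fixes W :: real
  shows "set_integrable lborel {u..v} (\<lambda>x. W * (\<Sum>e\<in>S. 1 / sqrt \<bar>x - e\<bar>))"
proof -
  have "indicator {u..v} x *\<^sub>R (W * (\<Sum>e\<in>S. 1 / sqrt \<bar>x - e\<bar>))
      = (\<Sum>e\<in>S. W * (indicator {u..v} x *\<^sub>R (1 / sqrt \<bar>x - e\<bar>)))" for x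
    by (cases "x \<in> {u..v}") (simp_all add: sum_distrib_left)
  moreover have "integrable lborel (\<lambda>x. \<Sum>e\<in>S. W * (indicator {u..v} x *\<^sub>R (1 / sqrt \<bar>x - e\<bar>)))"
    by (intro Bochner_Integration.integrable_sum integrable_mult_right set_integrable_inverse_sqrt[unfolded set_integrable_def])
  ultimately show ?thesis unfolding set_integrable_def by simp
qed

section \<open>The Cauchy transform of a compactly supported density\<close>

abbreviation upper_half_plane :: "complex set" where
  "upper_half_plane \<equiv> {z. Im z > 0}"

lemma filterlim_vertical_line:
  "filterlim (\<lambda>y. Complex x y) (at (complex_of_real x) within upper_half_plane) (at_right 0)"
proof -
  have "((\<lambda>y. Complex x y) \<longlongrightarrow> Complex x 0) (at_right 0)"
    by (intro tendsto_intros)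
  then show ?thesis
    by (auto simp: filterlim_at eventually_at_right_less complex_of_real_def
             intro: eventually_mono[OF eventually_at_right_less[of 0]])
qed

lemma at_within_upper_half_plane_neq_bot: "at (complex_of_real x) within upper_half_plane \<noteq> bot"
  using filterlim_vertical_line[of x] trivial_limit_at_right_real[of 0]
  by (auto simp: filterlim_def bot_unique filtermap_bot_iff)

lemma tendsto_at_right_vertical_line:
  assumes "(f \<longlongrightarrow> l) (at (complex_of_real x) within upper_half_plane)"
  shows "((\<lambda>y. f (Complex x y)) \<longlongrightarrow> l) (at_right 0)"
  using filterlim_compose[OF assms filterlim_vertical_line] .

lemma LIMSEQ_vertical_line:
  assumes "(f \<longlongrightarrow> l) (at (complex_of_real x) within upper_half_plane)"
  shows "(\<lambda>n. f (Complex x (inverse (real (Suc n))))) \<longlonglongrightarrow> l"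
proof (rule filterlim_compose[OF tendsto_at_right_vertical_line[OF assms]])
  show "filterlim (\<lambda>n. inverse (real (Suc n))) (at_right 0) sequentially"
    using LIMSEQ_inverse_real_of_nat by (auto simp: filterlim_at)
qed

lemma open_nonreal: "open {z. Im z \<noteq> 0}"
  by (intro open_Collect_neq continuous_intros)

text \<open>Trades the logarithmic growth of the Cauchy transform near the real line for an integrable power.\<close>

lemma minus_ln_le_inverse_sqrt:
  assumes "0 < (y::real)"
  shows "- ln y \<le> 2 / sqrt y"
proof -
  have "ln (1 / sqrt y) \<le> 1 / sqrt y - 1"
    using assms by (intro ln_le_minus_one) simp
  moreover have "ln (1 / sqrt y) = - ln y / 2"
    using assms by (simp add: ln_div ln_sqrt)
  ultimately show ?thesis by (simp add: field_simps)
qed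

locale compact_density =
  fixes J :: "real \<Rightarrow> real" and a b B :: real
  assumes ab: "a < b"
    and continuous_density: "continuous_on UNIV J"
    and density_outside: "\<And>x. x \<notin> {a..b} \<Longrightarrow> J x = 0"
    and density_bound: "\<And>x. \<bar>J x\<bar> \<le> B"
begin

text \<open>The Cauchy transform of \<open>J\<close> and its derivative. The limit of \<open>F\<close> from above
is to be $\pi (HJ - iJ)$, so that $(i/\pi) F$ is the function of the theorem.\<close>

definition F :: "complex \<Rightarrow> complex" where
  "F z = (LINT \<mu>|lborel. of_real (J \<mu>) / (z - of_real \<mu>))"

definition F' :: "complex \<Rightarrow> complex" where
  "F' z = - (LINT \<mu>|lborel. of_real (J \<mu>) / (z - of_real \<mu>)\<^sup>2)"

lemma B_nonneg: "0 \<le> B"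
  using density_bound[of 0] by linarith

lemma borel_measurable_density [measurable]: "J \<in> borel_measurable borel"
  using continuous_density by (rule borel_measurable_continuous_onI)

lemma density_integral:
  fixes k :: "real \<Rightarrow> complex"
  assumes k: "continuous_on {a..b} k"
  shows integrable_density: "integrable lborel (\<lambda>\<mu>. of_real (J \<mu>) * k \<mu>)"
    and integral_density: "(LINT \<mu>|lborel. of_real (J \<mu>) * k \<mu>) = integral {a..b} (\<lambda>\<mu>. of_real (J \<mu>) * k \<mu>)"
    and norm_integral_density_le: "\<And>C. (\<And>\<mu>. \<mu> \<in> {a..b} \<Longrightarrow> norm (k \<mu>) \<le> C) \<Longrightarrow>
          norm (LINT \<mu>|lborel. of_real (J \<mu>) * k \<mu>) \<le> B * C * (b - a)"
proof -
  have "continuous_on {a..b} J" using continuous_density continuous_on_subset by blast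
  then have c: "continuous_on {a..b} (\<lambda>\<mu>. of_real (J \<mu>) * k \<mu>)"
    by (intro continuous_intros k)
  have s: "set_integrable lborel {a..b} (\<lambda>\<mu>. of_real (J \<mu>) * k \<mu>)"
    by (rule borel_integrable_atLeastAtMost'[OF c])
  have i: "indicator {a..b} \<mu> *\<^sub>R (of_real (J \<mu>) * k \<mu>) = of_real (J \<mu>) * k \<mu>" for \<mu>
    using density_outside[of \<mu>] by (cases "\<mu> \<in> {a..b}") auto
  show "integrable lborel (\<lambda>\<mu>. of_real (J \<mu>) * k \<mu>)"
    using s unfolding set_integrable_def i .
  show e: "(LINT \<mu>|lborel. of_real (J \<mu>) * k \<mu>) = integral {a..b} (\<lambda>\<mu>. of_real (J \<mu>) * k \<mu>)"
    using set_borel_integral_eq_integral(2)[OF s] unfolding set_lebesgue_integral_def i .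
  fix C assume C: "\<And>\<mu>. \<mu> \<in> {a..b} \<Longrightarrow> norm (k \<mu>) \<le> C"
  have "norm (integral {a..b} (\<lambda>\<mu>. of_real (J \<mu>) * k \<mu>)) \<le> B * C * (b - a)"
    using C density_bound B_nonneg
    by (intro integral_bound c) (use ab in \<open>auto simp: norm_mult intro!: mult_mono\<close>)
  then show "norm (LINT \<mu>|lborel. of_real (J \<mu>) * k \<mu>) \<le> B * C * (b - a)"
    unfolding e .
qed

lemma F_eq: "F z = (LINT \<mu>|lborel. of_real (J \<mu>) * (1 / (z - of_real \<mu>)))"
  and F'_eq: "F' z = - (LINT \<mu>|lborel. of_real (J \<mu>) * (1 / (z - of_real \<mu>)\<^sup>2))"
  by (simp_all add: F_def F'_def)

lemma nonreal_minus_real: "Im z \<noteq> 0 \<Longrightarrow> z - of_real \<mu> \<noteq> 0"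
  by (auto simp: complex_eq_iff)

lemma continuous_cauchy_kernel:
  assumes "Im z \<noteq> 0"
  shows "continuous_on {a..b} (\<lambda>\<mu>. 1 / (z - of_real \<mu>) ^ n)"
  using nonreal_minus_real[OF assms] by (intro continuous_intros) auto

lemma cauchy_transform_has_derivative:
  assumes z: "Im z \<noteq> 0"
  shows "(F has_field_derivative F' z) (at z)"
proof -
  define U where "U = {w. Im w * Im z > 0}"
  have "open U" "convex U"
  proof -
    have "U = {w. 0 < Im w} \<or> U = {w. Im w < 0}"
      using z by (cases "Im z > 0") (auto simp: U_def zero_less_mult_iff)
    then show "open U" "convex U"
      by (auto simp: open_halfspace_Im_gt open_halfspace_Im_lt convex_halfspace_Im_gt convex_halfspace_Im_lt)
  qed
  have zU: "z \<in> U" using z by (auto simp: U_def zero_less_mult_iff)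
  have U: "Im w \<noteq> 0" if "w \<in> U" for w using that by (auto simp: U_def)
  have eq: "F w = integral (cbox a b) (\<lambda>\<mu>. of_real (J \<mu>) * (1 / (w - of_real \<mu>)))" if "w \<in> U" for w
    unfolding F_eq using integral_density[OF continuous_cauchy_kernel[OF U[OF that], of 1]] by simp
  have cJ: "continuous_on A (\<lambda>x. J (g x))" if "continuous_on A g" for A and g :: "complex \<times> real \<Rightarrow> real"
    using continuous_on_compose2[OF continuous_density that] by simp
  have "((\<lambda>w. integral (cbox a b) (\<lambda>\<mu>. of_real (J \<mu>) * (1 / (w - of_real \<mu>)))) has_field_derivative
      integral (cbox a b) (\<lambda>\<mu>. - (of_real (J \<mu>) * (1 / (z - of_real \<mu>)\<^sup>2)))) (at z within U)"
  proof (rule leibniz_rule_field_derivative[OF _ _ _ zU \<open>convex U\<close>])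
    fix w \<mu> assume w: "w \<in> U"
    show "((\<lambda>w. of_real (J \<mu>) * (1 / (w - of_real \<mu>))) has_field_derivative
        - (of_real (J \<mu>) * (1 / (w - of_real \<mu>)\<^sup>2))) (at w within U)"
      using nonreal_minus_real[OF U[OF w]] by (auto intro!: derivative_eq_intros simp: power2_eq_square)
  next
    fix w assume w: "w \<in> U"
    have "continuous_on {a..b} J" using continuous_density continuous_on_subset by blast
    then have "continuous_on {a..b} (\<lambda>\<mu>. of_real (J \<mu>) * (1 / (w - of_real \<mu>)))"
      using nonreal_minus_real[OF U[OF w]] by (intro continuous_intros) auto
    then show "(\<lambda>\<mu>. of_real (J \<mu>) * (1 / (w - of_real \<mu>))) integrable_on cbox a b"
      by (simp add: integrable_continuous_interval)
  next
    show "continuous_on (U \<times> cbox a b) (\<lambda>(w, \<mu>). - (of_real (J \<mu>) * (1 / (w - of_real \<mu>)\<^sup>2)))"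
      using nonreal_minus_real U unfolding split_beta
      by (intro continuous_intros cJ) auto
  qed
  also have "integral (cbox a b) (\<lambda>\<mu>. - (of_real (J \<mu>) * (1 / (z - of_real \<mu>)\<^sup>2))) = F' z"
    unfolding F'_eq using integral_density[OF continuous_cauchy_kernel[OF z, of 2]]
    by (simp add: integral_neg)
  finally have "((\<lambda>w. integral (cbox a b) (\<lambda>\<mu>. of_real (J \<mu>) * (1 / (w - of_real \<mu>)))) has_field_derivative F' z) (at z)"
    by (simp only: at_within_open[OF zU \<open>open U\<close>])
  then show ?thesis
    by (rule has_field_derivative_transform_within_open[OF _ \<open>open U\<close> zU]) (simp add: eq)
qed

lemma cauchy_transform_cnj: "F (cnj z) = cnj (F z)" "F' (cnj z) = cnj (F' z)"
proof -
  show "F (cnj z) = cnj (F z)"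
    unfolding F_def by (subst Bochner_Integration.integral_cnj[symmetric]) simp
  show "F' (cnj z) = cnj (F' z)"
    unfolding F'_def complex_cnj_minus by (subst Bochner_Integration.integral_cnj[symmetric]) simp
qed

lemma norm_minus_support:
  fixes z :: complex
  assumes "norm z \<ge> 2 * (\<bar>a\<bar> + \<bar>b\<bar> + 1)" "\<mu> \<in> {a..b}"
  shows "norm (z - of_real \<mu>) \<ge> norm z / 2"
proof -
  have "norm z - norm (complex_of_real \<mu>) \<le> norm (z - of_real \<mu>)" by (rule norm_triangle_ineq2)
  then show ?thesis using assms by auto
qed

definition decay_constant :: real where "decay_constant = 4 * B * (b - a)"

lemma decay_constant_nonneg: "0 \<le> decay_constant"
  using B_nonneg ab by (simp add: decay_constant_def)

lemma cauchy_transform_decay: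
  assumes z: "Im z \<noteq> 0" "norm z \<ge> 2 * (\<bar>a\<bar> + \<bar>b\<bar> + 1)"
  shows "norm (F z) \<le> decay_constant / norm z" "norm (F' z) \<le> decay_constant / (norm z)\<^sup>2"
proof -
  have pos: "norm z > 0" using z by auto
  have le: "norm (z - of_real \<mu>) \<ge> norm z / 2" if "\<mu> \<in> {a..b}" for \<mu>
    using norm_minus_support[OF z(2) that] .
  have nn: "B * (b - a) / norm z \<ge> 0" using B_nonneg ab by auto
  have "norm (F z) \<le> B * (2 / norm z) * (b - a)"
    unfolding F_eq
  proof (rule norm_integral_density_le)
    fix \<mu> assume "\<mu> \<in> {a..b}"
    have "1 / norm (z - of_real \<mu>) \<le> 1 / (norm z / 2)"
      using le[OF \<open>\<mu> \<in> {a..b}\<close>] pos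
      by (intro divide_left_mono mult_pos_pos) linarith+
    then show "norm (1 / (z - of_real \<mu>)) \<le> 2 / norm z" by (simp add: norm_divide)
  qed (use continuous_cauchy_kernel[OF z(1), of 1] in simp)
  then show "norm (F z) \<le> decay_constant / norm z"
  proof -
    have "B * (2 / norm z) * (b - a) = 2 * (B * (b - a) / norm z)"
      and "decay_constant / norm z = 4 * (B * (b - a) / norm z)"
      by (simp_all add: decay_constant_def)
    with nn \<open>norm (F z) \<le> _\<close> show ?thesis by linarith
  qed
  have "norm (F' z) \<le> B * (4 / (norm z)\<^sup>2) * (b - a)"
    unfolding F'_eq norm_minus_cancel
  proof (rule norm_integral_density_le)
    fix \<mu> assume "\<mu> \<in> {a..b}"
    have "(norm z / 2)\<^sup>2 \<le> (norm (z - of_real \<mu>))\<^sup>2"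
      using le[OF \<open>\<mu> \<in> {a..b}\<close>] by (intro power_mono) auto
    moreover have "0 < norm (z - of_real \<mu>)"
      using le[OF \<open>\<mu> \<in> {a..b}\<close>] pos by linarith
    ultimately have "1 / (norm (z - of_real \<mu>))\<^sup>2 \<le> 1 / (norm z / 2)\<^sup>2"
      using pos by (intro divide_left_mono mult_pos_pos zero_less_power) auto
    then show "norm (1 / (z - of_real \<mu>)\<^sup>2) \<le> 4 / (norm z)\<^sup>2"
      by (simp add: norm_divide norm_power power_divide)
  qed (use continuous_cauchy_kernel[OF z(1)] in simp)
  then show "norm (F' z) \<le> decay_constant / (norm z)\<^sup>2"
    by (simp add: decay_constant_def algebra_simps)
qed

text \<open>The substitution $\mu = x - yt$ turns the Cauchy kernel at height $y$ into the one at height 1.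
Limits at the real line thereby become limits of averages of \<open>J\<close> over shrinking
neighbourhoods.\<close>

lemma rescaled:
  assumes y: "0 < y"
  shows integrable_F_rescaled: "integrable lborel (\<lambda>t. J (x - y * t) *\<^sub>R (1 / (complex_of_real t + \<i>)))"
    and F_rescaled: "F (Complex x y) = (LINT t|lborel. J (x - y * t) *\<^sub>R (1 / (complex_of_real t + \<i>)))"
    and F'_rescaled: "of_real y * F' (Complex x y) = - (LINT t|lborel. J (x - y * t) *\<^sub>R (1 / (complex_of_real t + \<i>)\<^sup>2))"
proof -
  have z: "Complex x y - of_real (x + - y * t) = of_real y * (of_real t + \<i>)" for t
    by (simp add: complex_eq_iff algebra_simps)
  have ti: "of_real t + \<i> \<noteq> 0" for t by (simp add: complex_eq_iff)
  have y0: "Im (Complex x y) \<noteq> 0" using y by simp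
  have 1: "of_real y * (of_real (J (x + - y * t)) / (Complex x y - of_real (x + - y * t))) = J (x - y * t) *\<^sub>R (1 / (complex_of_real t + \<i>))" for t
    unfolding z using y ti by (simp add: scaleR_conv_of_real)
  have 2: "of_real y * (of_real (J (x + - y * t)) / (Complex x y - of_real (x + - y * t))\<^sup>2) = (1 / of_real y) * (J (x - y * t) *\<^sub>R (1 / (complex_of_real t + \<i>)\<^sup>2))" for t
    unfolding z using y ti by (simp add: scaleR_conv_of_real power2_eq_square)
  have "integrable lborel (\<lambda>\<mu>. of_real (J \<mu>) / (Complex x y - of_real \<mu>))"
    using integrable_density[OF continuous_cauchy_kernel[OF y0, of 1]] by simp
  from lborel_integrable_real_affine[OF this, of "-y" x] 
  have "integrable lborel (\<lambda>t. of_real y * (of_real (J (x + - y * t)) / (Complex x y - of_real (x + - y * t))))"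
    using y by (intro integrable_mult_right) auto
  then show "integrable lborel (\<lambda>t. J (x - y * t) *\<^sub>R (1 / (complex_of_real t + \<i>)))"
    unfolding 1 .
  have "F (Complex x y) = \<bar>-y\<bar> *\<^sub>R (LINT t|lborel. of_real (J (x + - y * t)) / (Complex x y - of_real (x + - y * t)))"
    unfolding F_def by (rule lborel_integral_real_affine) (use y in auto)
  also have "\<dots> = (LINT t|lborel. of_real y * (of_real (J (x + - y * t)) / (Complex x y - of_real (x + - y * t))))"
    using y by (simp only: integral_mult_right_zero scaleR_conv_of_real) simp
  finally show "F (Complex x y) = (LINT t|lborel. J (x - y * t) *\<^sub>R (1 / (complex_of_real t + \<i>)))"
    unfolding 1 .
  have "- F' (Complex x y) = \<bar>-y\<bar> *\<^sub>R (LINT t|lborel. of_real (J (x + - y * t)) / (Complex x y - of_real (x + - y * t))\<^sup>2)"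
    unfolding F'_def minus_minus by (rule lborel_integral_real_affine) (use y in auto)
  also have "\<dots> = (LINT t|lborel. of_real y * (of_real (J (x + - y * t)) / (Complex x y - of_real (x + - y * t))\<^sup>2))"
    using y by (simp only: integral_mult_right_zero scaleR_conv_of_real) simp
  also have "\<dots> = 1 / of_real y * (LINT t|lborel. J (x - y * t) *\<^sub>R (1 / (complex_of_real t + \<i>)\<^sup>2))"
    unfolding 2 by (simp only: integral_mult_right_zero)
  finally have "of_real y * - F' (Complex x y) = of_real y * (1 / of_real y) * (LINT t|lborel. J (x - y * t) *\<^sub>R (1 / (complex_of_real t + \<i>)\<^sup>2))"
    by (simp only: mult.assoc)
  then show "of_real y * F' (Complex x y) = - (LINT t|lborel. J (x - y * t) *\<^sub>R (1 / (complex_of_real t + \<i>)\<^sup>2))"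
    using y by (metis (no_types, lifting) minus_minus mult_minus_right mult_1 nonzero_mult_div_cancel_left of_real_eq_0_iff order_less_irrefl times_divide_eq_right mult.right_neutral)
qed

lemma parts_F_rescaled:
  assumes y: "0 < y"
  shows "Im (F (Complex x y)) = - (LINT t|lborel. J (x - y * t) *\<^sub>R (1 / (1 + t\<^sup>2)))"
    and "Re (F (Complex x y)) = (LINT t|lborel. J (x - y * t) *\<^sub>R (t / (1 + t\<^sup>2)))"
proof -
  have i: "Im (J (x - y * t) *\<^sub>R (1 / (complex_of_real t + \<i>))) = - (J (x - y * t) *\<^sub>R (1 / (1 + t\<^sup>2)))"
       "Re (J (x - y * t) *\<^sub>R (1 / (complex_of_real t + \<i>))) = J (x - y * t) *\<^sub>R (t / (1 + t\<^sup>2))" for t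
    by (simp_all add: Im_divide Re_divide add.commute)
  show "Im (F (Complex x y)) = - (LINT t|lborel. J (x - y * t) *\<^sub>R (1 / (1 + t\<^sup>2)))"
    unfolding F_rescaled[OF y] integral_Im[OF integrable_F_rescaled[OF y], symmetric] i by simp
  show "Re (F (Complex x y)) = (LINT t|lborel. J (x - y * t) *\<^sub>R (t / (1 + t\<^sup>2)))"
    unfolding F_rescaled[OF y] integral_Re[OF integrable_F_rescaled[OF y], symmetric] i by simp
qed

lemma integrable_rescaled:
  fixes K :: "real \<Rightarrow> 'a::{banach,second_countable_topology}"
  assumes K: "integrable lborel K"
  shows "integrable lborel (\<lambda>t. J (x - y * t) *\<^sub>R K t)"
proof (rule Bochner_Integration.integrable_bound)
  show "integrable lborel (\<lambda>t. B * norm (K t))" using K by auto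
  have [measurable]: "K \<in> borel_measurable borel" using K by auto
  show "(\<lambda>t. J (x - y * t) *\<^sub>R K t) \<in> borel_measurable lborel" by measurable
  show "AE t in lborel. norm (J (x - y * t) *\<^sub>R K t) \<le> norm (B * norm (K t))"
    using density_bound B_nonneg by (auto simp: abs_mult intro!: mult_right_mono)
qed

lemma Im_cauchy_transform_bound:
  assumes z: "0 < Im z"
  shows "\<bar>Im (F z)\<bar> \<le> pi * B"
proof -
  have "\<bar>LINT t|lborel. J (Re z - Im z * t) *\<^sub>R (1 / (1 + t\<^sup>2))\<bar> \<le> (LINT t|lborel. B * (1 / (1 + t\<^sup>2)))"
  proof (rule integral_abs_bound_integral)
    show "\<bar>J (Re z - Im z * t) *\<^sub>R (1 / (1 + t\<^sup>2))\<bar> \<le> B * (1 / (1 + t\<^sup>2))" for t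
      using density_bound by (auto simp: abs_mult abs_divide intro!: mult_right_mono divide_right_mono)
  qed (intro integrable_rescaled integrable_mult_right integrable_poisson_kernel)+
  also have "\<dots> = pi * B" by (subst integral_mult_right_zero) (simp add: integral_poisson_kernel)
  finally show ?thesis using parts_F_rescaled(1)[OF z, of "Re z"] by simp
qed

lemma cauchy_transform_derivative_bound:
  assumes z: "0 < Im z"
  shows "norm (F' z) \<le> pi * B / Im z"
proof -
  have "norm (LINT t|lborel. J (Re z - Im z * t) *\<^sub>R (1 / (complex_of_real t + \<i>)\<^sup>2)) \<le> (LINT t|lborel. B * (1 / (1 + t\<^sup>2)))"
  proof (rule Bochner_Integration.integral_norm_bound_integral)
    show "norm (J (Re z - Im z * t) *\<^sub>R (1 / (complex_of_real t + \<i>)\<^sup>2)) \<le> B * (1 / (1 + t\<^sup>2))" for t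
      using density_bound norm_of_real_plus_i_sq[of t] by (auto simp: norm_divide norm_power intro!: divide_right_mono)
  qed (intro integrable_rescaled integrable_mult_right integrable_poisson_kernel integrable_cauchy_square_kernel)+
  also have "\<dots> = pi * B" by (subst integral_mult_right_zero) (simp add: integral_poisson_kernel)
  finally have "norm (of_real (Im z) * F' z) \<le> pi * B"
    using F'_rescaled[OF z, of "Re z"] by simp
  then show ?thesis using z by (simp add: norm_mult field_simps)
qed

lemma boundary_sequenceE:
  assumes "\<forall>n. X n \<in> upper_half_plane - {complex_of_real x}" "X \<longlonglongrightarrow> complex_of_real x"
  shows "\<And>n. 0 < Im (X n)" "(\<lambda>n. Re (X n)) \<longlonglongrightarrow> x" "(\<lambda>n. Im (X n)) \<longlonglongrightarrow> 0"
  using assms tendsto_Re[OF assms(2)] tendsto_Im[OF assms(2)] by auto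

text \<open>The imaginary part is a Poisson integral, so it has boundary values wherever \<open>J\<close> is
continuous.\<close>

lemma Im_cauchy_transform_boundary:
  "((\<lambda>z. Im (F z)) \<longlongrightarrow> - pi * J x) (at (of_real x) within upper_half_plane)"
  unfolding tendsto_at_iff_sequentially
proof (intro allI impI)
  fix X assume X: "\<forall>n. X n \<in> upper_half_plane - {complex_of_real x}" "X \<longlonglongrightarrow> complex_of_real x"
  note X' = boundary_sequenceE[OF X]
  have "(\<lambda>n. - (LINT t|lborel. J (Re (X n) - Im (X n) * t) *\<^sub>R (1 / (1 + t\<^sup>2)))) \<longlonglongrightarrow> - (J x *\<^sub>R pi)"
    using tendsto_minus[OF approximate_identity[OF continuous_density density_bound integrable_poisson_kernel X'(2,3)]]
    by (simp only: integral_poisson_kernel)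
  moreover have "- (LINT t|lborel. J (Re (X n) - Im (X n) * t) *\<^sub>R (1 / (1 + t\<^sup>2))) = Im (F (X n))" for n
    using parts_F_rescaled(1)[OF X'(1)[of n], of "Re (X n)"] by simp
  ultimately show "((\<lambda>z. Im (F z)) \<circ> X) \<longlonglongrightarrow> - pi * J x"
    by (simp add: o_def mult.commute)
qed

text \<open>The trivial bound for the derivative is of order $1/y$. Continuity of the density improves it to
$o(1/y)$, because a constant density contributes nothing.\<close>

lemma cauchy_transform_derivative_boundary:
  "((\<lambda>z. of_real (Im z) * F' z) \<longlongrightarrow> 0) (at (of_real x) within upper_half_plane)"
  unfolding tendsto_at_iff_sequentially
proof (intro allI impI)
  fix X assume X: "\<forall>n. X n \<in> upper_half_plane - {complex_of_real x}" "X \<longlonglongrightarrow> complex_of_real x"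
  note X' = boundary_sequenceE[OF X]
  have "(\<lambda>n. - (LINT t|lborel. J (Re (X n) - Im (X n) * t) *\<^sub>R (1 / (complex_of_real t + \<i>)\<^sup>2))) \<longlonglongrightarrow> - (J x *\<^sub>R 0)"
    using tendsto_minus[OF approximate_identity[OF continuous_density density_bound integrable_cauchy_square_kernel X'(2,3)]]
    by (simp only: integral_cauchy_square_kernel)
  moreover have "- (LINT t|lborel. J (Re (X n) - Im (X n) * t) *\<^sub>R (1 / (complex_of_real t + \<i>)\<^sup>2)) = of_real (Im (X n)) * F' (X n)" for n
    using F'_rescaled[OF X'(1)[of n], of "Re (X n)"] by simp
  ultimately show "((\<lambda>z. of_real (Im z) * F' z) \<circ> X) \<longlonglongrightarrow> 0"
    by (simp add: o_def)
qed

lemma set_integrable_truncated: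
  assumes "0 < \<epsilon>"
  shows "set_integrable lborel {\<mu>. \<epsilon> \<le> \<bar>\<mu> - x\<bar>} (\<lambda>\<mu>. J \<mu> / (x - \<mu>))"
  unfolding set_integrable_def
proof (rule Bochner_Integration.integrable_bound)
  show "integrable lborel (\<lambda>\<mu>. indicator {a..b} \<mu> * (B / \<epsilon>))"
    by (intro integrable_mult_left integrable_real_indicator) (use ab in auto)
  show "AE \<mu> in lborel. norm (indicat_real {\<mu>. \<epsilon> \<le> \<bar>\<mu> - x\<bar>} \<mu> *\<^sub>R (J \<mu> / (x - \<mu>))) \<le> norm (indicator {a..b} \<mu> * (B / \<epsilon>))"
  proof (intro AE_I2)
    fix \<mu>
    have "\<bar>J \<mu>\<bar> / \<bar>x - \<mu>\<bar> \<le> B / \<epsilon>" if "\<epsilon> \<le> \<bar>\<mu> - x\<bar>"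
      using density_bound[of \<mu>] that assms B_nonneg by (intro frac_le) auto
    then show "norm (indicat_real {\<mu>. \<epsilon> \<le> \<bar>\<mu> - x\<bar>} \<mu> *\<^sub>R (J \<mu> / (x - \<mu>))) \<le> norm (indicator {a..b} \<mu> * (B / \<epsilon>))"
      using density_outside[of \<mu>] B_nonneg assms by (auto simp: indicator_def abs_divide)
  qed
qed measurable

lemma Re_F_minus_truncated:
  assumes y: "0 < y"
  shows "Re (F (Complex x y)) - (LINT \<mu>:{\<mu>. y \<le> \<bar>\<mu> - x\<bar>}|lborel. J \<mu> / (x - \<mu>))
         = (LINT t|lborel. J (x - y * t) *\<^sub>R truncation_kernel t)"
proof -
  let ?h = "\<lambda>\<mu>. indicat_real {\<mu>. y \<le> \<bar>\<mu> - x\<bar>} \<mu> *\<^sub>R (J \<mu> / (x - \<mu>))"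
  have h: "integrable lborel ?h"
    using set_integrable_truncated[OF y] by (simp add: set_integrable_def)
  have e: "y * ?h (x + - y * t) = J (x - y * t) *\<^sub>R (if 1 \<le> \<bar>t\<bar> then 1 / t else 0)" for t
    using y by (auto simp: indicator_def abs_mult)
  have "integrable lborel (\<lambda>t. y * ?h (x + - y * t))"
    by (intro integrable_mult_right lborel_integrable_real_affine[OF h]) (use y in auto)
  then have i1: "integrable lborel (\<lambda>t. J (x - y * t) *\<^sub>R (if 1 \<le> \<bar>t\<bar> then 1 / t else 0))"
    unfolding e .
  have i2: "integrable lborel (\<lambda>t. J (x - y * t) *\<^sub>R (t / (1 + t\<^sup>2)))"
    using integrable_Re[OF integrable_F_rescaled[OF y, of x]] by (simp add: Re_divide add.commute)
  have "(LINT \<mu>:{\<mu>. y \<le> \<bar>\<mu> - x\<bar>}|lborel. J \<mu> / (x - \<mu>)) = \<bar>-y\<bar> *\<^sub>R (LINT t|lborel. ?h (x + - y * t))"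
    unfolding set_lebesgue_integral_def by (rule lborel_integral_real_affine) (use y in auto)
  also have "\<dots> = (LINT t|lborel. y * ?h (x + - y * t))"
    using y by (simp only: integral_mult_right_zero) simp
  finally have t: "(LINT \<mu>:{\<mu>. y \<le> \<bar>\<mu> - x\<bar>}|lborel. J \<mu> / (x - \<mu>)) = (LINT t|lborel. J (x - y * t) *\<^sub>R (if 1 \<le> \<bar>t\<bar> then 1 / t else 0))"
    unfolding e .
  show ?thesis
    unfolding t parts_F_rescaled(2)[OF y]
    by (subst Bochner_Integration.integral_diff[OF i2 i1, symmetric])
       (simp add: truncation_kernel_def right_diff_distrib)
qed

text \<open>Truncating the integral at distance $y$ and moving the point to height $y$ are the same
regularisation up to the average of the density against \<^const>\<open>truncation_kernel\<close>, which
tends to 0. Existence of a principal value is therefore equivalent to existence of a vertical limit of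
the real part of the Cauchy transform, and this makes all principal values accessible to complex
analysis.\<close>

lemma has_principal_value_iff:
  "has_principal_value (\<lambda>\<mu>. J \<mu> / (x - \<mu>)) x I \<longleftrightarrow> ((\<lambda>y. Re (F (Complex x y))) \<longlongrightarrow> I) (at_right 0)"
proof -
  let ?T = "\<lambda>y. LINT \<mu>:{\<mu>. y \<le> \<bar>\<mu> - x\<bar>}|lborel. J \<mu> / (x - \<mu>)"
  have d: "((\<lambda>y. Re (F (Complex x y)) - ?T y) \<longlongrightarrow> 0) (at_right 0)"
    unfolding tendsto_at_iff_sequentially
  proof (intro allI impI)
    fix Y :: "nat \<Rightarrow> real" assume Y: "\<forall>n. Y n \<in> {0<..} - {0}" "Y \<longlonglongrightarrow> 0"
    have "(\<lambda>n. LINT t|lborel. J (x - Y n * t) *\<^sub>R truncation_kernel t) \<longlonglongrightarrow> J x *\<^sub>R 0"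
      using approximate_identity[OF continuous_density density_bound integrable_truncation_kernel tendsto_const Y(2), of x]
      by (simp only: integral_truncation_kernel)
    then show "((\<lambda>y. Re (F (Complex x y)) - ?T y) \<circ> Y) \<longlonglongrightarrow> 0"
      using Re_F_minus_truncated Y(1) by (simp add: o_def)
  qed
  have "(?T \<longlongrightarrow> I) (at_right 0) \<longleftrightarrow> ((\<lambda>y. Re (F (Complex x y))) \<longlongrightarrow> I) (at_right 0)"
    using tendsto_add[OF d, of ?T I] tendsto_diff[OF _ d, of "\<lambda>y. Re (F (Complex x y))" I] by auto
  then show ?thesis
    unfolding has_principal_value_def using set_integrable_truncated by auto
qed

lemma principal_value_eq:
  assumes "((\<lambda>y. Re (F (Complex x y))) \<longlongrightarrow> I) (at_right 0)"
  shows "principal_value (\<lambda>\<mu>. J \<mu> / (x - \<mu>)) x = I"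
  unfolding principal_value_def
  by (rule the_equality)
     (use assms tendsto_unique[OF trivial_limit_at_right_real] in \<open>auto simp: has_principal_value_iff\<close>)

text \<open>Integrating the bound $\pi B/y$ for the derivative down from height 1 gives logarithmic growth
at the line.\<close>

lemma cauchy_transform_bound:
  assumes z: "0 < Im z" "Im z < 1"
  shows "norm (F z) \<le> (B * (b - a) + 2 * pi * B) / sqrt (Im z)"
proof -
  define x y where "x = Re z" and "y = Im z"
  have y: "0 < y" "y < 1" using z by (auto simp: y_def)
  define f where "f = (\<lambda>s. F (of_real x + of_real s * \<i>))"
  have f': "(f has_vector_derivative \<i> * F' (of_real x + of_real s * \<i>)) (at s)" if "s > 0" for s
    unfolding f_def by (rule has_vector_derivative_along_line, rule cauchy_transform_has_derivative) (use that in auto)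
  have "norm (f 1 - f y) \<le> pi * B * ln 1 - pi * B * ln y"
  proof (rule differentiable_bound_general[OF y(2)])
    show "continuous_on {y..1} f"
      using y f' by (intro continuous_at_imp_continuous_on ballI has_vector_derivative_continuous[OF f']) auto
    show "continuous_on {y..1} (\<lambda>s. pi * B * ln s)"
      using y by (intro continuous_intros) auto
    show "((\<lambda>s. pi * B * ln s) has_vector_derivative pi * B / s) (at s)" if "y < s" "s < 1" for s
      using that y unfolding has_real_derivative_iff_has_vector_derivative[symmetric]
      by (auto intro!: derivative_eq_intros)
    show "norm (\<i> * F' (of_real x + of_real s * \<i>)) \<le> pi * B / s" if "y < s" "s < 1" for s
      using cauchy_transform_derivative_bound[of "of_real x + of_real s * \<i>"] that y by (simp add: norm_mult)
  qed (use y f' in auto)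
  moreover have "norm (f 1) \<le> B * 1 * (b - a)"
    unfolding f_def F_eq
  proof (rule norm_integral_density_le)
    show "continuous_on {a..b} (\<lambda>\<mu>. 1 / (of_real x + of_real 1 * \<i> - of_real \<mu>))"
      using continuous_cauchy_kernel[of "of_real x + of_real 1 * \<i>" 1] by simp
    fix \<mu>
    have "1 \<le> cmod (of_real x + of_real 1 * \<i> - of_real \<mu>)"
      using abs_Im_le_cmod[of "of_real x + of_real 1 * \<i> - of_real \<mu>"] by simp
    then show "norm (1 / (of_real x + of_real 1 * \<i> - of_real \<mu>)) \<le> 1"
      by (simp add: norm_divide divide_le_eq_1)
  qed
  moreover have "norm (f y) \<le> norm (f 1) + norm (f 1 - f y)"
    by (metis norm_minus_commute norm_triangle_sub)
  moreover have "pi * B * (- ln y) \<le> pi * B * (2 / sqrt y)"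
    using B_nonneg by (intro mult_left_mono minus_ln_le_inverse_sqrt y) auto
  moreover have "B * (b - a) \<le> B * (b - a) / sqrt y"
    using y B_nonneg ab by (simp add: le_divide_eq mult_left_le)
  moreover have "f y = F z" 
  proof -
    have "of_real x + of_real y * \<i> = z" by (simp add: complex_eq_iff x_def y_def)
    then show ?thesis by (simp add: f_def)
  qed
  ultimately show ?thesis by (simp add: add_divide_distrib y_def[symmetric] mult_ac)
qed

end

section \<open>Extension to the boundary\<close>

text \<open>A derivative of order $y^{-1/2}$ makes the function Hoelder continuous with exponent $1/2$ up to the
boundary: two points at distance $h$ are joined by going up by $h$, across, and down again, and each
of the three pieces costs a multiple of $\sqrt h$.\<close>

lemma hoelder_boundary_limit:
  fixes G G' :: "complex \<Rightarrow> complex"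
  assumes deriv: "\<And>z. 0 < Im z \<Longrightarrow> (G has_field_derivative G' z) (at z)"
    and bound: "\<And>z. 0 < Im z \<Longrightarrow> Im z < 1 \<Longrightarrow> \<bar>Re z\<bar> < N \<Longrightarrow> norm (G' z) \<le> C / sqrt (Im z)"
    and x: "\<bar>x\<bar> < N"
  shows "\<exists>l. (G \<longlongrightarrow> l) (at (of_real x) within upper_half_plane)"
proof -
  define X where "X = {z. \<bar>Re z\<bar> < N \<and> 0 < Im z \<and> Im z < 1/2}"
  have "0 \<le> C"
    using order_trans[OF norm_ge_zero bound[of "Complex x (1/4)"]] x by (simp add: zero_le_divide_iff)
  have vertical: "norm (G (z + of_real h * \<i>) - G (z + of_real 0 * \<i>)) \<le> 2 * C * sqrt h - 2 * C * sqrt 0"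
    if z: "z \<in> X" and h: "0 < h" "h < 1/2" for z h
  proof (rule differentiable_bound_general[OF h(1)])
    have d: "((\<lambda>s. G (z + of_real s * \<i>)) has_vector_derivative \<i> * G' (z + of_real s * \<i>)) (at s)" if "s \<ge> 0" for s
      by (rule has_vector_derivative_along_line, rule deriv) (use that z in \<open>auto simp: X_def\<close>)
    show "continuous_on {0..h} (\<lambda>s. G (z + of_real s * \<i>))"
      by (intro continuous_at_imp_continuous_on ballI has_vector_derivative_continuous[OF d]) auto
    show "((\<lambda>s. G (z + of_real s * \<i>)) has_vector_derivative \<i> * G' (z + of_real s * \<i>)) (at s)" if "0 < s" for s
      using d that by simp
    show "continuous_on {0..h} (\<lambda>s. 2 * C * sqrt s)" by (intro continuous_intros)
    show "((\<lambda>s. 2 * C * sqrt s) has_vector_derivative C / sqrt s) (at s)" if "0 < s" for s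
      using that unfolding has_real_derivative_iff_has_vector_derivative[symmetric]
      by (auto intro!: derivative_eq_intros simp: field_simps)
    show "norm (\<i> * G' (z + of_real s * \<i>)) \<le> C / sqrt s" if "0 < s" "s < h" for s
    proof -
      have "norm (G' (z + of_real s * \<i>)) \<le> C / sqrt (Im (z + of_real s * \<i>))"
        by (rule bound) (use that h z in \<open>auto simp: X_def\<close>)
      also have "\<dots> \<le> C / sqrt s"
        by (rule divide_left_mono) (use that z \<open>0 \<le> C\<close> in \<open>auto simp: X_def\<close>)
      finally show ?thesis by (simp add: norm_mult)
    qed
  qed
  have hoelder: "norm (G z - G w) \<le> 5 * C * sqrt (norm (z - w))"
    if z: "z \<in> X" and w: "w \<in> X" and zw: "norm (z - w) < 1/2" for z w
  proof (cases "z = w")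
    case False
    define h where "h = norm (z - w)"
    have h: "0 < h" "h < 1/2" using False zw by (auto simp: h_def)
    define T where "T = {\<zeta>. \<bar>Re \<zeta>\<bar> < N \<and> h \<le> Im \<zeta> \<and> Im \<zeta> < 1}"
    have "T = {\<zeta>. Re \<zeta> < N} \<inter> {\<zeta>. - N < Re \<zeta>} \<inter> {\<zeta>. Im \<zeta> \<ge> h} \<inter> {\<zeta>. Im \<zeta> < 1}"
      by (auto simp: T_def)
    then have "convex T"
      by (simp add: convex_Int convex_halfspace_Re_lt convex_halfspace_Re_gt convex_halfspace_Im_ge convex_halfspace_Im_lt)
    have "norm (G (z + of_real h * \<i>) - G (w + of_real h * \<i>)) \<le> C / sqrt h * norm ((z + of_real h * \<i>) - (w + of_real h * \<i>))"
    proof (rule field_differentiable_bound[OF \<open>convex T\<close>])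
      show "(G has_field_derivative G' \<zeta>) (at \<zeta> within T)" if "\<zeta> \<in> T" for \<zeta>
        by (rule has_field_derivative_at_within, rule deriv) (use that h in \<open>auto simp: T_def\<close>)
      show "norm (G' \<zeta>) \<le> C / sqrt h" if "\<zeta> \<in> T" for \<zeta>
      proof -
        have "norm (G' \<zeta>) \<le> C / sqrt (Im \<zeta>)"
          by (rule bound) (use that h in \<open>auto simp: T_def\<close>)
        also have "\<dots> \<le> C / sqrt h"
          by (rule divide_left_mono) (use that h \<open>0 \<le> C\<close> in \<open>auto simp: T_def\<close>)
        finally show ?thesis .
      qed
    qed (use z w h in \<open>auto simp: T_def X_def\<close>)
    also have "\<dots> = C * (h / sqrt h)" by (simp add: h_def)
    also have "\<dots> = C * sqrt h" using h by (simp add: real_div_sqrt)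
    finally have hor: "norm (G (z + of_real h * \<i>) - G (w + of_real h * \<i>)) \<le> C * sqrt h" .
    have "norm (G z - G w) = norm (- (G (z + of_real h * \<i>) - G z) + (G (z + of_real h * \<i>) - G (w + of_real h * \<i>)) + (G (w + of_real h * \<i>) - G w))"
      by simp
    also have "\<dots> \<le> norm (G (z + of_real h * \<i>) - G z) + norm (G (z + of_real h * \<i>) - G (w + of_real h * \<i>)) + norm (G (w + of_real h * \<i>) - G w)"
    proof -
      have "norm (- p + q + r) \<le> norm p + norm q + norm r" for p q r :: complex
        using norm_triangle_ineq[of "- p + q" r] norm_triangle_ineq[of "- p" q] norm_minus_cancel[of p]
        by linarith
      then show ?thesis .
    qed
    also have "\<dots> \<le> 2 * C * sqrt h + C * sqrt h + 2 * C * sqrt h"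
      using vertical[OF z h] vertical[OF w h] hor by simp
    finally show ?thesis by (simp add: h_def)
  qed simp
  have "uniformly_continuous_on X G"
    unfolding uniformly_continuous_on_def
  proof (intro allI impI)
    fix e :: real assume e: "0 < e"
    define d where "d = min (1/2) ((e / (5 * C + 1))\<^sup>2)"
    have "d > 0" using e \<open>0 \<le> C\<close> by (auto simp: d_def)
    moreover have "dist (G w) (G z) < e" if zw: "z \<in> X" "w \<in> X" "dist w z < d" for z w
    proof -
      have n: "norm (w - z) < 1/2" "norm (w - z) < (e / (5 * C + 1))\<^sup>2"
        using zw(3) by (auto simp: d_def dist_norm)
      have "sqrt (norm (w - z)) < e / (5 * C + 1)"
        using n(2) e \<open>0 \<le> C\<close> by (intro real_less_lsqrt) auto
      then have "(5 * C + 1) * sqrt (norm (w - z)) < e"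
        using \<open>0 \<le> C\<close> by (simp add: field_simps)
      moreover have "5 * C * sqrt (norm (w - z)) \<le> (5 * C + 1) * sqrt (norm (w - z))"
        by (intro mult_right_mono) auto
      ultimately show ?thesis
        using hoelder[OF zw(2,1) n(1)] by (simp add: dist_norm)
    qed
    ultimately show "\<exists>d>0. \<forall>z\<in>X. \<forall>w\<in>X. dist w z < d \<longrightarrow> dist (G w) (G z) < e" by blast
  qed
  moreover have "of_real x \<in> closure X"
    unfolding closure_approachable
  proof (intro allI impI)
    fix e :: real assume "0 < e"
    then show "\<exists>y\<in>X. dist y (complex_of_real x) < e"
      using x by (intro bexI[of _ "Complex x (min (e/2) (1/4))"])
                 (auto simp: X_def dist_norm complex_of_real_def norm_complex_def)
  qed
  ultimately obtain l where l: "(G \<longlongrightarrow> l) (at (of_real x) within X)"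
    by (rule uniformly_continuous_on_extension_at_closure)
  have "at (complex_of_real x) within upper_half_plane = at (of_real x) within X"
  proof (rule at_within_nhd)
    have "{z. \<bar>Re z\<bar> < N \<and> \<bar>Im z\<bar> < 1/2} = {z. Re z < N} \<inter> {z. - N < Re z} \<inter> {z. Im z < 1/2} \<inter> {z. - (1/2) < Im z}"
      by auto
    then show "open {z. \<bar>Re z\<bar> < N \<and> \<bar>Im z\<bar> < 1/2}"
      by (simp only:) (intro open_Int open_halfspace_Re_lt open_halfspace_Re_gt open_halfspace_Im_lt open_halfspace_Im_gt)
  qed (use x in \<open>auto simp: X_def\<close>)
  with l show ?thesis by auto
qed

text \<open>Where no limit from above exists, the value is arbitrary.\<close>

definition boundary_extension :: "(complex \<Rightarrow> complex) \<Rightarrow> complex \<Rightarrow> complex" where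
  "boundary_extension G z = (if 0 < Im z then G z else Lim (at z within upper_half_plane) G)"

lemma boundary_extension_upper [simp]: "0 < Im z \<Longrightarrow> boundary_extension G z = G z"
  by (simp add: boundary_extension_def)

lemma boundary_extension_eq:
  assumes "(G \<longlongrightarrow> l) (at (of_real x) within upper_half_plane)"
  shows "boundary_extension G (of_real x) = l"
  using tendsto_Lim[OF at_within_upper_half_plane_neq_bot assms] by (simp add: boundary_extension_def)

lemma tendsto_boundary_extension:
  assumes "\<exists>l. (G \<longlongrightarrow> l) (at (of_real x) within upper_half_plane)"
  shows "(G \<longlongrightarrow> boundary_extension G (of_real x)) (at (of_real x) within upper_half_plane)"
  using assms boundary_extension_eq by blast

lemma continuous_on_boundary_extension:
  assumes G: "continuous_on upper_half_plane G"
    and lim: "\<And>x. x \<in> A \<Longrightarrow> \<exists>l. (G \<longlongrightarrow> l) (at (of_real x) within upper_half_plane)"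
  shows "continuous_on (upper_half_plane \<union> of_real ` A) (boundary_extension G)"
  unfolding continuous_on_iff
proof (intro ballI allI impI)
  let ?H = "boundary_extension G"
  fix z e assume z: "z \<in> upper_half_plane \<union> of_real ` A" and e: "0 < (e::real)"
  show "\<exists>d>0. \<forall>w\<in>upper_half_plane \<union> of_real ` A. dist w z < d \<longrightarrow> dist (?H w) (?H z) < e"
  proof (cases "0 < Im z")
    case True
    have "continuous (at z) G"
      using G True by (simp add: continuous_on_eq_continuous_at open_halfspace_Im_gt)
    then obtain d where d: "d > 0" "\<And>w. dist w z < d \<Longrightarrow> dist (G w) (G z) < e"
      using e unfolding continuous_at_eps_delta by blast
    have "0 < Im w" if "dist w z < Im z" for w
      using that abs_Im_le_cmod[of "w - z"] by (simp add: dist_norm)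
    then show ?thesis
      using d True by (intro exI[of _ "min d (Im z)"]) auto
  next
    case False
    then obtain x where x: "x \<in> A" "z = of_real x" using z by auto
    have l: "(G \<longlongrightarrow> ?H z) (at z within upper_half_plane)"
      unfolding x by (rule tendsto_boundary_extension[OF lim[OF x(1)]])
    then obtain d where d: "d > 0" "\<And>w. 0 < Im w \<Longrightarrow> dist w z < d \<Longrightarrow> dist (G w) (?H z) < e / 2"
    proof -
      have "\<exists>d>0. \<forall>w\<in>upper_half_plane. 0 < dist w z \<and> dist w z < d \<longrightarrow> dist (G w) (?H z) < e / 2"
        using l e unfolding Lim_within by (blast intro: half_gt_zero)
      moreover have "0 < dist w z" if "0 < Im w" for w using that False by auto
      ultimately show ?thesis using that by blast
    qed
    have "dist (?H w) (?H z) < e" if w: "w \<in> upper_half_plane \<union> of_real ` A" "dist w z < d" for w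
    proof (cases "0 < Im w")
      case True
      then show ?thesis using d(2)[of w] w(2) e by auto
    next
      case False
      then obtain u where u: "u \<in> A" "w = of_real u" using w by auto
      have "((\<lambda>\<zeta>. dist (G \<zeta>) (?H z)) \<longlongrightarrow> dist (?H w) (?H z)) (at w within upper_half_plane)"
        unfolding u by (intro tendsto_dist tendsto_const tendsto_boundary_extension[OF lim[OF u(1)]])
      moreover have "eventually (\<lambda>\<zeta>. dist (G \<zeta>) (?H z) \<le> e / 2) (at w within upper_half_plane)"
        unfolding eventually_at
      proof (intro exI[of _ "d - dist w z"] conjI ballI impI)
        fix \<zeta> assume "\<zeta> \<in> upper_half_plane" "\<zeta> \<noteq> w \<and> dist \<zeta> w < d - dist w z"
        then show "dist (G \<zeta>) (?H z) \<le> e / 2"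
          using d(2)[of \<zeta>] dist_triangle[of \<zeta> z w] by auto
      qed (use w(2) in simp)
      ultimately have "dist (?H w) (?H z) \<le> e / 2"
        using at_within_upper_half_plane_neq_bot[of u] u by (intro tendsto_upperbound) auto
      then show ?thesis using e by simp
    qed
    then show ?thesis using d(1) by blast
  qed
qed

text \<open>The fundamental theorem of calculus for a boundary function whose derivative exists only off a
finite set: it is inherited from horizontal lines that descend to the boundary.\<close>

lemma FTC_dominated_limit:
  fixes g g' :: "nat \<Rightarrow> real \<Rightarrow> 'a::euclidean_space" and w :: "real \<Rightarrow> real"
  assumes uv: "u \<le> v"
    and deriv: "\<And>n x. (g n has_vector_derivative g' n x) (at x)"
    and cont: "\<And>n. continuous_on UNIV (g' n)"
    and E: "finite E" and w: "set_integrable lborel {u..v} w" and k [measurable]: "k \<in> borel_measurable borel"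
    and lim: "\<And>x. x \<in> {u..v} - E \<Longrightarrow> (\<lambda>n. g' n x) \<longlonglongrightarrow> k x"
    and bound: "\<And>n x. x \<in> {u..v} - E \<Longrightarrow> norm (g' n x) \<le> w x"
    and ends: "(\<lambda>n. g n u) \<longlonglongrightarrow> lu" "(\<lambda>n. g n v) \<longlonglongrightarrow> lv"
  shows "set_integrable lborel {u..v} k" "(LINT x:{u..v}|lborel. k x) = lv - lu"
proof -
  have ae: "AE x in lborel. x \<notin> E"
    using finite_imp_null_set_lborel[OF E] by (rule AE_not_in)
  have [measurable]: "g' n \<in> borel_measurable borel" for n
    using cont[of n] by (rule borel_measurable_continuous_onI)
  have w': "integrable lborel (\<lambda>x. indicator {u..v} x *\<^sub>R w x)"
    using w by (simp add: set_integrable_def)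
  have lim': "AE x in lborel. (\<lambda>n. indicat_real {u..v} x *\<^sub>R g' n x) \<longlonglongrightarrow> indicator {u..v} x *\<^sub>R k x"
    using ae lim by (auto elim!: eventually_mono simp: indicator_def)
  have bound': "AE x in lborel. norm (indicat_real {u..v} x *\<^sub>R g' n x) \<le> indicator {u..v} x *\<^sub>R w x" for n
    using ae bound by (auto elim!: eventually_mono simp: indicator_def)
  show "set_integrable lborel {u..v} k"
    unfolding set_integrable_def
    by (rule integrable_dominated_convergence[OF _ _ w' lim' bound']) auto
  have "(\<lambda>n. LINT x:{u..v}|lborel. g' n x) \<longlonglongrightarrow> (LINT x:{u..v}|lborel. k x)"
    unfolding set_lebesgue_integral_def
    by (rule integral_dominated_convergence[OF _ _ w' lim' bound']) auto
  moreover have "(LINT x:{u..v}|lborel. g' n x) = g n v - g n u" for n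
  proof -
    have "continuous_on {u..v} (g' n)" using cont continuous_on_subset by blast
    then have "set_integrable lborel {u..v} (g' n)" by (rule borel_integrable_atLeastAtMost')
    moreover have "(g' n has_integral g n v - g n u) {u..v}"
      by (rule fundamental_theorem_of_calculus[OF uv])
         (use deriv in \<open>auto intro: has_vector_derivative_at_within\<close>)
    ultimately show ?thesis
      using set_borel_integral_eq_integral(2) by (metis integral_unique)
  qed
  ultimately have "(\<lambda>n. g n v - g n u) \<longlonglongrightarrow> (LINT x:{u..v}|lborel. k x)" by simp
  moreover have "(\<lambda>n. g n v - g n u) \<longlonglongrightarrow> lv - lu"
    by (intro tendsto_diff ends)
  ultimately show "(LINT x:{u..v}|lborel. k x) = lv - lu"
    by (rule LIMSEQ_unique)
qed

section \<open>The potential of the density\<close>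

lemma Complex_horizontal: "Complex x y = \<i> * of_real y + of_real x * 1"
  and Complex_vertical: "Complex x y = of_real x + of_real y * \<i>"
  by (simp_all add: complex_eq_iff)

lemma convex_upper_half_plane: "convex upper_half_plane"
  and open_upper_half_plane: "open upper_half_plane"
  using convex_halfspace_Im_gt[of 0] open_halfspace_Im_gt[of 0] by simp_all

context compact_density
begin

lemma cauchy_transform_holomorphic: "F holomorphic_on {z. Im z \<noteq> 0}"
  unfolding holomorphic_on_open[OF open_nonreal] using cauchy_transform_has_derivative by auto

text \<open>A primitive of the Cauchy transform, that is, a complex logarithmic potential of the density up to a
constant. Unlike the Cauchy transform it is continuous up to the real line for every continuous
density, which the reflection principle requires.\<close>

definition \<Phi> :: "complex \<Rightarrow> complex" where
  "\<Phi> = (SOME \<Phi>. \<forall>z. 0 < Im z \<longrightarrow> (\<Phi> has_field_derivative F z) (at z))"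

lemma potential_has_derivative:
  assumes "0 < Im z"
  shows "(\<Phi> has_field_derivative F z) (at z)"
proof -
  have "F holomorphic_on upper_half_plane"
    by (rule holomorphic_on_subset[OF cauchy_transform_holomorphic]) auto
  then obtain G where "\<And>z. z \<in> upper_half_plane \<Longrightarrow> (G has_field_derivative F z) (at z within upper_half_plane)"
    using holomorphic_convex_primitive'[OF convex_upper_half_plane open_upper_half_plane] by blast
  then have "\<forall>z. 0 < Im z \<longrightarrow> (G has_field_derivative F z) (at z)"
    using at_within_open[OF _ open_upper_half_plane] by (metis mem_Collect_eq)
  then have "\<forall>z. 0 < Im z \<longrightarrow> (\<Phi> has_field_derivative F z) (at z)"
    unfolding \<Phi>_def by (rule someI[where P="\<lambda>\<Phi>. \<forall>z. 0 < Im z \<longrightarrow> (\<Phi> has_field_derivative F z) (at z)"])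
  with assms show ?thesis by blast
qed

lemma potential_boundary_limit:
  "(\<Phi> \<longlongrightarrow> boundary_extension \<Phi> (of_real x)) (at (of_real x) within upper_half_plane)"
proof (rule tendsto_boundary_extension, rule hoelder_boundary_limit)
  show "norm (F z) \<le> (B * (b - a) + 2 * pi * B) / sqrt (Im z)" if "0 < Im z" "Im z < 1" for z
    using cauchy_transform_bound that .
  show "\<bar>x\<bar> < \<bar>x\<bar> + 1" by simp
qed (use potential_has_derivative in auto)

lemma continuous_on_potential: "continuous_on {z. 0 \<le> Im z} (boundary_extension \<Phi>)"
proof -
  have "continuous_on (upper_half_plane \<union> of_real ` UNIV) (boundary_extension \<Phi>)"
  proof (rule continuous_on_boundary_extension)
    show "continuous_on upper_half_plane \<Phi>"
      by (intro continuous_at_imp_continuous_on ballI DERIV_isCont[OF potential_has_derivative]) auto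
  qed (use potential_boundary_limit in blast)
  then show ?thesis
    by (rule continuous_on_subset) (auto simp: complex_eq_iff image_iff)
qed

text \<open>Wherever the principal value exists it is the derivative of the real part of the potential along the
real line. The increment from $x$ to $x+h$ is computed along a detour at height $|h|$: the two
vertical pieces cancel up to $o(h)$ since the imaginary part of \<open>F\<close> is nearly $-\pi J(x)$
on both, and along the horizontal piece \<open>F\<close> varies by $o(1)$ since its derivative is
$o(1/|h|)$ there.\<close>

lemma potential_has_boundary_derivative:
  assumes I: "((\<lambda>y. Re (F (Complex x y))) \<longlongrightarrow> I) (at_right 0)"
  shows "((\<lambda>t. Re (boundary_extension \<Phi> (of_real t))) has_real_derivative I) (at x)"
  unfolding has_field_derivative_def has_derivative_at_alt
proof (intro conjI allI impI)
  show "bounded_linear ((*) I)" by (rule bounded_linear_mult_right)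
  fix e :: real assume e: "0 < e"
  \<comment> \<open>four errors of relative size \<open>\<epsilon>\<close>: two vertical pieces, the horizontal piece, and the principal value\<close>
  define \<epsilon> where "\<epsilon> = e / 4"
  have \<epsilon>: "0 < \<epsilon>" using e by (simp add: \<epsilon>_def)
  let ?L = "\<lambda>t. Re (boundary_extension \<Phi> (of_real t))"
  obtain d1 where d1: "d1 > 0" "\<And>z. 0 < Im z \<Longrightarrow> dist z (of_real x) < d1 \<Longrightarrow> \<bar>Im (F z) + pi * J x\<bar> < \<epsilon>"
  proof -
    have "\<exists>d>0. \<forall>z\<in>upper_half_plane. 0 < dist z (of_real x) \<and> dist z (of_real x) < d \<longrightarrow> dist (Im (F z)) (- pi * J x) < \<epsilon>"
      using Im_cauchy_transform_boundary[of x] \<epsilon> unfolding Lim_within by blast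
    moreover have "0 < dist z (of_real x)" if "0 < Im z" for z using that by auto
    ultimately show ?thesis using that by (auto simp: dist_real_def)
  qed
  obtain d2 where d2: "d2 > 0" "\<And>z. 0 < Im z \<Longrightarrow> dist z (of_real x) < d2 \<Longrightarrow> Im z * norm (F' z) < \<epsilon>"
  proof -
    have "\<exists>d>0. \<forall>z\<in>upper_half_plane. 0 < dist z (of_real x) \<and> dist z (of_real x) < d \<longrightarrow> dist (of_real (Im z) * F' z) 0 < \<epsilon>"
      using cauchy_transform_derivative_boundary[of x] \<epsilon> unfolding Lim_within by blast
    moreover have "0 < dist z (of_real x)" if "0 < Im z" for z using that by auto
    ultimately show ?thesis using that by (auto simp: norm_mult)
  qed
  obtain d3 where d3: "d3 > 0" "\<And>s. 0 < s \<Longrightarrow> s < d3 \<Longrightarrow> \<bar>Re (F (Complex x s)) - I\<bar> < \<epsilon>"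
    using tendstoD[OF I \<epsilon>] unfolding eventually_at_right_field by (auto simp: dist_real_def)
  define d where "d = min (min d1 d2 / 2) d3"
  have d: "0 < d" "2 * d \<le> d1" "2 * d \<le> d2" "d \<le> d3" using d1 d2 d3 by (auto simp: d_def)
  have near: "dist (Complex x' s) (of_real x) < 2 * d" if "\<bar>x' - x\<bar> < d" "0 < s" "s < d" for x' s
    using cmod_le[of "Complex x' s - of_real x"] that by (simp add: dist_norm)
  have vertical: "\<bar>Re (\<Phi> (Complex x' s)) - ?L x' - pi * J x * s\<bar> \<le> \<epsilon> * s"
    if x': "\<bar>x' - x\<bar> < d" and s: "0 < s" "s < d" for x' s
  proof -
    define f where "f = (\<lambda>t. Re (\<Phi> (Complex x' t)) - pi * J x * t)"
    have f': "(f has_real_derivative - (Im (F (Complex x' t)) + pi * J x)) (at t)" if "0 < t" for t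
    proof -
      have "((\<lambda>t. \<Phi> (Complex x' t)) has_vector_derivative \<i> * F (Complex x' t)) (at t)"
        unfolding Complex_vertical
        by (rule has_vector_derivative_along_line, rule potential_has_derivative) (use that in auto)
      then have "((\<lambda>t. Re (\<Phi> (Complex x' t))) has_real_derivative Re (\<i> * F (Complex x' t))) (at t)"
        unfolding has_real_derivative_iff_has_vector_derivative
        by (rule bounded_linear.has_vector_derivative[OF bounded_linear_Re])
      from DERIV_diff[OF this DERIV_cmult_Id[of "pi * J x"]]
      show ?thesis unfolding f_def by simp
    qed
    have le: "\<bar>f s - f \<eta>\<bar> \<le> \<epsilon> * s" if \<eta>: "0 < \<eta>" "\<eta> < s" for \<eta>
    proof -
      have "norm (f s - f \<eta>) \<le> \<epsilon> * norm (s - \<eta>)"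
      proof (rule field_differentiable_bound[of "{\<eta>..s}"])
        show "(f has_real_derivative - (Im (F (Complex x' t)) + pi * J x)) (at t within {\<eta>..s})" if "t \<in> {\<eta>..s}" for t
          by (rule has_field_derivative_at_within, rule f') (use that \<eta> in auto)
        show "norm (- (Im (F (Complex x' t)) + pi * J x)) \<le> \<epsilon>" if "t \<in> {\<eta>..s}" for t
        proof -
          have t: "0 < t" "t < d" using that \<eta> s by auto
          show ?thesis using d1(2)[of "Complex x' t"] near[OF x' t] t d(2) by simp
        qed
      qed (use \<eta> in auto)
      also have "\<dots> \<le> \<epsilon> * s" using \<eta> \<epsilon> by (intro mult_left_mono) auto
      finally show ?thesis by simp
    qed
    have "((\<lambda>\<eta>. \<Phi> (Complex x' \<eta>)) \<longlongrightarrow> boundary_extension \<Phi> (of_real x')) (at_right 0)"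
      by (rule tendsto_at_right_vertical_line[OF potential_boundary_limit])
    then have "((\<lambda>\<eta>. \<bar>f s - f \<eta>\<bar>) \<longlongrightarrow> \<bar>f s - (?L x' - pi * J x * 0)\<bar>) (at_right 0)"
      unfolding f_def by (intro tendsto_intros)
    moreover have "eventually (\<lambda>\<eta>. \<bar>f s - f \<eta>\<bar> \<le> \<epsilon> * s) (at_right 0)"
      unfolding eventually_at_right_field using le s by (intro exI[of _ s]) auto
    ultimately have "\<bar>f s - (?L x' - pi * J x * 0)\<bar> \<le> \<epsilon> * s"
      by (rule tendsto_upperbound) simp
    then show ?thesis by (simp add: f_def algebra_simps)
  qed
  show "\<exists>d>0. \<forall>y. norm (y - x) < d \<longrightarrow> norm (?L y - ?L x - I * (y - x)) \<le> e * norm (y - x)"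
  proof (intro exI[of _ d] conjI allI impI d(1))
    fix y assume y: "norm (y - x) < d"
    define h s where "h = y - x" and "s = \<bar>h\<bar>"
    show "norm (?L y - ?L x - I * (y - x)) \<le> e * norm (y - x)"
    proof (cases "h = 0")
      case False
      have s: "0 < s" "s < d" using False y by (auto simp: s_def h_def)
      define z0 z1 where "z0 = Complex x s" and "z1 = Complex y s"
      define S where "S = closed_segment z0 z1"
      have S: "Im \<zeta> = s" "\<bar>Re \<zeta> - x\<bar> \<le> \<bar>h\<bar>" if \<zeta>: "\<zeta> \<in> S" for \<zeta>
      proof -
        obtain u where u: "0 \<le> u" "u \<le> 1" "\<zeta> = (1 - u) *\<^sub>R z0 + u *\<^sub>R z1"
          using \<zeta> unfolding S_def in_segment by blast
        show "Im \<zeta> = s" unfolding u(3) z0_def z1_def by (simp add: algebra_simps)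
        have "Re \<zeta> - x = u * h" unfolding u(3) z0_def z1_def h_def by (simp add: algebra_simps)
        then show "\<bar>Re \<zeta> - x\<bar> \<le> \<bar>h\<bar>" using u by (simp add: abs_mult mult_left_le_one_le)
      qed
      have SC: "\<zeta> = Complex (Re \<zeta>) s" "\<bar>Re \<zeta> - x\<bar> < d" if "\<zeta> \<in> S" for \<zeta>
        using S[OF that] s by (auto simp: complex_eq_iff s_def)
      have zS: "z0 \<in> S" "z1 \<in> S" "convex S" by (auto simp: S_def)
      have z10: "z1 - z0 = of_real h" by (simp add: z0_def z1_def h_def complex_eq_iff)
      \<comment> \<open>along the horizontal piece the Cauchy transform is nearly constant\<close>
      have FS: "norm (F \<zeta> - F z0) \<le> \<epsilon>" if \<zeta>: "\<zeta> \<in> S" for \<zeta>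
      proof -
        have "norm (F \<zeta> - F z0) \<le> \<epsilon> / s * norm (\<zeta> - z0)"
        proof (rule field_differentiable_bound[OF zS(3)])
          fix w assume w: "w \<in> S"
          show "(F has_field_derivative F' w) (at w within S)"
            by (rule has_field_derivative_at_within, rule cauchy_transform_has_derivative) (use S[OF w] s in auto)
          have "s * norm (F' w) < \<epsilon>"
            using d2(2)[of w] near[OF SC(2)[OF w] s] SC(1)[OF w] S(1)[OF w] s d by simp
          then show "norm (F' w) \<le> \<epsilon> / s" using s by (simp add: field_simps)
        qed (use \<zeta> zS in auto)
        also have "norm (\<zeta> - z0) = \<bar>Re \<zeta> - x\<bar>"
          using S(1)[OF \<zeta>] by (simp add: cmod_eq_Re z0_def)
        also have "\<epsilon> / s * \<bar>Re \<zeta> - x\<bar> \<le> \<epsilon> / s * s"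
          using S(2)[OF \<zeta>] \<epsilon> s by (intro mult_left_mono) (auto simp: s_def)
        finally show ?thesis using s by simp
      qed
      have "norm ((\<Phi> z1 - F z0 * z1) - (\<Phi> z0 - F z0 * z0)) \<le> \<epsilon> * norm (z1 - z0)"
      proof (rule field_differentiable_bound[OF zS(3)])
        fix w assume w: "w \<in> S"
        have "(\<Phi> has_field_derivative F w) (at w within S)"
          by (rule has_field_derivative_at_within, rule potential_has_derivative) (use S[OF w] s in auto)
        then show "((\<lambda>w. \<Phi> w - F z0 * w) has_field_derivative F w - F z0) (at w within S)"
          by (auto intro!: derivative_eq_intros)
        show "norm (F w - F z0) \<le> \<epsilon>" by (rule FS[OF w])
      qed (use zS in auto)
      also have "\<epsilon> * norm (z1 - z0) = \<epsilon> * s" by (simp add: z10 s_def)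
      also have "(\<Phi> z1 - F z0 * z1) - (\<Phi> z0 - F z0 * z0) = \<Phi> z1 - \<Phi> z0 - F z0 * (z1 - z0)"
        by (simp add: algebra_simps)
      finally have "norm (\<Phi> z1 - \<Phi> z0 - F z0 * of_real h) \<le> \<epsilon> * s" unfolding z10 .
      then have hor: "\<bar>Re (\<Phi> z1) - Re (\<Phi> z0) - Re (F z0) * h\<bar> \<le> \<epsilon> * s"
        using abs_Re_le_cmod[of "\<Phi> z1 - \<Phi> z0 - F z0 * of_real h"] by simp
      have "\<bar>(Re (F z0) - I) * h\<bar> \<le> \<epsilon> * s"
        unfolding abs_mult s_def[symmetric] z0_def
        using d3(2)[of s] s d by (intro mult_right_mono) auto
      then have der: "\<bar>Re (F z0) * h - I * h\<bar> \<le> \<epsilon> * s" by (simp add: algebra_simps)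
      have "\<bar>?L y - ?L x - I * h\<bar> \<le> 4 * (\<epsilon> * s)"
        using vertical[of y s] vertical[of x s] y s d(1) hor der
        unfolding z0_def z1_def by simp
      then show ?thesis by (simp add: \<epsilon>_def s_def h_def)
    qed (simp add: h_def)
  qed
qed

lemma Im_potential_increment:
  assumes uv: "u \<le> v" and c: "\<And>x. x \<in> {u..v} \<Longrightarrow> J x = c"
  shows "Im (boundary_extension \<Phi> (of_real v)) - Im (boundary_extension \<Phi> (of_real u)) = - pi * c * (v - u)"
proof -
  define \<eta> :: "nat \<Rightarrow> real" where "\<eta> n = inverse (of_nat (Suc n))" for n
  have \<eta>: "\<And>n. 0 < \<eta> n" by (simp add: \<eta>_def)
  have lim: "(\<lambda>n. f (Complex x (\<eta> n))) \<longlonglongrightarrow> l"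
    if "(f \<longlongrightarrow> l) (at (of_real x) within upper_half_plane)" for f and l :: real and x
    unfolding \<eta>_def by (rule LIMSEQ_vertical_line[OF that])
  have "(LINT x:{u..v}|lborel. - pi * J x) = Im (boundary_extension \<Phi> (of_real v)) - Im (boundary_extension \<Phi> (of_real u))"
  proof (rule FTC_dominated_limit(2)[OF uv, where E="{}" and w="\<lambda>_. pi * B"])
    show "((\<lambda>x. Im (\<Phi> (Complex x (\<eta> n)))) has_vector_derivative Im (F (Complex x (\<eta> n)))) (at x)" for n x
    proof -
      have "((\<lambda>x. \<Phi> (Complex x (\<eta> n))) has_vector_derivative 1 * F (Complex x (\<eta> n))) (at x)"
        unfolding Complex_horizontal
        by (rule has_vector_derivative_along_line, rule potential_has_derivative) (use \<eta> in auto)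
      from bounded_linear.has_vector_derivative[OF bounded_linear_Im this] show ?thesis by simp
    qed
    show "continuous_on UNIV (\<lambda>x. Im (F (Complex x (\<eta> n))))" for n
    proof -
      have "continuous_on UNIV (\<lambda>x. F (Complex x (\<eta> n)))"
        by (rule continuous_on_compose2[OF holomorphic_on_imp_continuous_on[OF cauchy_transform_holomorphic]])
           (use \<eta>[of n] in \<open>auto simp: Complex_horizontal intro!: continuous_intros\<close>)
      then show ?thesis by (intro continuous_intros)
    qed
    show "(\<lambda>n. Im (F (Complex x (\<eta> n)))) \<longlonglongrightarrow> - pi * J x" for x
      by (rule lim[OF Im_cauchy_transform_boundary])
    show "norm (Im (F (Complex x (\<eta> n)))) \<le> pi * B" for x n
      using Im_cauchy_transform_bound[of "Complex x (\<eta> n)"] \<eta> by simp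
    show "(\<lambda>n. Im (\<Phi> (Complex u (\<eta> n)))) \<longlonglongrightarrow> Im (boundary_extension \<Phi> (of_real u))"
      and "(\<lambda>n. Im (\<Phi> (Complex v (\<eta> n)))) \<longlonglongrightarrow> Im (boundary_extension \<Phi> (of_real v))"
      by (rule lim[OF tendsto_Im[OF potential_boundary_limit]])+
    show "set_integrable lborel {u..v} (\<lambda>_. pi * B)"
      by (intro borel_integrable_atLeastAtMost' continuous_intros)
  qed auto
  moreover have "(LINT x:{u..v}|lborel. - pi * J x) = (LINT x:{u..v}|lborel. - pi * c)"
    by (rule set_lebesgue_integral_cong) (use c in auto)
  moreover have "(LINT x:{u..v}|lborel. - pi * c) = - pi * c * (v - u)"
    using uv by (simp add: set_lebesgue_integral_def)
  ultimately show ?thesis by simp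
qed

end

section \<open>Reflection across bands and gaps\<close>

lemma deriv_real_on_reals:
  assumes S: "open S" and f: "f holomorphic_on S" and real: "\<And>z. z \<in> S \<Longrightarrow> z \<in> \<real> \<Longrightarrow> f z \<in> \<real>"
    and z: "z \<in> S" "z \<in> \<real>"
  shows "deriv f z \<in> \<real>"
proof -
  obtain t where t: "z = of_real t" using z(2) by (auto elim: Reals_cases)
  define T where "T = complex_of_real -` S"
  have T: "open T" "t \<in> T"
    using z(1) t S by (auto simp: T_def intro!: continuous_open_vimage continuous_intros)
  have "(f has_field_derivative deriv f z) (at (0 + of_real t * 1))"
    using holomorphic_derivI[OF f S z(1)] t by simp
  from bounded_linear.has_vector_derivative[OF bounded_linear_Im has_vector_derivative_along_line[OF this]]
  have "((\<lambda>s. Im (f (of_real s))) has_real_derivative Im (deriv f z)) (at t)"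
    by (simp add: has_real_derivative_iff_has_vector_derivative)
  then have "((\<lambda>_. 0) has_real_derivative Im (deriv f z)) (at t)"
    by (rule has_field_derivative_transform_within_open[OF _ T])
       (use real in \<open>auto simp: T_def complex_is_Real_iff\<close>)
  then have "Im (deriv f z) = 0"
    using DERIV_unique[OF _ DERIV_const] by blast
  then show ?thesis by (simp add: complex_is_Real_iff)
qed

context compact_density
begin

text \<open>If the potential differs from a quadratic polynomial by a function that is real on an interval, up to
the constant factor \<open>\<omega>\<close>, then it continues analytically across the interval by
reflection. The derivative \<open>F'\<close> is its second derivative and inherits both the
continuation and the reality.\<close>

lemma reflect_second_derivative:
  fixes k :: complex
  assumes r: "0 < r" and \<omega>: "\<omega> \<noteq> 0"
    and real: "\<And>t. \<bar>t - x\<bar> < r \<Longrightarrow>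
      \<omega> * (boundary_extension \<Phi> (of_real t) - (A / 2 * (of_real t)\<^sup>2 + k * of_real t + m)) \<in> \<real>"
  shows "\<exists>H. H holomorphic_on ball (of_real x) r \<and>
    (\<forall>z\<in>ball (of_real x) r. 0 < Im z \<longrightarrow> H z = F' z - A) \<and>
    (\<forall>t. \<bar>t - x\<bar> < r \<longrightarrow> \<omega> * H (of_real t) \<in> \<real>)"
proof -
  define S where "S = ball (complex_of_real x) r"
  define \<Psi> where "\<Psi> z = \<omega> * (boundary_extension \<Phi> z - (A / 2 * z\<^sup>2 + k * z + m))" for z
  define W where "W z = (if 0 \<le> Im z then \<Psi> z else cnj (\<Psi> (cnj z)))" for z
  have S: "open S" by (simp add: S_def)
  have tS: "of_real t \<in> S \<longleftrightarrow> \<bar>t - x\<bar> < r" for t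
    by (simp add: S_def dist_of_real dist_real_def abs_minus_commute)
  have d\<Phi>: "(boundary_extension \<Phi> has_field_derivative F z) (at z)" if "0 < Im z" for z
    by (rule has_field_derivative_transform_within_open[OF potential_has_derivative[OF that] open_upper_half_plane])
       (use that in auto)
  have d\<Psi>: "(\<Psi> has_field_derivative \<omega> * (F z - (A * z + k))) (at z)" if "0 < Im z" for z
    unfolding \<Psi>_def by (rule derivative_eq_intros d\<Phi> that refl | simp)+
  have W: "W holomorphic_on S"
    unfolding W_def
  proof (rule Schwarz_reflection[OF S])
    show "cnj ` S \<subseteq> S"
    proof safe
      fix z assume "z \<in> S"
      moreover have "cmod (of_real x - cnj z) = cmod (of_real x - z)"
        by (metis complex_cnj_complex_of_real complex_cnj_diff complex_mod_cnj)
      ultimately show "cnj z \<in> S" by (simp add: S_def dist_norm)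
    qed
    show "\<Psi> holomorphic_on S \<inter> {z. 0 < Im z}"
      using d\<Psi> open_Int[OF S open_upper_half_plane] by (auto simp: holomorphic_on_open)
    show "continuous_on (S \<inter> {z. 0 \<le> Im z}) \<Psi>"
      unfolding \<Psi>_def
      by (intro continuous_intros continuous_on_subset[OF continuous_on_potential]) auto
    show "\<Psi> z \<in> \<real>" if z: "z \<in> S" "z \<in> \<real>" for z
    proof -
      obtain t where "z = of_real t" using z(2) by (auto elim: Reals_cases)
      then show ?thesis using real[of t] tS[of t] z(1) by (simp add: \<Psi>_def)
    qed
  qed
  have Wreal: "W z \<in> \<real>" if z: "z \<in> S" "z \<in> \<real>" for z
  proof -
    obtain t where "z = of_real t" using z(2) by (auto elim: Reals_cases)
    then show ?thesis using real[of t] tS[of t] z(1) by (simp add: W_def \<Psi>_def)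
  qed
  have W': "deriv W holomorphic_on S" by (rule holomorphic_deriv[OF W S])
  define H where "H z = deriv (deriv W) z / \<omega>" for z
  have W1: "deriv W z = \<omega> * (F z - (A * z + k))" if "0 < Im z" for z
    by (rule DERIV_imp_deriv, rule has_field_derivative_transform_within_open[OF d\<Psi>[OF that] open_upper_half_plane])
       (use that in \<open>auto simp: W_def\<close>)
  show ?thesis
  proof (intro exI conjI ballI impI allI)
    show "H holomorphic_on ball (of_real x) r"
      unfolding H_def S_def[symmetric] by (intro holomorphic_intros holomorphic_deriv W' S \<omega>)
  next
    fix z assume z: "0 < Im z"
    have "((\<lambda>w. \<omega> * (F w - (A * w + k))) has_field_derivative \<omega> * (F' z - A)) (at z)"
      by (rule derivative_eq_intros cauchy_transform_has_derivative refl | use z in simp)+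
    then have "(deriv W has_field_derivative \<omega> * (F' z - A)) (at z)"
      by (rule has_field_derivative_transform_within_open[OF _ open_upper_half_plane])
         (use z W1 in auto)
    then show "H z = F' z - A" using \<omega> by (simp add: H_def DERIV_imp_deriv)
  next
    fix t assume "\<bar>t - x\<bar> < r"
    then have "of_real t \<in> S" using tS by simp
    then have "deriv (deriv W) (of_real t) \<in> \<real>"
      by (intro deriv_real_on_reals[OF S W'] deriv_real_on_reals[OF S W] Wreal) auto
    then show "\<omega> * H (of_real t) \<in> \<real>" using \<omega> by (simp add: H_def)
  qed
qed

text \<open>On a band the real part of the potential has derivative $t - \alpha$, so it is quadratic and
$1 - F'$ is purely imaginary there.\<close>

lemma continuation_across_band:
  assumes r: "0 < r"
    and pv: "\<And>t. \<bar>t - x\<bar> < r \<Longrightarrow> ((\<lambda>y. Re (F (Complex t y))) \<longlongrightarrow> t - \<alpha>) (at_right 0)"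
  shows "\<exists>H. H holomorphic_on ball (of_real x) r \<and>
    (\<forall>z\<in>ball (of_real x) r. 0 < Im z \<longrightarrow> H z = 1 - F' z) \<and>
    (\<forall>t. \<bar>t - x\<bar> < r \<longrightarrow> Re (H (of_real t)) = 0)"
proof -
  let ?L = "\<lambda>t. Re (boundary_extension \<Phi> (of_real t)) - (t\<^sup>2 / 2 - \<alpha> * t)"
  have "\<exists>m. \<forall>t\<in>{x - r<..<x + r}. ?L t = m"
  proof (rule has_field_derivative_zero_constant)
    fix t assume "t \<in> {x - r<..<x + r}"
    then have t: "\<bar>t - x\<bar> < r" by auto
    have "((\<lambda>t. t\<^sup>2 / 2 - \<alpha> * t) has_real_derivative t - \<alpha>) (at t)"
      by (auto intro!: derivative_eq_intros)
    from DERIV_diff[OF potential_has_boundary_derivative[OF pv[OF t]] this]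
    have "(?L has_real_derivative 0) (at t)" by simp
    then show "(?L has_real_derivative 0) (at t within {x - r<..<x + r})"
      by (rule has_field_derivative_at_within)
  qed simp
  then obtain m where m: "\<And>t. \<bar>t - x\<bar> < r \<Longrightarrow> ?L t = m"
    by (auto simp: abs_less_iff)
  have "\<exists>H. H holomorphic_on ball (of_real x) r \<and>
    (\<forall>z\<in>ball (of_real x) r. 0 < Im z \<longrightarrow> H z = F' z - 1) \<and>
    (\<forall>t. \<bar>t - x\<bar> < r \<longrightarrow> \<i> * H (of_real t) \<in> \<real>)"
  proof (rule reflect_second_derivative[OF r])
    show "\<i> * (boundary_extension \<Phi> (of_real t) - (1 / 2 * (of_real t)\<^sup>2 + of_real (- \<alpha>) * of_real t + of_real m)) \<in> \<real>"
      if "\<bar>t - x\<bar> < r" for t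
      using m[OF that] by (simp add: complex_is_Real_iff power2_eq_square)
  qed simp
  then obtain H where "H holomorphic_on ball (of_real x) r"
    "\<forall>z\<in>ball (of_real x) r. 0 < Im z \<longrightarrow> H z = F' z - 1"
    "\<forall>t. \<bar>t - x\<bar> < r \<longrightarrow> \<i> * H (of_real t) \<in> \<real>" by blast
  then show ?thesis
    by (intro exI[of _ "\<lambda>z. - H z"]) (auto intro: holomorphic_intros simp: complex_is_Real_iff)
qed

text \<open>On a gap the density is constant, so the imaginary part of the potential is affine and $1 - F'$ is
real there.\<close>

lemma continuation_across_gap:
  assumes r: "0 < r" and c: "\<And>t. \<bar>t - x\<bar> < r \<Longrightarrow> J t = c"
  shows "\<exists>H. H holomorphic_on ball (of_real x) r \<and>
    (\<forall>z\<in>ball (of_real x) r. 0 < Im z \<longrightarrow> H z = 1 - F' z) \<and>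
    (\<forall>t. \<bar>t - x\<bar> < r \<longrightarrow> Im (H (of_real t)) = 0)"
proof -
  define m where "m = Im (boundary_extension \<Phi> (of_real x)) + pi * c * x"
  have m: "Im (boundary_extension \<Phi> (of_real t)) = m - pi * c * t" if t: "\<bar>t - x\<bar> < r" for t
  proof (cases "t \<le> x")
    case True
    have "Im (boundary_extension \<Phi> (of_real x)) - Im (boundary_extension \<Phi> (of_real t)) = - pi * c * (x - t)"
      by (rule Im_potential_increment[OF True c]) (use t in auto)
    then show ?thesis by (simp add: m_def algebra_simps)
  next
    case False
    have "Im (boundary_extension \<Phi> (of_real t)) - Im (boundary_extension \<Phi> (of_real x)) = - pi * c * (t - x)"
      by (rule Im_potential_increment) (use False t c in auto)
    then show ?thesis by (simp add: m_def algebra_simps)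
  qed
  have "\<exists>H. H holomorphic_on ball (of_real x) r \<and>
    (\<forall>z\<in>ball (of_real x) r. 0 < Im z \<longrightarrow> H z = F' z - 0) \<and>
    (\<forall>t. \<bar>t - x\<bar> < r \<longrightarrow> 1 * H (of_real t) \<in> \<real>)"
  proof (rule reflect_second_derivative[OF r])
    show "1 * (boundary_extension \<Phi> (of_real t) - (0 / 2 * (of_real t)\<^sup>2 + - (\<i> * of_real (pi * c)) * of_real t + \<i> * of_real m)) \<in> \<real>"
      if "\<bar>t - x\<bar> < r" for t
      using m[OF that] by (simp add: complex_is_Real_iff)
  qed simp
  then obtain H where "H holomorphic_on ball (of_real x) r"
    "\<forall>z\<in>ball (of_real x) r. 0 < Im z \<longrightarrow> H z = F' z"
    "\<forall>t. \<bar>t - x\<bar> < r \<longrightarrow> H (of_real t) \<in> \<real>" by auto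
  then show ?thesis
    by (intro exI[of _ "\<lambda>z. 1 - H z"]) (auto intro: holomorphic_intros simp: complex_is_Real_iff)
qed

text \<open>The alternative in the hypothesis describes a square root that is imaginary on the bands and real
elsewhere. In both cases its product with $1 - F'$ is real, so one reflection across the whole line
without the exceptional points suffices.\<close>

lemma reflected_product:
  assumes E: "finite E"
    and R0: "R0 holomorphic_on upper_half_plane" "continuous_on {z. 0 \<le> Im z} R0"
    and E': "\<And>x. x \<notin> E \<Longrightarrow>
      Re (R0 (of_real x)) = 0 \<and> (\<exists>r>0. \<forall>t. \<bar>t - x\<bar> < r \<longrightarrow> ((\<lambda>y. Re (F (Complex t y))) \<longlongrightarrow> t - \<alpha>) (at_right 0)) \<or>
      Im (R0 (of_real x)) = 0 \<and> (\<exists>r>0. \<exists>c. \<forall>t. \<bar>t - x\<bar> < r \<longrightarrow> J t = c)"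
  obtains M where "M holomorphic_on - of_real ` E"
    "\<And>z. 0 < Im z \<Longrightarrow> M z = R0 z * (1 - F' z)" "\<And>z. Im z \<noteq> 0 \<Longrightarrow> M (cnj z) = cnj (M z)"
    "\<And>x. x \<notin> E \<Longrightarrow> M (of_real x) \<in> \<real>"
proof -
  define G where "G z = R0 z * (1 - F' z)" for z
  have ex: "\<exists>l\<in>\<real>. (G \<longlongrightarrow> l) (at (of_real x) within upper_half_plane)" if x: "x \<notin> E" for x
  proof -
    have "\<exists>H r. 0 < r \<and> H holomorphic_on ball (of_real x) r \<and>
        (\<forall>z\<in>ball (of_real x) r. 0 < Im z \<longrightarrow> H z = 1 - F' z) \<and> R0 (of_real x) * H (of_real x) \<in> \<real>"
      using E'[OF x]
    proof (elim disjE conjE exE)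
      fix r assume "Re (R0 (of_real x)) = 0" "0 < r"
        "\<forall>t. \<bar>t - x\<bar> < r \<longrightarrow> ((\<lambda>y. Re (F (Complex t y))) \<longlongrightarrow> t - \<alpha>) (at_right 0)"
      moreover from this continuation_across_band[OF \<open>0 < r\<close>, of x \<alpha>]
      obtain H where "H holomorphic_on ball (of_real x) r"
        "\<forall>z\<in>ball (of_real x) r. 0 < Im z \<longrightarrow> H z = 1 - F' z" "\<forall>t. \<bar>t - x\<bar> < r \<longrightarrow> Re (H (of_real t)) = 0"
        by blast
      ultimately show ?thesis
        by (intro exI[of _ H] exI[of _ r]) (simp add: complex_is_Real_iff)
    next
      fix r c assume "Im (R0 (of_real x)) = 0" "0 < r" "\<forall>t. \<bar>t - x\<bar> < r \<longrightarrow> J t = c"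
      moreover from this continuation_across_gap[OF \<open>0 < r\<close>, of x c]
      obtain H where "H holomorphic_on ball (of_real x) r"
        "\<forall>z\<in>ball (of_real x) r. 0 < Im z \<longrightarrow> H z = 1 - F' z" "\<forall>t. \<bar>t - x\<bar> < r \<longrightarrow> Im (H (of_real t)) = 0"
        by blast
      ultimately show ?thesis
        by (intro exI[of _ H] exI[of _ r]) (simp add: complex_is_Real_iff)
    qed
    then obtain H r where H: "0 < r" "H holomorphic_on ball (of_real x) r"
        "\<And>z. z \<in> ball (of_real x) r \<Longrightarrow> 0 < Im z \<Longrightarrow> H z = 1 - F' z" "R0 (of_real x) * H (of_real x) \<in> \<real>"
      by blast
    have "isCont H (of_real x)"
      using H(1,2) by (metis centre_in_ball continuous_on_eq_continuous_at holomorphic_on_imp_continuous_on open_ball)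
    then have "(H \<longlongrightarrow> H (of_real x)) (at (of_real x) within upper_half_plane)"
      by (metis continuous_at continuous_at_imp_continuous_within continuous_within)
    moreover have "eventually (\<lambda>z. H z = 1 - F' z) (at (of_real x) within upper_half_plane)"
      unfolding eventually_at using H(1,3) by (intro exI[of _ r]) (auto simp: dist_commute)
    ultimately have "((\<lambda>z. 1 - F' z) \<longlongrightarrow> H (of_real x)) (at (of_real x) within upper_half_plane)"
      by (rule Lim_transform_eventually)
    moreover have "(R0 \<longlongrightarrow> R0 (of_real x)) (at (of_real x) within upper_half_plane)"
    proof (rule tendsto_within_subset)
      show "(R0 \<longlongrightarrow> R0 (of_real x)) (at (of_real x) within {z. 0 \<le> Im z})"
        using R0(2) by (simp add: continuous_on_def)
    qed auto
    ultimately have "(G \<longlongrightarrow> R0 (of_real x) * H (of_real x)) (at (of_real x) within upper_half_plane)"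
      unfolding G_def by (intro tendsto_mult)
    with H(4) show ?thesis by blast
  qed
  let ?G = "boundary_extension G"
  have real: "?G (of_real x) \<in> \<real>" if "x \<notin> E" for x
    using ex[OF that] boundary_extension_eq by blast
  have "F' holomorphic_on {z. Im z \<noteq> 0}"
  proof -
    have "deriv F holomorphic_on {z. Im z \<noteq> 0}"
      by (rule holomorphic_deriv[OF cauchy_transform_holomorphic open_nonreal])
    then show ?thesis
      by (rule holomorphic_transform) (use cauchy_transform_has_derivative in \<open>auto intro: DERIV_imp_deriv\<close>)
  qed
  then have "F' holomorphic_on upper_half_plane"
    by (rule holomorphic_on_subset) auto
  then have holG: "G holomorphic_on upper_half_plane"
    unfolding G_def by (intro holomorphic_intros R0)
  have contG: "continuous_on (upper_half_plane \<union> of_real ` (- E)) ?G"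
    by (rule continuous_on_boundary_extension[OF holomorphic_on_imp_continuous_on[OF holG]]) (use ex in blast)
  define M where "M z = (if 0 \<le> Im z then ?G z else cnj (?G (cnj z)))" for z
  show ?thesis
  proof
    show "M holomorphic_on - of_real ` E"
      unfolding M_def
    proof (rule Schwarz_reflection)
      show "open (- complex_of_real ` E)"
        using E by (simp add: finite_imp_closed open_Compl)
      show "cnj ` (- complex_of_real ` E) \<subseteq> - complex_of_real ` E"
        by (auto simp: complex_eq_iff)
      show "?G holomorphic_on - complex_of_real ` E \<inter> {z. 0 < Im z}"
        by (rule holomorphic_transform[OF holomorphic_on_subset[OF holG]]) auto
      have "z \<in> upper_half_plane \<union> of_real ` (- E)" if "z \<notin> of_real ` E" "0 \<le> Im z" for z
      proof (cases "Im z = 0")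
        case True
        then have "z = of_real (Re z)" by (simp add: complex_eq_iff)
        with that(1) show ?thesis by blast
      qed (use that in auto)
      then show "continuous_on (- complex_of_real ` E \<inter> {z. 0 \<le> Im z}) ?G"
        by (intro continuous_on_subset[OF contG]) auto
      show "?G z \<in> \<real>" if "z \<in> - complex_of_real ` E" "z \<in> \<real>" for z
        using that real by (auto elim!: Reals_cases)
    qed
    show "M z = R0 z * (1 - F' z)" if "0 < Im z" for z
      using that by (simp add: M_def G_def)
    show "M (cnj z) = cnj (M z)" if "Im z \<noteq> 0" for z
      using that by (auto simp: M_def)
    show "M (of_real x) \<in> \<real>" if "x \<notin> E" for x
      using real[OF that] by (simp add: M_def)
  qed
qed

end

section \<open>Isolated singularities on the real axis\<close>

text \<open>A bound that deteriorates like $1/|\mathrm{Im}\, w|$ towards the axis still controls the function on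
the axis. On the circle of radius $\rho$ around a real point $x$ one has
$|(w-x)^2-\rho^2| = 2\rho\,|\mathrm{Im}\, w|$, so multiplying by this polynomial removes the blow-up and
the maximum principle applies.\<close>

lemma norm_le_near_real_axis:
  fixes f :: "complex \<Rightarrow> complex"
  assumes f: "f holomorphic_on ball (of_real x) r" and \<rho>: "0 < \<rho>" "\<rho> < r"
    and bound: "\<And>w. norm (w - of_real x) = \<rho> \<Longrightarrow> Im w \<noteq> 0 \<Longrightarrow> norm (f w) \<le> K / \<bar>Im w\<bar>"
    and z: "norm (z - of_real x) \<le> \<rho> / 2" and K: "0 \<le> K"
  shows "norm (f z) \<le> 3 * K / \<rho>"
proof -
  define g where "g w = f w * ((w - of_real x)\<^sup>2 - of_real (\<rho>\<^sup>2))" for w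
  have sub: "cball (of_real x) \<rho> \<subseteq> ball (of_real x) r" using \<rho> by auto
  have g: "g holomorphic_on ball (of_real x) r" unfolding g_def by (intro holomorphic_intros f)
  have "norm (g z) \<le> 2 * \<rho> * K"
  proof (rule maximum_modulus_frontier[where S="cball (of_real x) \<rho>" and f=g and \<xi>=z])
    show "g holomorphic_on interior (cball (of_real x) \<rho>)"
      using sub by (intro holomorphic_on_subset[OF g]) auto
    show "continuous_on (closure (cball (of_real x) \<rho>)) g"
      using sub by (auto intro: continuous_on_subset[OF holomorphic_on_imp_continuous_on[OF g]])
    show "norm (g w) \<le> 2 * \<rho> * K" if "w \<in> frontier (cball (complex_of_real x) \<rho>)" for w
    proof -
      define u where "u = w - of_real x"
      have u: "norm u = \<rho>"
        using that \<rho> by (simp add: frontier_cball u_def dist_norm norm_minus_commute)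
      have "u\<^sup>2 - of_real (\<rho>\<^sup>2) = u * (u - cnj u)"
        by (simp only: right_diff_distrib power2_eq_square complex_norm_square[symmetric] u[symmetric] of_real_mult[symmetric])
      also have "\<dots> = u * (of_real (2 * Im u) * \<i>)"
        by (simp add: complex_diff_cnj mult.commute)
      finally have n: "norm (u\<^sup>2 - of_real (\<rho>\<^sup>2)) = 2 * \<rho> * \<bar>Im w\<bar>"
        using u by (simp add: norm_mult u_def)
      show ?thesis
      proof (cases "Im w = 0")
        case True
        then show ?thesis using n K \<rho> unfolding g_def u_def[symmetric] norm_mult by simp
      next
        case False
        have "norm (f w) * (2 * \<rho> * \<bar>Im w\<bar>) \<le> K / \<bar>Im w\<bar> * (2 * \<rho> * \<bar>Im w\<bar>)"
          by (rule mult_right_mono[OF bound]) (use False u \<rho> in \<open>auto simp: u_def\<close>)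
        then show ?thesis using n False unfolding g_def u_def[symmetric] norm_mult by (simp add: mult_ac)
      qed
    qed
  qed (use z \<rho> in \<open>auto simp: dist_norm norm_minus_commute\<close>)
  moreover have "norm ((z - of_real x)\<^sup>2 - of_real (\<rho>\<^sup>2)) \<ge> 3 / 4 * \<rho>\<^sup>2"
  proof -
    have "(norm (z - of_real x))\<^sup>2 \<le> (\<rho> / 2)\<^sup>2" using z by (intro power_mono) auto
    then have "norm ((z - of_real x)\<^sup>2) \<le> \<rho>\<^sup>2 / 4" by (simp add: norm_power power_divide)
    moreover have "norm (complex_of_real (\<rho>\<^sup>2)) - norm ((z - of_real x)\<^sup>2) \<le> norm (of_real (\<rho>\<^sup>2) - (z - of_real x)\<^sup>2)"
      by (rule norm_triangle_ineq2)
    moreover have "norm (complex_of_real (\<rho>\<^sup>2)) = \<rho>\<^sup>2" by (simp add: norm_power)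
    ultimately show ?thesis by (subst norm_minus_commute) linarith
  qed
  ultimately have "norm (f z) * (3 / 4 * \<rho>\<^sup>2) \<le> 2 * \<rho> * K"
    unfolding g_def norm_mult by (meson mult_left_mono norm_ge_zero order_trans)
  then have "norm (f z) * (3 / 4 * \<rho>) \<le> 2 * K"
    using \<rho> by (simp add: power2_eq_square)
  then have "norm (f z) \<le> 8 / 3 * K / \<rho>" using \<rho> by (simp add: field_simps)
  also have "\<dots> \<le> 3 * K / \<rho>" using K \<rho> by (intro divide_right_mono mult_right_mono) auto
  finally show ?thesis .
qed

text \<open>Away from the axis the hypothesis bounds the function by a multiple of $|z-e|^{-1/2}$ near $e$. By
\<open>norm_le_near_real_axis\<close>, applied on a circle of radius $|z-e|/2$, the same order of
growth holds close to the axis, and it is too small for a pole.\<close>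

lemma removable_of_axis_bound:
  fixes f :: "complex \<Rightarrow> complex"
  assumes E: "finite E" and f: "f holomorphic_on - complex_of_real ` E"
    and bound: "\<And>e. e \<in> E \<Longrightarrow> \<exists>A d. 0 < d \<and>
      (\<forall>z. Im z \<noteq> 0 \<longrightarrow> norm (z - of_real e) < d \<longrightarrow> norm (f z) \<le> A * sqrt (norm (z - of_real e)) / \<bar>Im z\<bar>)"
  obtains h where "h holomorphic_on UNIV" "\<And>z. z \<notin> of_real ` E \<Longrightarrow> h z = f z"
proof -
  have "f \<in> O[at z](\<lambda>_. 1)" if z: "z \<in> of_real ` E" for z
  proof -
    obtain e where e: "e \<in> E" "z = of_real e" using z by auto
    obtain A' d where d: "0 < d" and A': "\<And>w. Im w \<noteq> 0 \<Longrightarrow> norm (w - of_real e) < d \<Longrightarrow>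
        norm (f w) \<le> A' * sqrt (norm (w - of_real e)) / \<bar>Im w\<bar>"
      using bound[OF e(1)] by auto
    define A where "A = \<bar>A'\<bar>"
    have "open (- complex_of_real ` (E - {e}))" using E by (simp add: finite_imp_closed open_Compl)
    then obtain s where s: "0 < s" "ball (of_real e) s \<subseteq> - complex_of_real ` (E - {e})"
      by (rule openE) auto
    define r where "r = min d s"
    have r: "0 < r" "r \<le> d" "r \<le> s" using d s by (auto simp: r_def)
    have hol: "f holomorphic_on ball (of_real e) r - {of_real e}"
      using s r by (intro holomorphic_on_subset[OF f]) force
    have A: "norm (f w) \<le> A * sqrt (norm (w - of_real e)) / \<bar>Im w\<bar>"
      if "Im w \<noteq> 0" "norm (w - of_real e) < d" for w
    proof -
      have "norm (f w) \<le> A' * sqrt (norm (w - of_real e)) / \<bar>Im w\<bar>" using A' that .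
      also have "\<dots> \<le> A * sqrt (norm (w - of_real e)) / \<bar>Im w\<bar>"
        by (intro divide_right_mono mult_right_mono) (auto simp: A_def)
      finally show ?thesis .
    qed
    have est: "norm (f w) \<le> 12 * A / sqrt (norm (w - of_real e))"
      if w: "w \<noteq> of_real e" "norm (w - of_real e) < r / 2" for w
    proof -
      define D where "D = norm (w - of_real e)"
      have D: "0 < D" "D < r / 2" using w by (auto simp: D_def)
      have sq: "sqrt D * sqrt D = D" using D by simp
      show ?thesis
      proof (cases "D / 4 \<le> \<bar>Im w\<bar>")
        case True
        have "norm (f w) \<le> A * sqrt D / \<bar>Im w\<bar>"
          unfolding D_def by (rule A) (use True D r in \<open>auto simp: D_def\<close>)
        also have "\<dots> \<le> A * sqrt D / (D / 4)"
          using True D by (intro divide_left_mono) (auto simp: A_def)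
        also have "\<dots> = 4 * A / sqrt D" using D sq by (simp add: field_simps)
        also have "\<dots> \<le> 12 * A / sqrt D"
          using D by (intro divide_right_mono) (auto simp: A_def)
        finally show ?thesis by (simp add: D_def)
      next
        case False
        define x where "x = Re w"
        have wx: "norm (w - of_real x) = \<bar>Im w\<bar>" by (simp add: x_def cmod_eq_Im)
        have "D \<le> norm (w - of_real x) + norm (of_real x - complex_of_real e)"
          unfolding D_def using norm_triangle_ineq[of "w - of_real x" "of_real x - complex_of_real e"] by simp
        then have xe: "norm (of_real x - complex_of_real e) \<ge> 3 * D / 4"
          using wx False by simp
        have xe': "norm (of_real x - complex_of_real e) \<le> D"
          using abs_Re_le_cmod[of "w - of_real e"] by (simp add: D_def x_def flip: of_real_diff)
        have "norm (f w) \<le> 3 * (2 * A * sqrt D) / (D / 2)"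
        proof (rule norm_le_near_real_axis[where r="3 * D / 4" and x=x and f=f and z=w])
          have "ball (complex_of_real x) (3 * D / 4) \<subseteq> ball (of_real e) r - {of_real e}"
          proof
            fix \<zeta> assume \<zeta>: "\<zeta> \<in> ball (complex_of_real x) (3 * D / 4)"
            then have "norm (\<zeta> - of_real x) < 3 * D / 4" by (simp add: dist_norm norm_minus_commute)
            moreover have "norm (\<zeta> - of_real e) \<le> norm (\<zeta> - of_real x) + norm (of_real x - complex_of_real e)"
              using norm_triangle_ineq[of "\<zeta> - of_real x" "of_real x - complex_of_real e"] by simp
            ultimately have "norm (\<zeta> - of_real e) < r" using xe' D by linarith
            moreover have "\<zeta> \<noteq> of_real e"
              using \<zeta> xe by (auto simp: dist_norm)
            ultimately show "\<zeta> \<in> ball (of_real e) r - {of_real e}" by (simp add: dist_norm norm_minus_commute)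
          qed
          then show "f holomorphic_on ball (of_real x) (3 * D / 4)"
            by (rule holomorphic_on_subset[OF hol])
          show "norm (f \<zeta>) \<le> (2 * A * sqrt D) / \<bar>Im \<zeta>\<bar>"
            if \<zeta>: "norm (\<zeta> - of_real x) = D / 2" "Im \<zeta> \<noteq> 0" for \<zeta>
          proof -
            have le: "norm (\<zeta> - of_real e) \<le> norm (\<zeta> - of_real x) + norm (of_real x - complex_of_real e)"
              using norm_triangle_ineq[of "\<zeta> - of_real x" "of_real x - complex_of_real e"] by simp
            then have "norm (f \<zeta>) \<le> A * sqrt (norm (\<zeta> - of_real e)) / \<bar>Im \<zeta>\<bar>"
              using \<zeta> xe' D r by (intro A) auto
            also have "\<dots> \<le> A * sqrt (4 * D) / \<bar>Im \<zeta>\<bar>"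
              using le \<zeta> xe' D by (intro divide_right_mono mult_left_mono real_sqrt_le_mono) (auto simp: A_def)
            finally show ?thesis by (simp add: real_sqrt_mult mult_ac)
          qed
          show "norm (w - of_real x) \<le> D / 2 / 2" using wx False by simp
        qed (use D in \<open>auto simp: A_def\<close>)
        also have "\<dots> = 12 * A / sqrt D" using D sq by (simp add: field_simps)
        finally show ?thesis by (simp add: D_def)
      qed
    qed
    have "((\<lambda>w. (w - of_real e) * f w) \<longlongrightarrow> 0) (at (of_real e))"
    proof (rule Lim_null_comparison)
      show "eventually (\<lambda>w. norm ((w - of_real e) * f w) \<le> 12 * A * sqrt (norm (w - of_real e))) (at (of_real e))"
        unfolding eventually_at
      proof (intro exI[of _ "r / 2"] conjI ballI impI)
        fix w :: complex assume "w \<noteq> of_real e \<and> dist w (of_real e) < r / 2"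
        then have w: "w \<noteq> of_real e" "norm (w - of_real e) < r / 2" by (auto simp: dist_norm)
        have p: "0 < norm (w - of_real e)" using w by simp
        have "norm ((w - of_real e) * f w) \<le> norm (w - of_real e) * (12 * A / sqrt (norm (w - of_real e)))"
          unfolding norm_mult by (rule mult_left_mono[OF est[OF w]]) simp
        also have "\<dots> = 12 * A * (norm (w - of_real e) / sqrt (norm (w - of_real e)))" by simp
        also have "\<dots> = 12 * A * sqrt (norm (w - of_real e))"
          using p by (subst real_div_sqrt) auto
        finally show "norm ((w - of_real e) * f w) \<le> 12 * A * sqrt (norm (w - of_real e))" .
      qed (use r in simp)
      have "((\<lambda>w. 12 * A * sqrt (norm (w - complex_of_real e))) \<longlongrightarrow> 12 * A * sqrt (norm (complex_of_real e - of_real e))) (at (of_real e))"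
        by (intro tendsto_intros)
      then show "((\<lambda>w. 12 * A * sqrt (norm (w - complex_of_real e))) \<longlongrightarrow> 0) (at (of_real e))" by simp
    qed
    then obtain b where "eventually (\<lambda>w. norm (f w) \<le> b) (at (of_real e))"
      using holomorphic_on_extend_lim[OF hol] holomorphic_on_extend_bounded[OF hol] r by auto
    then show ?thesis unfolding e(2) by (intro bigoI[of _ b]) simp
  qed
  then have "\<exists>h. h holomorphic_on UNIV \<and> (\<forall>z\<in>UNIV - of_real ` E. h z = f z)"
    using E f by (intro removable_singularities) (auto simp: Compl_eq_Diff_UNIV)
  then show ?thesis using that by auto
qed

section \<open>The square root of the band polynomial\<close>

text \<open>On the negative axis the principal square root takes its limit from above, in accordance with the
convention for \<open>R\<close> on the bands.\<close>

lemma continuous_on_csqrt_closed_upper: "continuous_on {z. 0 \<le> Im z} csqrt"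
proof -
  have eq: "csqrt z = Complex (sqrt ((cmod z + Re z) / 2)) (sqrt ((cmod z - Re z) / 2))" if "0 \<le> Im z" for z
    using that by (simp add: complex_eq_iff)
  have "continuous_on {z. 0 \<le> Im z} (\<lambda>z. Complex (sqrt ((cmod z + Re z) / 2)) (sqrt ((cmod z - Re z) / 2)))"
    unfolding Complex_eq by (intro continuous_intros) auto
  then show ?thesis by (rule continuous_on_eq) (simp add: eq)
qed

lemma csqrt_pair:
  fixes x u v :: real
  assumes "u < v"
  shows csqrt_pair_outside: "x \<le> u \<or> v \<le> x \<Longrightarrow>
      csqrt (of_real x - of_real u) * csqrt (of_real x - of_real v) = of_real (sgn (x - u) * sqrt ((x - u) * (x - v)))"
    and csqrt_pair_inside: "u \<le> x \<Longrightarrow> x \<le> v \<Longrightarrow>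
      csqrt (of_real x - of_real u) * csqrt (of_real x - of_real v) = \<i> * of_real (sqrt ((x - u) * (v - x)))"
proof -
  have pos: "csqrt (of_real x - of_real e) = of_real (sqrt (x - e))" if "e \<le> x" for e
    using that csqrt_of_real[of "x - e"] by simp
  have neg: "csqrt (of_real x - of_real e) = \<i> * of_real (sqrt (e - x))" if "x \<le> e" for e
    using that csqrt_of_real_nonpos[of "of_real (x - e)"] by simp
  show "csqrt (of_real x - of_real u) * csqrt (of_real x - of_real v) = \<i> * of_real (sqrt ((x - u) * (v - x)))"
    if "u \<le> x" "x \<le> v"
    using that by (simp add: pos neg real_sqrt_mult)
  show "csqrt (of_real x - of_real u) * csqrt (of_real x - of_real v) = of_real (sgn (x - u) * sqrt ((x - u) * (x - v)))"
    if "x \<le> u \<or> v \<le> x"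
  proof (cases "v \<le> x")
    case True
    then show ?thesis using assms by (simp add: pos real_sqrt_mult)
  next
    case False
    then have x: "x \<le> u" "x < v" using that by auto
    have "sqrt ((x - u) * (x - v)) = sqrt (u - x) * sqrt (v - x)"
      unfolding real_sqrt_mult[symmetric] by (simp add: algebra_simps)
    moreover have "\<i> * s * (\<i> * t) = - (s * t)" for s t :: complex
      by (simp add: complex_eq_iff algebra_simps)
    ultimately show ?thesis using x by (cases "x = u") (auto simp: neg sgn_if)
  qed
qed

text \<open>Distinct singularities do not reinforce each other. For two points this is
$\sqrt{|e-a|} \le \sqrt{|z-e|} + \sqrt{|z-a|}$ divided by the product of the two roots, the square
root version of a partial fraction.\<close>

lemma inverse_sqrt_prod_le_sum:
  assumes "finite E" "E \<noteq> {}"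
  shows "\<exists>C\<ge>0. \<forall>z. z \<notin> complex_of_real ` E \<longrightarrow>
    1 / (\<Prod>e\<in>E. sqrt (norm (z - of_real e))) \<le> C * (\<Sum>e\<in>E. 1 / sqrt (norm (z - of_real e)))"
  using assms
proof (induction E rule: finite_ne_induct)
  case (singleton e)
  show ?case by (intro exI[of _ 1]) auto
next
  case (insert a E)
  let ?n = "\<lambda>z e. sqrt (norm (z - complex_of_real e))"
  obtain C where C: "0 \<le> C" "\<And>z. z \<notin> complex_of_real ` E \<Longrightarrow> 1 / (\<Prod>e\<in>E. ?n z e) \<le> C * (\<Sum>e\<in>E. 1 / ?n z e)"
    using insert.IH by blast
  define D where "D = (\<Sum>e\<in>E. 1 / sqrt \<bar>e - a\<bar>)"
  have D0: "0 \<le> D" unfolding D_def by (intro sum_nonneg) auto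
  have two: "1 / ?n z e * (1 / ?n z a) \<le> D * (1 / ?n z e + 1 / ?n z a)"
    if z: "z \<noteq> of_real a" "z \<noteq> of_real e" and e: "e \<in> E" for z e
  proof -
    have ea: "e \<noteq> a" using insert.hyps e by auto
    have p: "?n z e > 0" "?n z a > 0" "sqrt \<bar>e - a\<bar> > 0" using z ea by auto
    have "\<bar>e - a\<bar> = norm ((z - of_real a) - (z - of_real e))"
      by (simp flip: of_real_diff)
    also have "\<dots> \<le> norm (z - of_real a) + norm (z - of_real e)" by (rule norm_triangle_ineq4)
    finally have "sqrt \<bar>e - a\<bar> \<le> sqrt (norm (z - of_real a) + norm (z - of_real e))" by simp
    also have "\<dots> \<le> ?n z a + ?n z e" by (rule sqrt_add_le_add_sqrt) auto
    finally have "sqrt \<bar>e - a\<bar> \<le> ?n z a + ?n z e" .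
    then have "1 / ?n z e * (1 / ?n z a) \<le> 1 / sqrt \<bar>e - a\<bar> * (1 / ?n z e + 1 / ?n z a)"
      using p by (simp add: field_simps)
    also have "\<dots> \<le> D * (1 / ?n z e + 1 / ?n z a)"
      unfolding D_def using e insert.hyps(1) by (intro mult_right_mono member_le_sum) auto
    finally show ?thesis .
  qed
  define N where "N = real (card E)"
  show ?case
  proof (intro exI[of _ "C * D * (1 + N)"] conjI allI impI)
    show "0 \<le> C * D * (1 + N)" using C D0 by (simp add: N_def)
    fix z assume z: "z \<notin> complex_of_real ` insert a E"
    have "1 / (\<Prod>e\<in>insert a E. ?n z e) = 1 / (\<Prod>e\<in>E. ?n z e) * (1 / ?n z a)"
      using insert.hyps by simp
    also have "\<dots> \<le> C * (\<Sum>e\<in>E. 1 / ?n z e) * (1 / ?n z a)"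
      using z by (intro mult_right_mono C) auto
    also have "\<dots> = C * (\<Sum>e\<in>E. 1 / ?n z e * (1 / ?n z a))"
      by (simp only: mult.assoc sum_distrib_right)
    also have "\<dots> \<le> C * (\<Sum>e\<in>E. D * (1 / ?n z e + 1 / ?n z a))"
      using z C(1) by (intro mult_left_mono sum_mono two) auto
    also have "\<dots> = C * D * ((\<Sum>e\<in>E. 1 / ?n z e) + N * (1 / ?n z a))"
      by (simp add: sum_distrib_left[symmetric] sum.distrib N_def)
    also have "\<dots> \<le> C * D * ((1 + N) * (\<Sum>e\<in>insert a E. 1 / ?n z e))"
    proof (rule mult_left_mono)
      have "0 \<le> (\<Sum>e\<in>E. 1 / ?n z e)" by (intro sum_nonneg) auto
      moreover have "0 \<le> 1 / ?n z a" "0 \<le> N" by (auto simp: N_def)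
      ultimately have "0 \<le> N * (\<Sum>e\<in>E. 1 / ?n z e) + 1 / ?n z a" by simp
      then show "(\<Sum>e\<in>E. 1 / ?n z e) + N * (1 / ?n z a) \<le> (1 + N) * (\<Sum>e\<in>insert a E. 1 / ?n z e)"
        using insert.hyps by (simp add: algebra_simps add_divide_distrib)
    qed (use C D0 in auto)
    finally show "1 / (\<Prod>e\<in>insert a E. ?n z e) \<le> C * D * (1 + N) * (\<Sum>e\<in>insert a E. 1 / ?n z e)"
      by (simp add: mult.assoc)
  qed
qed

locale band_system =
  fixes g :: nat and p q :: "nat \<Rightarrow> real"
  assumes band_order: "\<And>k. k \<le> g \<Longrightarrow> p k < q (k + 1)"
    and gap_order: "\<And>k. k \<in> {1..g} \<Longrightarrow> q k < p k"
begin

definition endpoints :: "real set" where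
  "endpoints = p ` {0..g} \<union> q ` {1..g + 1}"

text \<open>The product of the principal square roots at the endpoints. It turns out to be the branch
\<open>R\<close> on the whole plane (\<open>band_root_eq\<close>), including its values on the bands,
and it makes the values on the real line explicit.\<close>

definition band_root :: "complex \<Rightarrow> complex" where
  "band_root z = (\<Prod>k=0..g. csqrt (z - of_real (p k)) * csqrt (z - of_real (q (k + 1))))"

lemma p_mono: "i \<le> j \<Longrightarrow> j \<le> g \<Longrightarrow> p i \<le> p j"
proof (induction j rule: dec_induct)
  case (step n)
  then show ?case using band_order[of n] gap_order[of "Suc n"] by auto
qed simp

lemma q_mono: "i \<le> j \<Longrightarrow> 1 \<le> i \<Longrightarrow> j \<le> g + 1 \<Longrightarrow> q i \<le> q j"
proof (induction j rule: dec_induct)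
  case (step n)
  then show ?case using band_order[of n] gap_order[of n] by auto
qed simp

lemma q_less_p: "1 \<le> i \<Longrightarrow> i \<le> j \<Longrightarrow> j \<le> g \<Longrightarrow> q i < p j"
  using p_mono[of i j] gap_order[of i] by auto

lemma p_less_q: "i < j \<Longrightarrow> j \<le> g + 1 \<Longrightarrow> p i < q j"
  using q_mono[of "i + 1" j] band_order[of i] by auto

lemma p_less_p: "i < j \<Longrightarrow> j \<le> g \<Longrightarrow> p i < p j"
  using p_less_q[of i j] gap_order[of j] by auto

lemma q_less_q: "i < j \<Longrightarrow> 1 \<le> i \<Longrightarrow> j \<le> g + 1 \<Longrightarrow> q i < q j"
  using q_less_p[of i i] p_less_q[of i j] by auto

lemma outer_less: "p 0 < q (g + 1)"
  by (rule p_less_q) auto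

lemma finite_endpoints: "finite endpoints" and endpoints_nonempty: "endpoints \<noteq> {}"
  by (auto simp: endpoints_def)

lemma endpoints_bounds: "e \<in> endpoints \<Longrightarrow> p 0 \<le> e \<and> e \<le> q (g + 1)"
proof -
  assume "e \<in> endpoints"
  then consider k where "e = p k" "k \<le> g" | k where "e = q k" "1 \<le> k" "k \<le> g + 1"
    by (auto simp: endpoints_def)
  then show ?thesis
  proof cases
    case (1 k)
    then show ?thesis using p_mono[of 0 k] p_less_q[of k "g + 1"] by simp
  next
    case (2 k)
    then show ?thesis using q_mono[of k "g + 1"] p_less_q[of 0 k] by simp
  qed
qed

lemma inj_endpoints: "inj_on p {0..g}" "inj_on q {1..g + 1}" "p ` {0..g} \<inter> q ` {1..g + 1} = {}"
proof -
  show "inj_on p {0..g}"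
    by (intro strict_mono_on_imp_inj_on strict_mono_onI p_less_p) auto
  show "inj_on q {1..g + 1}"
    by (intro strict_mono_on_imp_inj_on strict_mono_onI q_less_q) auto
  have "p i \<noteq> q j" if "i \<le> g" "1 \<le> j" "j \<le> g + 1" for i j
    using that p_less_q[of i j] q_less_p[of j i] by (cases "i < j") auto
  then show "p ` {0..g} \<inter> q ` {1..g + 1} = {}" by auto
qed

lemma prod_endpoints:
  fixes h :: "real \<Rightarrow> 'a::comm_monoid_mult"
  shows "(\<Prod>k=0..g. h (p k) * h (q (k + 1))) = (\<Prod>e\<in>endpoints. h e)"
proof -
  have "(\<Prod>e\<in>endpoints. h e) = (\<Prod>e\<in>p ` {0..g}. h e) * (\<Prod>e\<in>q ` {1..g + 1}. h e)"
    unfolding endpoints_def using inj_endpoints(3) by (intro prod.union_disjoint) auto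
  also have "\<dots> = (\<Prod>k=0..g. h (p k)) * (\<Prod>k=1..g + 1. h (q k))"
    by (subst (1 2) prod.reindex) (use inj_endpoints in auto)
  also have "(\<Prod>k=1..g + 1. h (q k)) = (\<Prod>k=0..g. h (q (k + 1)))"
    using prod.shift_bounds_cl_nat_ivl[of "\<lambda>k. h (q k)" 0 1 g] by simp
  finally show ?thesis by (simp add: prod.distrib)
qed

lemma band_root_endpoints: "band_root z = (\<Prod>e\<in>endpoints. csqrt (z - of_real e))"
  unfolding band_root_def by (rule prod_endpoints)

text \<open>Grouping the two ends of each gap, and the two outermost endpoints, is the right pairing for signs:
seen from a band, the pair of a gap contributes a real number whose sign tells on which side the gap
lies.\<close>

lemma band_root_gaps:
  "band_root z = csqrt (z - of_real (p 0)) * csqrt (z - of_real (q (g + 1)))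
     * (\<Prod>j=1..g. csqrt (z - of_real (q j)) * csqrt (z - of_real (p j)))"
proof -
  have "(\<Prod>k=0..g. csqrt (z - of_real (p k))) = csqrt (z - of_real (p 0)) * (\<Prod>k=1..g. csqrt (z - of_real (p k)))"
    by (simp add: prod.atLeast_Suc_atMost)
  moreover have "(\<Prod>k=0..g. csqrt (z - of_real (q (k + 1)))) = (\<Prod>k=1..g+1. csqrt (z - of_real (q k)))"
    using prod.shift_bounds_cl_nat_ivl[of "\<lambda>k. csqrt (z - of_real (q k))" 0 1 g] by simp
  moreover have "\<dots> = csqrt (z - of_real (q (g + 1))) * (\<Prod>k=1..g. csqrt (z - of_real (q k)))"
    by (simp add: mult.commute)
  ultimately show ?thesis
    unfolding band_root_def by (simp add: prod.distrib)
qed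

lemma continuous_on_band_root: "continuous_on {z. 0 \<le> Im z} band_root"
  unfolding band_root_def
  by (intro continuous_intros continuous_on_compose2[OF continuous_on_csqrt_closed_upper]) auto

lemma band_root_boundary:
  "(band_root \<longlongrightarrow> band_root (of_real x)) (at (of_real x) within upper_half_plane)"
proof (rule tendsto_within_subset)
  show "(band_root \<longlongrightarrow> band_root (of_real x)) (at (of_real x) within {z. 0 \<le> Im z})"
    using continuous_on_band_root by (simp add: continuous_on_def)
qed auto

lemma continuous_on_band_root_real: "continuous_on UNIV (\<lambda>x. band_root (of_real x))"
  by (rule continuous_on_compose2[OF continuous_on_band_root]) (auto intro!: continuous_intros)

definition slit_plane :: "complex set" where
  "slit_plane = {z. Im z \<noteq> 0 \<or> q (g + 1) < Re z}"

lemma slit_plane_Un: "slit_plane = upper_half_plane \<union> {z. q (g + 1) < Re z} \<union> {z. Im z < 0}"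
  by (auto simp: slit_plane_def)

lemma connected_slit_plane: "connected slit_plane"
  unfolding slit_plane_Un
proof (intro connected_Un)
  show "connected upper_half_plane" "connected {z. q (g + 1) < Re z}" "connected {z. Im z < 0}"
    by (intro convex_connected convex_upper_half_plane convex_halfspace_Re_gt convex_halfspace_Im_lt)+
  have "Complex (q (g + 1) + 1) 1 \<in> upper_half_plane \<inter> {z. q (g + 1) < Re z}" by simp
  then show "upper_half_plane \<inter> {z. q (g + 1) < Re z} \<noteq> {}" by blast
  have "Complex (q (g + 1) + 1) (-1) \<in> (upper_half_plane \<union> {z. q (g + 1) < Re z}) \<inter> {z. Im z < 0}" by simp
  then show "(upper_half_plane \<union> {z. q (g + 1) < Re z}) \<inter> {z. Im z < 0} \<noteq> {}" by blast
qed

lemma slit_plane_minus_endpoint: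
  assumes "z \<in> slit_plane" "e \<in> endpoints"
  shows "z - of_real e \<notin> \<real>\<^sub>\<le>\<^sub>0"
  using assms endpoints_bounds[of e] by (auto simp: slit_plane_def complex_nonpos_Reals_iff)

lemma holomorphic_on_band_root: "band_root holomorphic_on slit_plane"
  unfolding band_root_endpoints[abs_def]
  by (intro holomorphic_intros) (use slit_plane_minus_endpoint in auto)

lemma holomorphic_on_band_root_upper: "band_root holomorphic_on upper_half_plane"
  by (rule holomorphic_on_subset[OF holomorphic_on_band_root]) (auto simp: slit_plane_def)

lemma band_root_squared: "(band_root z)\<^sup>2 = (\<Prod>k=0..g. (z - of_real (p k)) * (z - of_real (q (k + 1))))"
  by (simp add: band_root_def prod_power_distrib power_mult_distrib)

lemma band_root_eq_0_iff: "band_root z = 0 \<longleftrightarrow> z \<in> of_real ` endpoints"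
  by (auto simp: band_root_endpoints finite_endpoints)

lemma band_root_cnj:
  assumes "Im z \<noteq> 0"
  shows "band_root (cnj z) = cnj (band_root z)"
proof -
  have "csqrt (cnj z - of_real e) = cnj (csqrt (z - of_real e))" for e
    using assms cnj_csqrt[of "z - of_real e"] by (simp add: complex_nonpos_Reals_iff)
  then show ?thesis by (simp add: band_root_def)
qed

lemma norm_band_root: "norm (band_root z) = (\<Prod>e\<in>endpoints. sqrt (norm (z - of_real e)))"
  by (simp add: band_root_endpoints prod_norm[symmetric])

lemma inverse_band_root_bound:
  "\<exists>C\<ge>0. \<forall>z. z \<notin> of_real ` endpoints \<longrightarrow>
     1 / norm (band_root z) \<le> C * (\<Sum>e\<in>endpoints. 1 / sqrt (norm (z - of_real e)))"
  unfolding norm_band_root by (rule inverse_sqrt_prod_le_sum[OF finite_endpoints endpoints_nonempty])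

lemma band_root_near_endpoint:
  assumes e: "e \<in> endpoints"
  shows "\<exists>D\<ge>0. \<forall>z. norm (z - of_real e) < 1 \<longrightarrow> norm (band_root z) \<le> D * sqrt (norm (z - of_real e))"
proof (intro exI conjI allI impI)
  define D where "D = (\<Prod>e'\<in>endpoints - {e}. sqrt (1 + \<bar>e - e'\<bar>))"
  show "0 \<le> D" unfolding D_def by (intro prod_nonneg) auto
  fix z assume z: "norm (z - complex_of_real e) < 1"
  have "norm (band_root z) = sqrt (norm (z - of_real e)) * (\<Prod>e'\<in>endpoints - {e}. sqrt (norm (z - of_real e')))"
    unfolding norm_band_root by (rule prod.remove[OF finite_endpoints e])
  also have "\<dots> \<le> sqrt (norm (z - of_real e)) * D"
    unfolding D_def
  proof (intro mult_left_mono prod_mono conjI)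
    fix e' assume "e' \<in> endpoints - {e}"
    have "norm (z - of_real e') \<le> norm (z - of_real e) + norm (complex_of_real e - of_real e')"
      using norm_triangle_ineq[of "z - of_real e" "complex_of_real e - of_real e'"] by simp
    then show "sqrt (norm (z - of_real e')) \<le> sqrt (1 + \<bar>e - e'\<bar>)"
      using z by (simp flip: of_real_diff)
  qed auto
  finally show "norm (band_root z) \<le> D * sqrt (norm (z - of_real e))" by (simp add: mult.commute)
qed

lemma band_root_growth:
  assumes z: "norm z \<ge> 2 * (\<bar>p 0\<bar> + \<bar>q (g + 1)\<bar> + 1)"
  shows "norm (band_root z) \<le> (2 * norm z) ^ (g + 1)"
proof -
  have le: "norm (csqrt (z - of_real e)) \<le> sqrt (2 * norm z)" if "e \<in> endpoints" for e
  proof -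
    have "norm (z - of_real e) \<le> norm z + \<bar>e\<bar>" using norm_triangle_ineq4[of z "of_real e"] by simp
    moreover have "\<bar>e\<bar> \<le> norm z" using endpoints_bounds[OF that] z by auto
    ultimately show ?thesis by simp
  qed
  have "norm (band_root z) \<le> (\<Prod>k=0..g. sqrt (2 * norm z) * sqrt (2 * norm z))"
    unfolding band_root_def prod_norm[symmetric] norm_mult
    by (intro prod_mono conjI mult_mono le) (auto simp: endpoints_def)
  then show ?thesis by simp
qed

lemma band_root_asymptotic:
  "((\<lambda>x. band_root (of_real x) / of_real x ^ (g + 1)) \<longlongrightarrow> 1) at_top"
proof -
  have pair: "((\<lambda>x. of_real (sqrt ((1 - u / x) * (1 - v / x)))) \<longlongrightarrow> (1::complex)) at_top" for u v :: real
  proof -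
    have "((\<lambda>x::real. u / x) \<longlongrightarrow> 0) at_top" for u
      by (rule real_tendsto_divide_at_top[OF tendsto_const filterlim_ident])
    then have "((\<lambda>x. of_real (sqrt ((1 - u / x) * (1 - v / x)))) \<longlongrightarrow> complex_of_real (sqrt ((1 - 0) * (1 - 0)))) at_top"
      by (intro tendsto_intros)
    then show ?thesis by simp
  qed
  have "((\<lambda>x. \<Prod>k=0..g. of_real (sqrt ((1 - p k / x) * (1 - q (k + 1) / x)))) \<longlongrightarrow> (\<Prod>k=0..g. (1::complex))) at_top"
    by (intro tendsto_prod pair)
  moreover have "eventually (\<lambda>x. (\<Prod>k=0..g. of_real (sqrt ((1 - p k / x) * (1 - q (k + 1) / x))))
      = band_root (of_real x) / of_real x ^ (g + 1)) at_top"
    using eventually_gt_at_top[of "\<bar>q (g + 1)\<bar> + \<bar>p 0\<bar>"]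
  proof eventually_elim
    case (elim x)
    have pr: "csqrt (of_real x - of_real (p k)) * csqrt (of_real x - of_real (q (k + 1))) / of_real x
        = of_real (sqrt ((1 - p k / x) * (1 - q (k + 1) / x)))" if k: "k \<in> {0..g}" for k
    proof -
      have b: "p k < q (k + 1)" "q (k + 1) \<le> q (g + 1)" using band_order[of k] q_mono[of "k + 1" "g + 1"] k by auto
      then have x: "0 < x" "p k < x" "q (k + 1) < x" using elim by auto
      have "sqrt ((1 - p k / x) * (1 - q (k + 1) / x)) = sqrt ((x - p k) * (x - q (k + 1)) / x\<^sup>2)"
        using x by (simp add: field_simps power2_eq_square)
      also have "\<dots> = sqrt ((x - p k) * (x - q (k + 1))) / x"
        using x by (simp add: real_sqrt_divide)
      finally show ?thesis
        using csqrt_pair_outside[OF b(1), of x] x by simp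
    qed
    have "(\<Prod>k=0..g. of_real (sqrt ((1 - p k / x) * (1 - q (k + 1) / x))))
        = (\<Prod>k=0..g. csqrt (of_real x - of_real (p k)) * csqrt (of_real x - of_real (q (k + 1))) / of_real x)"
      by (intro prod.cong refl pr[symmetric])
    also have "\<dots> = band_root (of_real x) / of_real x ^ (g + 1)"
      unfolding band_root_def prod_dividef by simp
    finally show ?case .
  qed
  ultimately show ?thesis by (simp add: tendsto_cong)
qed

text \<open>Off the half-line to the left of the last endpoint both functions are continuous square roots of the
same nonvanishing function on a connected set that agree near $+\infty$. The remaining real points are
reached by taking limits from above.\<close>

lemma band_root_eq:
  assumes R: "band_sqrt g p q R"
  shows "R = band_root"
proof
  fix z
  let ?B = "complex_of_real ` bands g p q"
  have holR: "R holomorphic_on - ?B" and sqR: "\<And>z. z \<notin> ?B \<Longrightarrow> (R z)\<^sup>2 = (band_root z)\<^sup>2"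
    and posR: "\<forall>\<^sub>F x in at_top. Im (R (of_real x)) = 0 \<and> Re (R (of_real x)) > 0"
    and limR: "\<And>x. x \<in> bands g p q \<Longrightarrow> (R \<longlongrightarrow> R (of_real x)) (at (of_real x) within upper_half_plane)"
    using R by (auto simp: band_sqrt_def band_root_squared)
  have bounds: "x \<le> q (g + 1)" if "x \<in> bands g p q" for x
    using that q_mono[of _ "g + 1"] by (fastforce simp: bands_def)
  then have sub: "slit_plane \<subseteq> - ?B" by (force simp: slit_plane_def)
  have nz: "band_root w \<noteq> 0" if "w \<in> slit_plane" for w
    using that endpoints_bounds by (force simp: band_root_eq_0_iff slit_plane_def)
  define T where "T w = R w / band_root w" for w
  have T: "T w \<in> {1, -1}" if "w \<in> slit_plane" for w
  proof -
    have "(T w)\<^sup>2 = 1" using sqR[of w] nz[OF that] sub that by (auto simp: T_def power_divide)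
    then show ?thesis by (simp add: power2_eq_1_iff)
  qed
  have "T constant_on slit_plane"
  proof (rule continuous_finite_range_constant[OF connected_slit_plane])
    show "continuous_on slit_plane T"
      unfolding T_def using nz
      by (intro continuous_intros holomorphic_on_imp_continuous_on[OF holomorphic_on_subset[OF holR sub]]
                holomorphic_on_imp_continuous_on[OF holomorphic_on_band_root]) auto
    show "finite (T ` slit_plane)"
      by (rule finite_subset[of _ "{1, -1}"]) (use T in auto)
  qed
  then obtain \<kappa> where \<kappa>: "\<And>w. w \<in> slit_plane \<Longrightarrow> T w = \<kappa>" by (auto simp: constant_on_def)
  obtain x where x: "x > q (g + 1)" "Re (R (of_real x)) > 0"
    using eventually_happens[OF eventually_conj[OF posR eventually_gt_at_top[of "q (g + 1)"]]]
    by (auto simp: trivial_limit_at_top_linorder)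
  have xs: "of_real x \<in> slit_plane" using x by (simp add: slit_plane_def)
  have "Re (band_root (of_real x)) > 0"
  proof -
    have "csqrt (of_real x - of_real e) = of_real (sqrt (x - e))" if "e \<in> endpoints" for e
      using endpoints_bounds[OF that] x csqrt_of_real[of "x - e"] by simp
    then have "band_root (of_real x) = of_real (\<Prod>e\<in>endpoints. sqrt (x - e))"
      by (simp add: band_root_endpoints)
    moreover have "0 < (\<Prod>e\<in>endpoints. sqrt (x - e))"
      by (intro prod_pos) (use endpoints_bounds x in fastforce)
    ultimately show ?thesis by (simp only: Re_complex_of_real)
  qed
  moreover have "R (of_real x) = \<kappa> * band_root (of_real x)"
    using \<kappa>[OF xs] nz[OF xs] by (auto simp: T_def)
  ultimately have "\<kappa> = 1"
    using T[OF xs] \<kappa>[OF xs] x(2) by auto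
  then have slit: "R w = band_root w" if "w \<in> slit_plane" for w
    using \<kappa>[OF that] nz[OF that] by (auto simp: T_def)
  show "R z = band_root z"
  proof (cases "z \<in> slit_plane")
    case False
    define x where "x = Re z"
    have z: "z = of_real x" using False by (simp add: slit_plane_def complex_eq_iff x_def)
    have "(R \<longlongrightarrow> R z) (at z within upper_half_plane)"
    proof (cases "x \<in> bands g p q")
      case True
      then show ?thesis using limR z by simp
    next
      case False
      then have "z \<notin> ?B" using z by auto
      moreover have "open (- ?B)"
      proof -
        have "compact (bands g p q)" unfolding bands_def by (intro compact_UN) auto
        then have "compact ?B" by (intro compact_continuous_image continuous_intros)
        then show ?thesis by (simp add: compact_imp_closed open_Compl)
      qed
      ultimately have "isCont R z"
        using holomorphic_on_imp_continuous_on[OF holR] by (simp add: continuous_on_eq_continuous_at)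
      then show ?thesis unfolding isCont_def by (rule tendsto_within_subset) simp
    qed
    moreover have "(band_root \<longlongrightarrow> band_root z) (at z within upper_half_plane)"
      unfolding z by (rule band_root_boundary)
    moreover have "eventually (\<lambda>w. band_root w = R w) (at z within upper_half_plane)"
      unfolding eventually_at by (intro exI[of _ 1]) (auto simp: slit slit_plane_def)
    ultimately have "(R \<longlongrightarrow> R z) (at z within upper_half_plane)" "(R \<longlongrightarrow> band_root z) (at z within upper_half_plane)"
      using Lim_transform_eventually by blast+
    then show ?thesis
      unfolding z by (rule tendsto_unique[OF at_within_upper_half_plane_neq_bot])
  qed (use slit in auto)
qed

lemma real_line_cases:
  assumes "x \<notin> endpoints"
  obtains (left) "x < p 0" | (right) "q (g + 1) < x"
    | (band) k where "k \<le> g" "p k < x" "x < q (k + 1)"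
    | (gap) k where "k \<in> {1..g}" "q k < x" "x < p k"
proof -
  have E: "x \<noteq> p k" "x \<noteq> q (k + 1)" if "k \<le> g" for k
    using assms that by (auto simp: endpoints_def)
  consider "x < p 0" | k where "k \<le> g" "p k < x" "\<forall>j. k < j \<longrightarrow> j \<le> g \<longrightarrow> x < p j"
  proof (cases "x < p 0")
    case False
    define S where "S = {k. k \<le> g \<and> p k < x}"
    have S: "finite S" "S \<noteq> {}" using False E[of 0] by (auto simp: S_def)
    have "Max S \<in> S" using S by (rule Max_in)
    moreover have "x < p j" if "Max S < j" "j \<le> g" for j
    proof -
      have "j \<notin> S" using that Max_ge[OF S(1), of j] by auto
      then show ?thesis using that E(1)[of j] by (auto simp: S_def)
    qed
    ultimately show ?thesis using that(2)[of "Max S"] by (auto simp: S_def)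
  qed (use that in auto)
  then show thesis
  proof cases
    case (2 k)
    consider "x < q (k + 1)" | "q (k + 1) < x" "k = g" | "q (k + 1) < x" "k + 1 \<in> {1..g}"
      using E(2)[OF 2(1)] 2(1) by (cases "k = g") (auto simp: linorder_neq_iff)
    then show ?thesis
    proof cases
      case 1
      with 2 show ?thesis by (intro band)
    next
      case 2
      with \<open>k \<le> g\<close> show ?thesis by (intro right) simp
    next
      case 3
      have "x < p (k + 1)" using 2(3) 3(2) by simp
      with 3 show ?thesis by (intro gap)
    qed
  qed (use that in auto)
qed

text \<open>On the bands the square root is \<open>\<i>\<close> times this real number.\<close>

definition band_amplitude :: "real \<Rightarrow> real" where
  "band_amplitude x = sqrt ((x - p 0) * (q (g + 1) - x)) * (\<Prod>j=1..g. sgn (x - q j) * sqrt ((x - q j) * (x - p j)))"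

lemma band_root_on_band:
  assumes k: "k \<le> g" and x: "p k \<le> x" "x \<le> q (k + 1)"
  shows "band_root (of_real x) = \<i> * of_real (band_amplitude x)"
proof -
  have o: "p 0 \<le> x" "x \<le> q (g + 1)"
    using x p_mono[of 0 k] q_mono[of "k + 1" "g + 1"] k by auto
  have "csqrt (of_real x - of_real (q j)) * csqrt (of_real x - of_real (p j))
      = of_real (sgn (x - q j) * sqrt ((x - q j) * (x - p j)))" if "j \<in> {1..g}" for j
  proof (rule csqrt_pair_outside[OF gap_order[OF that]])
    show "x \<le> q j \<or> p j \<le> x"
      using that x k p_mono[of j k] q_mono[of "k + 1" j] by (cases "j \<le> k") auto
  qed
  then show ?thesis
    unfolding band_root_gaps band_amplitude_def csqrt_pair_inside[OF outer_less o] by simp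
qed

lemma band_root_off_bands_real:
  assumes "x < p 0 \<or> q (g + 1) < x \<or> (\<exists>k\<in>{1..g}. q k < x \<and> x < p k)"
  shows "band_root (of_real x) \<in> \<real>"
  using assms
proof (elim disjE bexE conjE)
  assume "x < p 0"
  then have "csqrt (of_real x - of_real (p k)) * csqrt (of_real x - of_real (q (k + 1))) \<in> \<real>" if "k \<le> g" for k
    using csqrt_pair_outside[OF band_order[OF that], of x] p_mono[of 0 k] that by simp
  then show ?thesis unfolding band_root_def by (intro prod_in_Reals) auto
next
  assume "q (g + 1) < x"
  then have "csqrt (of_real x - of_real (p k)) * csqrt (of_real x - of_real (q (k + 1))) \<in> \<real>" if "k \<le> g" for k
    using csqrt_pair_outside[OF band_order[OF that], of x] q_mono[of "k + 1" "g + 1"] that by simp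
  then show ?thesis unfolding band_root_def by (intro prod_in_Reals) auto
next
  fix k assume k: "k \<in> {1..g}" "q k < x" "x < p k"
  have o: "p 0 \<le> x" "x \<le> q (g + 1)"
    using k p_less_q[of 0 k] p_less_q[of k "g + 1"] by auto
  let ?c = "\<lambda>j. csqrt (of_real x - of_real (q j)) * csqrt (of_real x - of_real (p j))"
  have "?c j \<in> \<real>" if "j \<in> {1..g} - {k}" for j
  proof -
    have "x \<le> q j \<or> p j \<le> x"
      using that k p_less_q[of k j] p_less_q[of j k] by (cases "j < k") auto
    then show ?thesis
      using csqrt_pair_outside[OF gap_order[of j]] that by simp
  qed
  then have "(\<Prod>j\<in>{1..g} - {k}. ?c j) \<in> \<real>" by (rule prod_in_Reals)
  moreover have "band_root (of_real x) = csqrt (of_real x - of_real (p 0)) * csqrt (of_real x - of_real (q (g + 1)))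
      * (?c k * (\<Prod>j\<in>{1..g} - {k}. ?c j))"
    unfolding band_root_gaps using prod.remove[of "{1..g}" k ?c] k by simp
  moreover have "csqrt (of_real x - of_real (p 0)) * csqrt (of_real x - of_real (q (g + 1))) * ?c k \<in> \<real>"
    unfolding csqrt_pair_inside[OF outer_less o]
    using csqrt_pair_inside[OF gap_order[OF k(1)], of x] k by (simp add: complex_is_Real_iff)
  ultimately show ?thesis by (simp only: mult.assoc[symmetric] Reals_mult)
qed

text \<open>Each gap contributes the same sign to the amplitude as the factor $x - \xi_j$ with a zero
$\xi_j$ in that gap, so that the quotient has the same sign on all bands.\<close>

lemma band_amplitude_sign:
  assumes k: "k \<le> g" and x: "p k < x" "x < q (k + 1)"
    and \<xi>: "\<And>j. j \<in> {1..g} \<Longrightarrow> q j < \<xi> j \<and> \<xi> j < p j"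
  shows "0 < (\<Prod>j=1..g. x - \<xi> j) / band_amplitude x"
proof -
  have o: "p 0 < x" "x < q (g + 1)"
    using x p_mono[of 0 k] q_mono[of "k + 1" "g + 1"] k by auto
  have "0 < (x - \<xi> j) / (sgn (x - q j) * sqrt ((x - q j) * (x - p j)))" if j: "j \<in> {1..g}" for j
  proof (cases "j \<le> k")
    case True
    then have "p j < x" using x k p_mono[of j k] by auto
    then show ?thesis using \<xi>[OF j] gap_order[OF j] by simp
  next
    case False
    then have "x < q j" using x j q_mono[of "k + 1" j] by auto
    moreover from this gap_order[OF j] have "0 < (x - q j) * (x - p j)" by (intro mult_neg_neg) auto
    moreover have "x - \<xi> j < 0" using \<xi>[OF j] \<open>x < q j\<close> by simp
    ultimately show ?thesis by (simp add: divide_neg_pos)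
  qed
  then have "0 < (\<Prod>j=1..g. (x - \<xi> j) / (sgn (x - q j) * sqrt ((x - q j) * (x - p j))))"
    by (intro prod_pos) auto
  then have "0 < (\<Prod>j=1..g. x - \<xi> j) / (\<Prod>j=1..g. sgn (x - q j) * sqrt ((x - q j) * (x - p j)))"
    by (simp add: prod_dividef)
  moreover have "0 < 1 / sqrt ((x - p 0) * (q (g + 1) - x))" using o by simp
  ultimately have "0 < 1 / sqrt ((x - p 0) * (q (g + 1) - x)) * ((\<Prod>j=1..g. x - \<xi> j) / (\<Prod>j=1..g. sgn (x - q j) * sqrt ((x - q j) * (x - p j))))"
    by (rule mult_pos_pos[rotated])
  then show ?thesis by (simp add: band_amplitude_def)
qed

end

section \<open>Sign arguments and polynomials with prescribed zeros\<close>

lemma set_integral_pos: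
  fixes f :: "real \<Rightarrow> real"
  assumes f: "set_integrable lborel A f" and nonneg: "\<And>x. x \<in> A \<Longrightarrow> 0 \<le> f x"
    and pos: "\<And>x. u < x \<Longrightarrow> x < v \<Longrightarrow> x \<in> A \<and> 0 < f x" and uv: "u < v"
  shows "0 < (LINT x:A|lborel. f x)"
proof (rule ccontr)
  let ?h = "\<lambda>x. indicator A x *\<^sub>R f x"
  have h: "integrable lborel ?h" using f by (simp add: set_integrable_def)
  have n: "0 \<le> ?h x" for x using nonneg by (auto simp: indicator_def)
  assume "\<not> 0 < (LINT x:A|lborel. f x)"
  moreover have "0 \<le> (LINT x:A|lborel. f x)"
    unfolding set_lebesgue_integral_def by (intro Bochner_Integration.integral_nonneg n)
  ultimately have "integral\<^sup>L lborel ?h = 0"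
    by (simp add: set_lebesgue_integral_def)
  then have "AE x in lborel. ?h x = 0"
    using integral_nonneg_eq_0_iff_AE[OF h] n by simp
  then have "AE x in lborel. x \<notin> {u<..<v}"
    by eventually_elim (use pos in \<open>force simp: indicator_def\<close>)
  then have "emeasure lborel {u<..<v} = 0"
    by (subst (asm) AE_iff_measurable[where N="{u<..<v}"]) auto
  then show False using uv by simp
qed

lemma zero_of_set_integral_eq_zero:
  fixes f :: "real \<Rightarrow> real"
  assumes uv: "u < v" and f: "set_integrable lborel {u<..<v} f" and cont: "continuous_on {u<..<v} f"
    and zero: "(LINT x:{u<..<v}|lborel. f x) = 0"
  shows "\<exists>x. u < x \<and> x < v \<and> f x = 0"
proof (rule ccontr)
  assume "\<not> ?thesis"
  then have nz: "f x \<noteq> 0" if "x \<in> {u<..<v}" for x using that by auto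
  have conn: "connected (f ` {u<..<v})" by (intro connected_continuous_image cont) simp
  have "(\<forall>x\<in>{u<..<v}. 0 < f x) \<or> (\<forall>x\<in>{u<..<v}. f x < 0)"
  proof (rule ccontr)
    assume "\<not> ?thesis"
    then obtain x y where xy: "x \<in> {u<..<v}" "y \<in> {u<..<v}" "f x \<le> 0" "0 \<le> f y" by force
    have "0 \<in> f ` {u<..<v}"
      by (rule connectedD_interval[OF conn imageI[OF xy(1)] imageI[OF xy(2)] xy(3,4)])
    then show False using nz by auto
  qed
  then show False
  proof
    assume "\<forall>x\<in>{u<..<v}. 0 < f x"
    then have "0 < (LINT x:{u<..<v}|lborel. f x)"
      by (intro set_integral_pos[OF f _ _ uv]) (auto intro: less_imp_le)
    then show False using zero by simp
  next
    assume "\<forall>x\<in>{u<..<v}. f x < 0"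
    then have "0 < (LINT x:{u<..<v}|lborel. - f x)"
      using f by (intro set_integral_pos[OF _ _ _ uv]) (auto intro: less_imp_le simp: set_integrable_def)
    then show False using zero by (simp add: set_lebesgue_integral_def)
  qed
qed

lemma prod_linear_factors_dvd:
  fixes r :: "'a::idom poly"
  assumes "finite S" "\<And>a. a \<in> S \<Longrightarrow> poly r a = 0"
  shows "(\<Prod>a\<in>S. [:- a, 1:]) dvd r"
  using assms
proof (induction S arbitrary: r rule: finite_induct)
  case (insert a S)
  have "poly r a = 0" using insert.prems by simp
  then obtain s where s: "r = [:- a, 1:] * s"
    by (auto simp: poly_eq_0_iff_dvd elim: dvdE)
  have "poly s b = 0" if "b \<in> S" for b
    using insert.prems[of b] insert.hyps that by (auto simp: s)
  then have "(\<Prod>a\<in>S. [:- a, 1:]) dvd s" by (rule insert.IH)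
  then have "[:- a, 1:] * (\<Prod>a\<in>S. [:- a, 1:]) dvd [:- a, 1:] * s" by (intro mult_dvd_mono dvd_refl)
  then show ?case unfolding s prod.insert[OF insert.hyps] .
qed simp

lemma poly_eq_prod_of_roots:
  fixes r :: "'a::idom poly"
  assumes S: "finite S" "\<And>a. a \<in> S \<Longrightarrow> poly r a = 0" and deg: "degree r \<le> card S"
  obtains k where "\<And>z. poly r z = k * (\<Prod>a\<in>S. z - a)"
proof -
  obtain s where s: "r = (\<Prod>a\<in>S. [:- a, 1:]) * s"
    using prod_linear_factors_dvd[OF S] by (auto elim: dvdE)
  have "degree s = 0"
  proof (cases "s = 0")
    case False
    have "degree (\<Prod>a\<in>S. [:- a, 1:]) = card S"
      using S(1) by (subst degree_prod_eq_sum_degree) auto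
    moreover have "degree r = degree (\<Prod>a\<in>S. [:- a, 1:]) + degree s"
      unfolding s using False S(1) by (intro degree_mult_eq) auto
    ultimately show ?thesis using deg by simp
  qed simp
  then obtain k where "s = [:k:]" by (auto elim: degree_eq_zeroE)
  then have "poly r z = k * (\<Prod>a\<in>S. z - a)" for z
    unfolding s by (simp add: poly_prod algebra_simps)
  then show ?thesis by (rule that)
qed

section \<open>The polynomial attached to the density\<close>

text \<open>The hypotheses of the theorem on the density, with the principal values already expressed through
vertical limits of the Cauchy transform and \<open>\<alpha>\<close> in the role of $\langle a_0\rangle$.\<close>

locale band_density = band_system g p q + compact_density J "p 0" "q (g + 1)" B
  for g p q J B +
  fixes \<alpha> :: real and c :: "nat \<Rightarrow> real"
  assumes on_bands: "\<And>x. x \<in> bands g p q \<Longrightarrow> ((\<lambda>y. Re (F (Complex x y))) \<longlongrightarrow> x - \<alpha>) (at_right 0)"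
    and on_gaps: "\<And>k x. k \<in> {1..g} \<Longrightarrow> x \<in> gap p q k \<Longrightarrow> J x = c k"
begin

text \<open>The product of the square root and $1 - F'$ is analytic off the endpoints by
\<open>reflected_product\<close>. Near an endpoint $e$ it is at most of order
$|z-e|^{1/2}/|\mathrm{Im}\, z|$, by the trivial bound for \<open>F'\<close>, so the endpoints are
removable by \<open>removable_of_axis_bound\<close>.\<close>

lemma entire_product_exists:
  "\<exists>h. h holomorphic_on UNIV \<and> (\<forall>z. 0 < Im z \<longrightarrow> h z = band_root z * (1 - F' z)) \<and>
    (\<forall>z. Im z \<noteq> 0 \<longrightarrow> h (cnj z) = cnj (h z)) \<and> (\<forall>x. x \<notin> endpoints \<longrightarrow> h (of_real x) \<in> \<real>)"
proof -
  obtain M where M: "M holomorphic_on - of_real ` endpoints"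
    "\<And>z. 0 < Im z \<Longrightarrow> M z = band_root z * (1 - F' z)" "\<And>z. Im z \<noteq> 0 \<Longrightarrow> M (cnj z) = cnj (M z)"
    "\<And>x. x \<notin> endpoints \<Longrightarrow> M (of_real x) \<in> \<real>"
  proof (rule reflected_product[OF finite_endpoints holomorphic_on_band_root_upper continuous_on_band_root])
    fix x assume "x \<notin> endpoints"
    then show "Re (band_root (of_real x)) = 0 \<and> (\<exists>r>0. \<forall>t. \<bar>t - x\<bar> < r \<longrightarrow> ((\<lambda>y. Re (F (Complex t y))) \<longlongrightarrow> t - \<alpha>) (at_right 0)) \<or>
      Im (band_root (of_real x)) = 0 \<and> (\<exists>r>0. \<exists>c. \<forall>t. \<bar>t - x\<bar> < r \<longrightarrow> J t = c)"
    proof (cases rule: real_line_cases)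
      case left
      then have "Im (band_root (of_real x)) = 0" using band_root_off_bands_real[of x] by (simp add: complex_is_Real_iff)
      moreover have "J t = 0" if "\<bar>t - x\<bar> < p 0 - x" for t using that by (intro density_outside) auto
      ultimately show ?thesis using left by (intro disjI2 conjI exI[of _ "p 0 - x"] exI[of _ 0]) auto
    next
      case right
      then have "Im (band_root (of_real x)) = 0" using band_root_off_bands_real[of x] by (simp add: complex_is_Real_iff)
      moreover have "J t = 0" if "\<bar>t - x\<bar> < x - q (g + 1)" for t using that by (intro density_outside) auto
      ultimately show ?thesis using right by (intro disjI2 conjI exI[of _ "x - q (g + 1)"] exI[of _ 0]) auto
    next
      case (band k)
      have "t \<in> bands g p q" if "\<bar>t - x\<bar> < min (x - p k) (q (k + 1) - x)" for t
        unfolding bands_def using that band by (intro UN_I[of k]) auto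
      then show ?thesis
        using band band_root_on_band[of k x] on_bands
        by (intro disjI1 conjI exI[of _ "min (x - p k) (q (k + 1) - x)"]) auto
    next
      case (gap k)
      then have "x < p 0 \<or> q (g + 1) < x \<or> (\<exists>k\<in>{1..g}. q k < x \<and> x < p k)" by blast
      then have "Im (band_root (of_real x)) = 0"
        by (rule band_root_off_bands_real[unfolded complex_is_Real_iff])
      moreover have "J t = c k" if "\<bar>t - x\<bar> < min (x - q k) (p k - x)" for t
        by (rule on_gaps[OF gap(1)]) (use that in \<open>auto simp: gap_def\<close>)
      ultimately show ?thesis using gap
        by (intro disjI2 conjI exI[of _ "min (x - q k) (p k - x)"] exI[of _ "c k"]) auto
    qed
  qed blast
  obtain h where h: "h holomorphic_on UNIV" "\<And>z. z \<notin> of_real ` endpoints \<Longrightarrow> h z = M z"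
  proof (rule removable_of_axis_bound[OF finite_endpoints M(1)])
    fix e assume e: "e \<in> endpoints"
    obtain D where D: "0 \<le> D" "\<And>z. norm (z - of_real e) < 1 \<Longrightarrow> norm (band_root z) \<le> D * sqrt (norm (z - of_real e))"
      using band_root_near_endpoint[OF e] by blast
    define A where "A = D * (1 + pi * B)"
    have up: "norm (M z) \<le> A * sqrt (norm (z - of_real e)) / \<bar>Im z\<bar>" if z: "0 < Im z" "norm (z - of_real e) < 1" for z
    proof -
      have "Im z < 1" using abs_Im_le_cmod[of "z - of_real e"] z by simp
      have "norm (1 - F' z) \<le> 1 + norm (F' z)" using norm_triangle_ineq4[of 1 "F' z"] by simp
      also have "\<dots> \<le> 1 / Im z + pi * B / Im z"
        using cauchy_transform_derivative_bound[OF z(1)] \<open>Im z < 1\<close> z(1) by (intro add_mono) auto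
      finally have "norm (1 - F' z) \<le> (1 + pi * B) / Im z" by (simp add: add_divide_distrib)
      then have "norm (M z) \<le> D * sqrt (norm (z - of_real e)) * ((1 + pi * B) / Im z)"
        unfolding M(2)[OF z(1)] norm_mult using D z by (intro mult_mono) auto
      then show ?thesis using z(1) by (simp add: A_def mult_ac)
    qed
    have "norm (M z) \<le> A * sqrt (norm (z - of_real e)) / \<bar>Im z\<bar>" if z: "Im z \<noteq> 0" "norm (z - of_real e) < 1" for z
    proof (cases "0 < Im z")
      case False
      have "cnj z - of_real e = cnj (z - of_real e)" by simp
      then have n: "norm (cnj z - of_real e) = norm (z - of_real e)" by (metis complex_mod_cnj)
      have "M z = cnj (M (cnj z))" using M(3)[OF z(1)] by simp
      then show ?thesis using up[of "cnj z"] z False n by simp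
    qed (use up z in auto)
    then show "\<exists>A d. 0 < d \<and> (\<forall>z. Im z \<noteq> 0 \<longrightarrow> norm (z - of_real e) < d \<longrightarrow> norm (M z) \<le> A * sqrt (norm (z - of_real e)) / \<bar>Im z\<bar>)"
      by (intro exI[of _ A] exI[of _ 1]) auto
  qed blast
  have nr: "z \<notin> of_real ` endpoints" if "Im z \<noteq> 0" for z using that by auto
  show ?thesis
  proof (intro exI[of _ h] conjI allI impI)
    show "h z = band_root z * (1 - F' z)" if "0 < Im z" for z
      using that M(2)[OF that] h(2)[OF nr[of z]] by simp
    show "h (cnj z) = cnj (h z)" if "Im z \<noteq> 0" for z
      using that M(3)[OF that] h(2)[OF nr[of z]] h(2)[OF nr[of "cnj z"]] by simp
    show "h (of_real x) \<in> \<real>" if "x \<notin> endpoints" for x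
    proof -
      have "complex_of_real x \<notin> of_real ` endpoints" using that by auto
      then show ?thesis using M(4)[OF that] h(2) by simp
    qed
  qed (rule h(1))
qed

text \<open>Since \<open>F'\<close> decays like $1/z^2$, the entire product grows like the square root itself,
that is, like $z^{g+1}$. Liouville's theorem makes it a polynomial, and its leading coefficient is read
off along the positive real axis.\<close>

lemma entire_product_polynomial:
  obtains m where "degree m = g + 1" "lead_coeff m = 1"
    "\<And>z. 0 < Im z \<Longrightarrow> poly m z = band_root z * (1 - F' z)"
    "\<And>x. x \<notin> endpoints \<Longrightarrow> poly m (of_real x) \<in> \<real>"
proof -
  obtain h where h: "h holomorphic_on UNIV" "\<And>z. 0 < Im z \<Longrightarrow> h z = band_root z * (1 - F' z)"
    "\<And>z. Im z \<noteq> 0 \<Longrightarrow> h (cnj z) = cnj (h z)" "\<And>x. x \<notin> endpoints \<Longrightarrow> h (of_real x) \<in> \<real>"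
    using entire_product_exists by blast
  have contH: "isCont h z" for z
    using holomorphic_on_imp_continuous_on[OF h(1)] by (simp add: continuous_on_eq_continuous_at)
  define K where "K = 2 * (\<bar>p 0\<bar> + \<bar>q (g + 1)\<bar> + 1)"
  have K: "2 \<le> K" by (simp add: K_def)
  define C where "C = 2 ^ (g + 1) * (1 + decay_constant)"
  note dc = decay_constant_nonneg
  have upper: "norm (h z) \<le> C * norm z ^ (g + 1)" if z: "0 < Im z" "K \<le> norm z" for z
  proof -
    have "norm (F' z) \<le> decay_constant / (norm z)\<^sup>2"
      by (rule cauchy_transform_decay) (use z in \<open>auto simp: K_def\<close>)
    also have "\<dots> \<le> decay_constant / 1"
      using z K dc by (intro divide_left_mono) (auto simp: one_le_power)
    finally have "norm (1 - F' z) \<le> 1 + decay_constant"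
      using norm_triangle_ineq4[of 1 "F' z"] by simp
    then have "norm (h z) \<le> (2 * norm z) ^ (g + 1) * (1 + decay_constant)"
      unfolding h(2)[OF z(1)] norm_mult
      using band_root_growth[of z] z by (intro mult_mono) (auto simp: K_def)
    then show ?thesis by (simp add: C_def power_mult_distrib mult_ac)
  qed
  have growth: "norm (h z) \<le> C * norm z ^ (g + 1)" if z: "K \<le> norm z" for z
  proof -
    consider "0 < Im z" | "Im z < 0" | "Im z = 0" by linarith
    then show ?thesis
    proof cases
      case 1
      then show ?thesis using upper z by blast
    next
      case 2
      then have "norm (h (cnj z)) \<le> C * norm (cnj z) ^ (g + 1)" using z by (intro upper) auto
      moreover have "h (cnj z) = cnj (h z)" using h(3) 2 by auto
      ultimately show ?thesis by simp
    next
      case 3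
      then have zx: "z = of_real (Re z)" by (simp add: complex_eq_iff)
      \<comment> \<open>real points are limits of points above them, which are farther from the origin, so that the bound applies there\<close>
      have lim: "(\<lambda>y. Complex (Re z) y) \<midarrow>0\<rightarrow> z"
        using tendsto_Complex[OF tendsto_const[of "Re z"] tendsto_ident_at[of 0 UNIV]] 3
        by (metis complex_surj)
      then have lim: "((\<lambda>y. Complex (Re z) y) \<longlongrightarrow> z) (at_right 0)"
        by (rule tendsto_within_subset) simp
      have "((\<lambda>y. norm (h (Complex (Re z) y))) \<longlongrightarrow> norm (h z)) (at_right 0)"
        by (intro tendsto_norm isCont_tendsto_compose[OF contH] lim)
      moreover have "((\<lambda>y. C * norm (Complex (Re z) y) ^ (g + 1)) \<longlongrightarrow> C * norm z ^ (g + 1)) (at_right 0)"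
        by (intro tendsto_intros lim)
      moreover have "eventually (\<lambda>y. norm (h (Complex (Re z) y)) \<le> C * norm (Complex (Re z) y) ^ (g + 1)) (at_right 0)"
      proof (rule eventually_mono[OF eventually_at_right_less])
        fix y :: real assume y: "0 < y"
        have "norm z \<le> norm (Complex (Re z) y)"
          using zx abs_Re_le_cmod[of "Complex (Re z) y"] by (metis complex.sel(1) norm_of_real)
        then show "norm (h (Complex (Re z) y)) \<le> C * norm (Complex (Re z) y) ^ (g + 1)"
          using y z by (intro upper) auto
      qed
      ultimately show ?thesis by (intro tendsto_le[of "at_right 0"]) auto
    qed
  qed
  define a where "a k = (deriv ^^ k) h 0 / fact k" for k
  have hs: "h z = (\<Sum>k\<le>g + 1. a k * z ^ k)" for z
    unfolding a_def by (rule Liouville_polynomial[OF h(1) growth])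
  define m where "m = (\<Sum>k\<le>g + 1. monom (a k) k)"
  have m: "poly m z = h z" for z
    by (simp add: m_def hs poly_sum poly_monom)
  have coeff: "coeff m k = (if k \<le> g + 1 then a k else 0)" for k
    by (auto simp: m_def coeff_sum coeff_monom)
  have lim1: "((\<lambda>x. h (of_real x) / of_real x ^ (g + 1)) \<longlongrightarrow> a (g + 1)) at_top"
  proof -
    have "((\<lambda>x. \<Sum>k\<le>g + 1. a k * of_real x ^ k / of_real x ^ (g + 1)) \<longlongrightarrow> (\<Sum>k\<le>g + 1. if k = g + 1 then a k else 0)) at_top"
    proof (intro tendsto_sum)
      fix k assume "k \<in> {..g + 1}"
      then consider "k = g + 1" | "k < g + 1" by force
      then show "((\<lambda>x. a k * of_real x ^ k / of_real x ^ (g + 1)) \<longlongrightarrow> (if k = g + 1 then a k else 0)) at_top"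
      proof cases
        case 1
        have "eventually (\<lambda>x. a k = a k * of_real x ^ k / of_real x ^ (g + 1)) (at_top :: real filter)"
          using eventually_gt_at_top[of 0] by eventually_elim (simp add: 1)
        then show ?thesis using 1 by (simp add: tendsto_eventually eventually_mono)
      next
        case 2
        have inv: "((\<lambda>x. inverse (complex_of_real x)) \<longlongrightarrow> 0) at_top"
          using tendsto_inverse_0 filterlim_of_real_at_infinity by (rule filterlim_compose)
        have t1: "((\<lambda>x. a k * inverse (of_real x) ^ (g + 1 - k)) \<longlongrightarrow> a k * 0 ^ (g + 1 - k)) at_top"
          by (intro tendsto_intros inv)
        have t2: "eventually (\<lambda>x. a k * inverse (of_real x) ^ (g + 1 - k) = a k * of_real x ^ k / of_real x ^ (g + 1)) (at_top :: real filter)"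
          using eventually_gt_at_top[of 0]
        proof eventually_elim
          case (elim x)
          have "complex_of_real x ^ (g + 1) = of_real x ^ (g + 1 - k) * of_real x ^ k"
            using 2 by (simp flip: power_add)
          then show ?case using elim by (simp add: field_simps)
        qed
        have t3: "a k * 0 ^ (g + 1 - k) = (if k = g + 1 then a k else 0)"
          using 2 by (simp add: power_0_left)
        show ?thesis unfolding t3[symmetric] by (rule Lim_transform_eventually[OF t1 t2])
      qed
    qed
    then show ?thesis unfolding hs sum_divide_distrib by simp
  qed
  have near: "norm (h (of_real x) - band_root (of_real x)) \<le> norm (band_root (of_real x)) * (decay_constant / x\<^sup>2)"
    if x: "K \<le> x" for x
  proof -
    have lim: "((\<lambda>y. Complex x y) \<longlongrightarrow> of_real x) (at_right 0)"
      unfolding complex_of_real_def by (intro tendsto_intros)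
    have limR: "((\<lambda>y. band_root (Complex x y)) \<longlongrightarrow> band_root (of_real x)) (at_right 0)"
      by (rule tendsto_at_right_vertical_line[OF band_root_boundary])
    have "((\<lambda>y. norm (h (Complex x y) - band_root (Complex x y))) \<longlongrightarrow> norm (h (of_real x) - band_root (of_real x))) (at_right 0)"
      by (intro tendsto_intros isCont_tendsto_compose[OF contH] lim limR)
    moreover have "((\<lambda>y. norm (band_root (Complex x y)) * (decay_constant / x\<^sup>2)) \<longlongrightarrow> norm (band_root (of_real x)) * (decay_constant / x\<^sup>2)) (at_right 0)"
      by (intro tendsto_intros limR)
    moreover have "eventually (\<lambda>y. norm (h (Complex x y) - band_root (Complex x y)) \<le> norm (band_root (Complex x y)) * (decay_constant / x\<^sup>2)) (at_right 0)"
    proof (rule eventually_mono[OF eventually_at_right_less])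
      fix y :: real assume y: "0 < y"
      have nx: "x \<le> norm (Complex x y)" using abs_Re_le_cmod[of "Complex x y"] by simp
      have "h (Complex x y) - band_root (Complex x y) = - (band_root (Complex x y) * F' (Complex x y))"
        using h(2)[of "Complex x y"] y by (simp add: algebra_simps)
      then have eq: "norm (h (Complex x y) - band_root (Complex x y)) = norm (band_root (Complex x y)) * norm (F' (Complex x y))"
        by (simp add: norm_mult)
      have "0 < x" using K x by simp
      have "norm (F' (Complex x y)) \<le> decay_constant / (norm (Complex x y))\<^sup>2"
        by (rule cauchy_transform_decay) (use y x nx in \<open>auto simp: K_def\<close>)
      also have "\<dots> \<le> decay_constant / x\<^sup>2"
        using nx dc \<open>0 < x\<close> by (intro divide_left_mono power_mono mult_pos_pos zero_less_power) linarith+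
      finally show "norm (h (Complex x y) - band_root (Complex x y)) \<le> norm (band_root (Complex x y)) * (decay_constant / x\<^sup>2)"
        unfolding eq by (rule mult_left_mono) simp
    qed
    ultimately show ?thesis by (intro tendsto_le[of "at_right 0"]) auto
  qed
  have "((\<lambda>x. h (of_real x) / of_real x ^ (g + 1) - band_root (of_real x) / of_real x ^ (g + 1)) \<longlongrightarrow> 0) at_top"
  proof (rule Lim_null_comparison)
    show "eventually (\<lambda>x. norm (h (of_real x) / of_real x ^ (g + 1) - band_root (of_real x) / of_real x ^ (g + 1))
        \<le> norm (band_root (of_real x) / of_real x ^ (g + 1)) * (decay_constant / x\<^sup>2)) at_top"
      using eventually_ge_at_top[of K]
    proof eventually_elim
      case (elim x)
      have "norm (h (of_real x) / of_real x ^ (g + 1) - band_root (of_real x) / of_real x ^ (g + 1))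
        = norm (h (of_real x) - band_root (of_real x)) / norm (complex_of_real x ^ (g + 1))"
        by (simp add: norm_divide[symmetric] diff_divide_distrib)
      also have "\<dots> \<le> norm (band_root (of_real x)) * (decay_constant / x\<^sup>2) / norm (complex_of_real x ^ (g + 1))"
        by (intro divide_right_mono near elim) simp
      finally show ?case by (simp add: norm_divide mult.commute)
    qed
    have "((\<lambda>x::real. decay_constant / x\<^sup>2) \<longlongrightarrow> 0) at_top"
      by (intro real_tendsto_divide_at_top[OF tendsto_const] filterlim_pow_at_top filterlim_ident) simp_all
    from tendsto_mult[OF tendsto_norm[OF band_root_asymptotic] this]
    show "((\<lambda>x. norm (band_root (of_real x) / of_real x ^ (g + 1)) * (decay_constant / x\<^sup>2)) \<longlongrightarrow> 0) at_top"
      by simp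
  qed
  from tendsto_add[OF this band_root_asymptotic]
  have "((\<lambda>x. h (of_real x) / of_real x ^ (g + 1)) \<longlongrightarrow> 1) at_top" by simp
  then have lc: "a (g + 1) = 1"
    using lim1 by (intro tendsto_unique[of at_top]) auto
  have lc': "a (Suc g) = 1" using lc by simp
  have deg: "degree m = g + 1"
    by (intro antisym degree_le le_degree) (auto simp: coeff lc')
  show ?thesis
  proof (rule that[of m])
    show "lead_coeff m = 1" unfolding deg coeff using lc by simp
  qed (use deg m h in auto)
qed

end

section \<open>Uniqueness of the normalised polynomial\<close>

context band_system
begin

lemma borel_measurable_band_root [measurable]: "(\<lambda>x. band_root (of_real x)) \<in> borel_measurable borel"
  using continuous_on_band_root_real by (rule borel_measurable_continuous_onI)

lemma set_integrable_over_band_root: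
  fixes \<psi> :: "real \<Rightarrow> complex"
  assumes \<psi>: "continuous_on UNIV \<psi>"
  shows "set_integrable lborel {u..v} (\<lambda>x. \<psi> x / band_root (of_real x))"
proof -
  have [measurable]: "\<psi> \<in> borel_measurable borel"
    using \<psi> by (rule borel_measurable_continuous_onI)
  have "bounded (\<psi> ` {u..v})"
    by (intro compact_imp_bounded compact_continuous_image continuous_on_subset[OF \<psi>]) auto
  then obtain H where H: "0 < H" "\<And>x. x \<in> {u..v} \<Longrightarrow> norm (\<psi> x) \<le> H"
    by (auto simp: bounded_pos)
  obtain C where C: "0 \<le> C" "\<And>z. z \<notin> of_real ` endpoints \<Longrightarrow>
      1 / norm (band_root z) \<le> C * (\<Sum>e\<in>endpoints. 1 / sqrt (norm (z - of_real e)))"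
    using inverse_band_root_bound by blast
  let ?w = "\<lambda>x. H * (C * (\<Sum>e\<in>endpoints. 1 / sqrt \<bar>x - e\<bar>))"
  have w: "set_integrable lborel {u..v} ?w"
    unfolding mult.assoc[symmetric] by (rule set_integrable_sum_inverse_sqrt)
  have le: "norm (\<psi> x / band_root (of_real x)) \<le> ?w x" if x: "x \<in> {u..v}" for x
  proof (cases "x \<in> endpoints")
    case True
    then have "band_root (of_real x) = 0" by (simp add: band_root_eq_0_iff)
    then show ?thesis using H(1) C(1) by (simp add: sum_nonneg)
  next
    case False
    then have "complex_of_real x \<notin> of_real ` endpoints" by auto
    then have "1 / norm (band_root (of_real x)) \<le> C * (\<Sum>e\<in>endpoints. 1 / sqrt \<bar>x - e\<bar>)"
      using C(2)[of "of_real x"] by (simp flip: of_real_diff)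
    then have "norm (\<psi> x) * (1 / norm (band_root (of_real x))) \<le> ?w x"
      using H(2)[OF x] H(1) by (intro mult_mono) auto
    then show ?thesis by (simp add: norm_divide)
  qed
  show ?thesis
    unfolding set_integrable_def
  proof (rule Bochner_Integration.integrable_bound)
    show "integrable lborel (\<lambda>x. indicator {u..v} x *\<^sub>R ?w x)" using w by (simp add: set_integrable_def)
    show "AE x in lborel. norm (indicator {u..v} x *\<^sub>R (\<psi> x / band_root (of_real x))) \<le> norm (indicator {u..v} x *\<^sub>R ?w x)"
    proof (intro AE_I2)
      fix x
      have "norm (\<psi> x / band_root (of_real x)) \<le> norm (?w x)" if "x \<in> {u..v}"
        using order_trans[OF le[OF that] abs_ge_self] by simp
      then show "norm (indicator {u..v} x *\<^sub>R (\<psi> x / band_root (of_real x))) \<le> norm (indicator {u..v} x *\<^sub>R ?w x)"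
        by (auto simp: indicator_def)
    qed
  qed measurable
qed

lemma set_integral_gap:
  fixes h :: "real \<Rightarrow> complex"
  assumes "h \<in> borel_measurable borel"
  shows "(LINT x:gap p q k|lborel. h x) = (LINT x:{q k..p k}|lborel. h x)"
proof (rule set_integral_cong_set)
  have [measurable]: "h \<in> borel_measurable borel" by fact
  show "set_borel_measurable lborel {q k..p k} h" "set_borel_measurable lborel (gap p q k) h"
    unfolding set_borel_measurable_def gap_def by measurable
  have "AE x in lborel. x \<notin> {q k, p k}"
    by (intro AE_not_in finite_imp_null_set_lborel) simp
  then show "AE x in lborel. x \<in> {q k..p k} \<longleftrightarrow> x \<in> gap p q k"
    by eventually_elim (auto simp: gap_def)
qed

lemma bands_disjoint: "disjoint_family_on (\<lambda>k. {p k..q (k + 1)}) {0..g}"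
  unfolding disjoint_family_on_def
proof (intro ballI impI)
  fix i j assume "i \<in> {0..g}" "j \<in> {0..g}" "i \<noteq> j"
  then have "q (i + 1) < p j \<or> q (j + 1) < p i"
    using q_less_p[of "i + 1" j] q_less_p[of "j + 1" i] by (cases "i < j") auto
  then show "{p i..q (i + 1)} \<inter> {p j..q (j + 1)} = {}" by auto
qed

lemma set_integral_bands:
  fixes h :: "real \<Rightarrow> complex"
  assumes "\<And>u v. set_integrable lborel {u..v} h"
  shows "(LINT x:bands g p q|lborel. h x) = (\<Sum>k=0..g. LINT x:{p k..q (k + 1)}|lborel. h x)"
    and "set_integrable lborel (bands g p q) h"
proof -
  show "(LINT x:bands g p q|lborel. h x) = (\<Sum>k=0..g. LINT x:{p k..q (k + 1)}|lborel. h x)"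
    unfolding bands_def using assms bands_disjoint by (intro set_integral_finite_Union) auto
  show "set_integrable lborel (bands g p q) h"
    unfolding bands_def using assms by (intro set_integrable_UN) auto
qed

text \<open>Vanishing of the integral over a gap forces a zero of \<open>D\<close> in that gap, because the square
root is real and has no zero there. As the degree is at most \<open>g\<close>, these are all its zeros, so by
\<open>band_amplitude_sign\<close> the integrand over the bands has constant sign up to a constant
factor. Vanishing of that integral then forces the factor to be zero.\<close>

lemma abelian_differential_unique:
  fixes D :: "complex poly"
  assumes deg: "degree D \<le> g" and real: "\<And>x. x \<notin> endpoints \<Longrightarrow> poly D (of_real x) \<in> \<real>"
    and gaps: "\<And>k. k \<in> {1..g} \<Longrightarrow> (LINT x:gap p q k|lborel. poly D (of_real x) / band_root (of_real x)) = 0"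
    and bands: "(LINT x:bands g p q|lborel. poly D (of_real x) / band_root (of_real x)) = 0"
  shows "D = 0"
proof -
  let ?h = "\<lambda>x. poly D (of_real x) / band_root (of_real x)"
  have cont: "continuous_on UNIV (\<lambda>x::real. poly D (of_real x))" by (intro continuous_intros)
  have int: "set_integrable lborel {u..v} ?h" for u v
    by (rule set_integrable_over_band_root[OF cont])
  have "\<exists>x. q k < x \<and> x < p k \<and> poly D (of_real x) = 0" if k: "k \<in> {1..g}" for k
  proof -
    have ge: "x \<notin> endpoints" if "q k < x" "x < p k" for x
    proof
      assume "x \<in> endpoints"
      then consider j where "x = p j" "j \<le> g" | j where "x = q j" "1 \<le> j" "j \<le> g + 1"
        by (auto simp: endpoints_def)
      then show False
      proof cases
        case (1 j)
        then show False using that k p_mono[of k j] p_less_q[of j k] by (cases "k \<le> j") auto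
      next
        case (2 j)
        then show False using that k q_mono[of j k] p_less_q[of k j] by (cases "j \<le> k") auto
      qed
    qed
    then have nz: "band_root (of_real x) \<noteq> 0" if "q k < x" "x < p k" for x
      using that by (auto simp: band_root_eq_0_iff)
    have hr: "?h x \<in> \<real>" if "q k < x" "x < p k" for x
      using that k by (intro Reals_divide real ge band_root_off_bands_real) auto
    have i: "set_integrable lborel {q k<..<p k} ?h"
      by (rule set_integrable_subset[OF int[of "q k" "p k"]]) auto
    have i': "integrable lborel (\<lambda>x. indicator {q k<..<p k} x *\<^sub>R ?h x)"
      using i by (simp add: set_integrable_def)
    have "\<exists>x. q k < x \<and> x < p k \<and> Re (?h x) = 0"
    proof (rule zero_of_set_integral_eq_zero[OF gap_order[OF k]])
      show "set_integrable lborel {q k<..<p k} (\<lambda>x. Re (?h x))"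
        using integrable_Re[OF i'] by (simp add: set_integrable_def)
      show "continuous_on {q k<..<p k} (\<lambda>x. Re (?h x))"
        using nz by (intro continuous_intros continuous_on_subset[OF continuous_on_band_root_real]) auto
      have "(LINT x:{q k<..<p k}|lborel. Re (?h x)) = Re (LINT x:{q k<..<p k}|lborel. ?h x)"
        unfolding set_lebesgue_integral_def by (subst integral_Re[OF i', symmetric]) simp
      then show "(LINT x:{q k<..<p k}|lborel. Re (?h x)) = 0"
        using gaps[OF k] by (simp add: gap_def)
    qed
    then obtain x where x: "q k < x" "x < p k" "Re (?h x) = 0" by blast
    then have "?h x = 0" using hr[of x] by (simp add: complex_is_Real_iff complex_eq_iff)
    then show ?thesis using x nz by auto
  qed
  then obtain \<xi> where \<xi>: "\<And>k. k \<in> {1..g} \<Longrightarrow> q k < \<xi> k \<and> \<xi> k < p k \<and> poly D (of_real (\<xi> k)) = 0"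
    by metis
  have inj: "inj_on (\<lambda>k. complex_of_real (\<xi> k)) {1..g}"
  proof (rule inj_onI)
    have lt: "\<xi> i < \<xi> j" if "i \<in> {1..g}" "j \<in> {1..g}" "i < j" for i j
      using \<xi>[OF that(1)] \<xi>[OF that(2)] p_less_q[of i j] that by auto
    fix i j assume "i \<in> {1..g}" "j \<in> {1..g}" "complex_of_real (\<xi> i) = complex_of_real (\<xi> j)"
    then show "i = j" using lt[of i j] lt[of j i] by (cases i j rule: linorder_cases) auto
  qed
  obtain k where k: "\<And>z. poly D z = k * (\<Prod>a\<in>(\<lambda>k. complex_of_real (\<xi> k)) ` {1..g}. z - a)"
  proof (rule poly_eq_prod_of_roots[of "(\<lambda>k. complex_of_real (\<xi> k)) ` {1..g}" D])
    show "degree D \<le> card ((\<lambda>k. complex_of_real (\<xi> k)) ` {1..g})"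
      unfolding card_image[OF inj] using deg by simp
  qed (use \<xi> in auto)
  have D: "poly D (of_real x) = k * of_real (\<Prod>j=1..g. x - \<xi> j)" for x
    unfolding k prod.reindex[OF inj] by simp
  have "k \<in> \<real>"
  proof -
    define x where "x = q (g + 1) + 1"
    have x: "x \<notin> endpoints" using endpoints_bounds[of x] by (auto simp: x_def)
    have "(\<Prod>j=1..g. x - \<xi> j) \<noteq> 0"
    proof (subst prod_zero_iff)
      show "\<not> (\<exists>j\<in>{1..g}. x - \<xi> j = 0)"
      proof
        assume "\<exists>j\<in>{1..g}. x - \<xi> j = 0"
        then obtain j where "j \<in> {1..g}" "x = \<xi> j" by auto
        then show False using \<xi>[of j] p_less_q[of j "g + 1"] by (auto simp: x_def)
      qed
    qed simp
    then have "k = poly D (of_real x) / of_real (\<Prod>j=1..g. x - \<xi> j)"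
      by (simp add: D del: of_real_prod)
    then show ?thesis using real[OF x] by (metis Reals_divide Reals_of_real)
  qed
  then obtain \<kappa> where \<kappa>: "k = of_real \<kappa>" by (auto elim: Reals_cases)
  define \<psi> where "\<psi> x = (\<Prod>j=1..g. x - \<xi> j) / band_amplitude x" for x
  have hb: "?h x = - (\<i> * of_real (\<kappa> * \<psi> x))" if xb: "x \<in> bands g p q" for x
  proof -
    obtain j where j: "j \<le> g" "p j \<le> x" "x \<le> q (j + 1)" using xb by (auto simp: bands_def)
    show ?thesis
      unfolding D \<kappa> band_root_on_band[OF j] \<psi>_def
      by (simp add: divide_simps del: of_real_prod)
  qed
  have nonneg: "0 \<le> \<psi> x" and pos: "x \<notin> endpoints \<Longrightarrow> 0 < \<psi> x" if xb: "x \<in> bands g p q" for x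
  proof -
    obtain j where j: "j \<le> g" "p j \<le> x" "x \<le> q (j + 1)" using xb by (auto simp: bands_def)
    show p: "0 < \<psi> x" if "x \<notin> endpoints"
      unfolding \<psi>_def
    proof (rule band_amplitude_sign[OF j(1)])
      show "p j < x" "x < q (j + 1)"
        using j that by (auto simp: endpoints_def order.order_iff_strict)
    qed (use \<xi> in auto)
    show "0 \<le> \<psi> x"
    proof (cases "x \<in> endpoints")
      case True
      then have "band_root (of_real x) = 0" by (simp add: band_root_eq_0_iff)
      then have "band_amplitude x = 0" using band_root_on_band[OF j] by simp
      then show ?thesis by (simp add: \<psi>_def)
    qed (use p in auto)
  qed
  have "\<kappa> = 0"
  proof (rule ccontr)
    assume \<kappa>0: "\<kappa> \<noteq> 0"
    have int_b: "set_integrable lborel (bands g p q) ?h"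
      by (rule set_integral_bands(2)[OF int])
    have e: "indicator (bands g p q) x *\<^sub>R \<psi> x = Im (indicator (bands g p q) x *\<^sub>R ?h x) * (- 1 / \<kappa>)" for x
      using hb[of x] \<kappa>0 by (cases "x \<in> bands g p q") auto
    have i': "integrable lborel (\<lambda>x. indicator (bands g p q) x *\<^sub>R ?h x)"
      using int_b by (simp add: set_integrable_def)
    have "0 < (LINT x:bands g p q|lborel. \<psi> x)"
    proof (rule set_integral_pos[where u="p 0" and v="q 1"])
      show "set_integrable lborel (bands g p q) \<psi>"
        unfolding set_integrable_def e by (intro integrable_mult_left integrable_Im i')
      show "p 0 < q 1" using band_order[of 0] by simp
      show "x \<in> bands g p q \<and> 0 < \<psi> x" if x: "p 0 < x" "x < q 1" for x
      proof -
        have "x \<in> bands g p q" unfolding bands_def using x by (intro UN_I[of 0]) auto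
        moreover have "x \<notin> endpoints"
        proof
          assume "x \<in> endpoints"
          then consider j where "x = p j" "j \<le> g" | j where "x = q j" "1 \<le> j" "j \<le> g + 1"
            by (auto simp: endpoints_def)
          then show False
          proof cases
            case (1 j)
            then show False using x q_less_p[of 1 j] by (cases "j = 0") auto
          next
            case (2 j)
            then show False using x q_mono[of 1 j] by auto
          qed
        qed
        ultimately show ?thesis using pos by blast
      qed
    qed (use nonneg in auto)
    moreover have "(LINT x:bands g p q|lborel. \<psi> x) = Im (LINT x:bands g p q|lborel. ?h x) * (- 1 / \<kappa>)"
      unfolding set_lebesgue_integral_def e
      by (subst integral_Im[OF i', symmetric]) (rule integral_mult_left_zero)
    ultimately show False using bands by simp
  qed
  then have "poly D z = 0" for z using k \<kappa> by simp
  then show "D = 0" by (simp add: poly_eq_poly_eq_iff[symmetric] fun_eq_iff)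
qed

end

section \<open>Boundary values of the Cauchy transform\<close>

lemma poly_bounded_on_box:
  fixes m :: "complex poly"
  obtains H where "0 < H" "\<And>z. u \<le> Re z \<Longrightarrow> Re z \<le> v \<Longrightarrow> 0 \<le> Im z \<Longrightarrow> Im z \<le> 1 \<Longrightarrow> norm (poly m z) \<le> H"
proof -
  have "bounded (poly m ` cbox (Complex u 0) (Complex v 1))"
    by (intro compact_imp_bounded compact_continuous_image continuous_intros compact_cbox)
  then obtain H where "0 < H" "\<And>z. z \<in> cbox (Complex u 0) (Complex v 1) \<Longrightarrow> norm (poly m z) \<le> H"
    by (auto simp: bounded_pos)
  then show ?thesis using that by (auto simp: in_cbox_complex_iff)
qed

context band_density
begin

definition density_poly :: "complex poly" where
  "density_poly = (SOME m. degree m = g + 1 \<and> lead_coeff m = 1 \<and>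
     (\<forall>z. 0 < Im z \<longrightarrow> poly m z = band_root z * (1 - F' z)) \<and>
     (\<forall>x. x \<notin> endpoints \<longrightarrow> poly m (of_real x) \<in> \<real>))"

lemma density_poly:
  shows degree_density_poly: "degree density_poly = g + 1"
    and lead_coeff_density_poly: "lead_coeff density_poly = 1"
    and poly_density_poly: "\<And>z. 0 < Im z \<Longrightarrow> poly density_poly z = band_root z * (1 - F' z)"
    and real_density_poly: "\<And>x. x \<notin> endpoints \<Longrightarrow> poly density_poly (of_real x) \<in> \<real>"
proof -
  have "\<exists>m. degree m = g + 1 \<and> lead_coeff m = 1 \<and>
     (\<forall>z. 0 < Im z \<longrightarrow> poly m z = band_root z * (1 - F' z)) \<and>
     (\<forall>x. x \<notin> endpoints \<longrightarrow> poly m (of_real x) \<in> \<real>)"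
    by (rule entire_product_polynomial) blast
  from someI_ex[OF this, folded density_poly_def]
  show "degree density_poly = g + 1" "lead_coeff density_poly = 1"
    "\<And>z. 0 < Im z \<Longrightarrow> poly density_poly z = band_root z * (1 - F' z)"
    "\<And>x. x \<notin> endpoints \<Longrightarrow> poly density_poly (of_real x) \<in> \<real>" by blast+
qed

text \<open>The explicit form of \<open>F'\<close>, which has a meaning on the real line as well.\<close>

definition slope :: "complex \<Rightarrow> complex" where
  "slope z = 1 - poly density_poly z / band_root z"

lemma derivative_eq_slope:
  assumes "0 < Im z"
  shows "F' z = slope z"
proof -
  have "band_root z \<noteq> 0" using assms by (auto simp: band_root_eq_0_iff)
  then show ?thesis by (simp add: slope_def poly_density_poly[OF assms])
qed

text \<open>The explicit form of \<open>F'\<close> shows that it has only inverse square root singularities, which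
are integrable along the line and compatible with \<open>hoelder_boundary_limit\<close>.\<close>

lemma slope_bound:
  obtains W where "0 \<le> W" "\<And>z. u \<le> Re z \<Longrightarrow> Re z \<le> v \<Longrightarrow> 0 < Im z \<Longrightarrow> Im z \<le> 1 \<Longrightarrow>
     norm (F' z) \<le> 1 + W * (\<Sum>e\<in>endpoints. 1 / sqrt (norm (z - of_real e)))"
proof -
  obtain H where H: "0 < H" "\<And>z. u \<le> Re z \<Longrightarrow> Re z \<le> v \<Longrightarrow> 0 \<le> Im z \<Longrightarrow> Im z \<le> 1 \<Longrightarrow> norm (poly density_poly z) \<le> H"
    by (rule poly_bounded_on_box[of u v density_poly]) blast
  obtain C where C: "0 \<le> C" "\<And>z. z \<notin> of_real ` endpoints \<Longrightarrow>
      1 / norm (band_root z) \<le> C * (\<Sum>e\<in>endpoints. 1 / sqrt (norm (z - of_real e)))"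
    using inverse_band_root_bound by blast
  show ?thesis
  proof (rule that[of "H * C"])
    show "0 \<le> H * C" using H C by simp
    fix z assume z: "u \<le> Re z" "Re z \<le> v" "0 < Im z" "Im z \<le> 1"
    have "z \<notin> of_real ` endpoints" using z by auto
    then have "norm (poly density_poly z) * (1 / norm (band_root z)) \<le> H * (C * (\<Sum>e\<in>endpoints. 1 / sqrt (norm (z - of_real e))))"
      using z H by (intro mult_mono C H) auto
    moreover have "norm (F' z) \<le> 1 + norm (poly density_poly z) * (1 / norm (band_root z))"
      unfolding derivative_eq_slope[OF z(3)] slope_def
      using norm_triangle_ineq4[of 1 "poly density_poly z / band_root z"] by (simp add: norm_divide)
    ultimately show "norm (F' z) \<le> 1 + H * C * (\<Sum>e\<in>endpoints. 1 / sqrt (norm (z - of_real e)))"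
      by (simp add: mult.assoc)
  qed
qed

lemma cauchy_transform_boundary_limit:
  "(F \<longlongrightarrow> boundary_extension F (of_real x)) (at (of_real x) within upper_half_plane)"
proof (rule tendsto_boundary_extension)
  obtain W where W: "0 \<le> W" "\<And>z. - (\<bar>x\<bar> + 1) \<le> Re z \<Longrightarrow> Re z \<le> \<bar>x\<bar> + 1 \<Longrightarrow> 0 < Im z \<Longrightarrow> Im z \<le> 1 \<Longrightarrow>
     norm (F' z) \<le> 1 + W * (\<Sum>e\<in>endpoints. 1 / sqrt (norm (z - of_real e)))"
    by (rule slope_bound[of "- (\<bar>x\<bar> + 1)" "\<bar>x\<bar> + 1"]) blast
  show "\<exists>l. (F \<longlongrightarrow> l) (at (of_real x) within upper_half_plane)"
  proof (rule hoelder_boundary_limit[where N="\<bar>x\<bar> + 1" and C="1 + W * card endpoints"])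
    show "(F has_field_derivative F' z) (at z)" if "0 < Im z" for z
      using that by (intro cauchy_transform_has_derivative) auto
    fix z :: complex assume z: "0 < Im z" "Im z < 1" "\<bar>Re z\<bar> < \<bar>x\<bar> + 1"
    have "1 / sqrt (norm (z - of_real e)) \<le> 1 / sqrt (Im z)" for e
    proof -
      have "Im z \<le> norm (z - of_real e)" using z abs_Im_le_cmod[of "z - of_real e"] by simp
      then show ?thesis using z(1) by (intro divide_left_mono mult_pos_pos real_sqrt_gt_zero real_sqrt_le_mono) linarith+
    qed
    then have "(\<Sum>e\<in>endpoints. 1 / sqrt (norm (z - of_real e))) \<le> (\<Sum>e\<in>endpoints. 1 / sqrt (Im z))"
      by (intro sum_mono)
    then have "W * (\<Sum>e\<in>endpoints. 1 / sqrt (norm (z - of_real e))) \<le> W * (card endpoints * (1 / sqrt (Im z)))"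
      using W(1) by (intro mult_left_mono) auto
    moreover have "1 \<le> 1 / sqrt (Im z)" using z by simp
    moreover have "norm (F' z) \<le> 1 + W * (\<Sum>e\<in>endpoints. 1 / sqrt (norm (z - of_real e)))"
      using z by (intro W(2)) auto
    ultimately show "norm (F' z) \<le> (1 + W * card endpoints) / sqrt (Im z)"
      by (simp add: add_divide_distrib)
  qed simp
qed

lemma Im_boundary_cauchy_transform: "Im (boundary_extension F (of_real x)) = - pi * J x"
  using tendsto_unique[OF at_within_upper_half_plane_neq_bot tendsto_Im[OF cauchy_transform_boundary_limit]
      Im_cauchy_transform_boundary] .

text \<open>By \<open>has_principal_value_iff\<close> this provides principal values at every real point, while the
hypotheses provide them on the bands.\<close>

lemma Re_boundary_cauchy_transform:
  "((\<lambda>y. Re (F (Complex x y))) \<longlongrightarrow> Re (boundary_extension F (of_real x))) (at_right 0)"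
  by (rule tendsto_at_right_vertical_line[OF tendsto_Re[OF cauchy_transform_boundary_limit]])

lemma Re_boundary_cauchy_transform_band:
  "x \<in> bands g p q \<Longrightarrow> Re (boundary_extension F (of_real x)) = x - \<alpha>"
  by (rule tendsto_unique[OF trivial_limit_at_right_real Re_boundary_cauchy_transform on_bands])

lemma slope_boundary:
  assumes "x \<notin> endpoints"
  shows "(F' \<longlongrightarrow> slope (of_real x)) (at (of_real x) within upper_half_plane)"
proof -
  have "band_root (of_real x) \<noteq> 0" using assms by (auto simp: band_root_eq_0_iff)
  then have "(slope \<longlongrightarrow> slope (of_real x)) (at (of_real x) within upper_half_plane)"
    unfolding slope_def by (intro tendsto_intros band_root_boundary) auto
  moreover have "eventually (\<lambda>z. slope z = F' z) (at (of_real x) within upper_half_plane)"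
    unfolding eventually_at by (intro exI[of _ 1]) (auto simp: derivative_eq_slope)
  ultimately show ?thesis by (rule Lim_transform_eventually)
qed

lemma borel_measurable_slope [measurable]: "(\<lambda>x. slope (of_real x)) \<in> borel_measurable borel"
proof -
  have [measurable]: "(\<lambda>x::real. poly density_poly (of_real x)) \<in> borel_measurable borel"
    by (intro borel_measurable_continuous_onI continuous_intros)
  show ?thesis unfolding slope_def by measurable
qed

lemma slope_integral:
  assumes uv: "u \<le> v"
  shows set_integrable_slope: "set_integrable lborel {u..v} (\<lambda>x. slope (of_real x))"
    and set_integral_slope: "(LINT x:{u..v}|lborel. slope (of_real x))
      = boundary_extension F (of_real v) - boundary_extension F (of_real u)"
proof -
  define \<eta> :: "nat \<Rightarrow> real" where "\<eta> n = inverse (of_nat (Suc n))" for n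
  have \<eta>: "\<And>n. 0 < \<eta> n" "\<And>n. \<eta> n \<le> 1" by (simp_all add: \<eta>_def inverse_le_1_iff)
  have lim: "(\<lambda>n. f (Complex x (\<eta> n))) \<longlonglongrightarrow> l"
    if "(f \<longlongrightarrow> l) (at (of_real x) within upper_half_plane)" for f and l :: complex and x
    unfolding \<eta>_def by (rule LIMSEQ_vertical_line[OF that])
  obtain W where W: "0 \<le> W" "\<And>z. u \<le> Re z \<Longrightarrow> Re z \<le> v \<Longrightarrow> 0 < Im z \<Longrightarrow> Im z \<le> 1 \<Longrightarrow>
     norm (F' z) \<le> 1 + W * (\<Sum>e\<in>endpoints. 1 / sqrt (norm (z - of_real e)))"
    by (rule slope_bound[of u v]) blast
  define w where "w x = 1 + W * (\<Sum>e\<in>endpoints. 1 / sqrt \<bar>x - e\<bar>)" for x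
  have w: "set_integrable lborel {u..v} w"
    unfolding w_def
  proof (rule set_integral_add)
    show "set_integrable lborel {u..v} (\<lambda>x. 1 :: real)"
      by (intro borel_integrable_atLeastAtMost' continuous_intros)
    show "set_integrable lborel {u..v} (\<lambda>x. W * (\<Sum>e\<in>endpoints. 1 / sqrt \<bar>x - e\<bar>))"
      by (rule set_integrable_sum_inverse_sqrt)
  qed
  have deriv: "((\<lambda>x. F (Complex x (\<eta> n))) has_vector_derivative F' (Complex x (\<eta> n))) (at x)" for n x
  proof -
    have "((\<lambda>x. F (Complex x (\<eta> n))) has_vector_derivative 1 * F' (Complex x (\<eta> n))) (at x)"
      unfolding Complex_horizontal
      by (rule has_vector_derivative_along_line, rule cauchy_transform_has_derivative) (use \<eta>(1)[of n] in auto)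
    then show ?thesis by simp
  qed
  have cont: "continuous_on UNIV (\<lambda>x. F' (Complex x (\<eta> n)))" for n
  proof -
    have "continuous_on UNIV (\<lambda>x. slope (Complex x (\<eta> n)))"
    proof -
      have nz: "band_root (Complex x (\<eta> n)) \<noteq> 0" for x
        unfolding band_root_eq_0_iff using \<eta>(1)[of n] by (auto simp: complex_eq_iff)
      have c: "continuous_on UNIV (\<lambda>x. Complex x (\<eta> n))"
        unfolding Complex_horizontal by (intro continuous_intros)
      have "continuous_on UNIV (\<lambda>x. band_root (Complex x (\<eta> n)))"
        by (rule continuous_on_compose2[OF continuous_on_band_root c]) (use \<eta>(1)[of n] in auto)
      then show ?thesis unfolding slope_def using nz by (intro continuous_intros c) auto
    qed
    then show ?thesis by (rule continuous_on_eq) (use \<eta>(1) derivative_eq_slope in auto)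
  qed
  have lim': "(\<lambda>n. F' (Complex x (\<eta> n))) \<longlonglongrightarrow> slope (of_real x)" if "x \<in> {u..v} - endpoints" for x
    by (rule lim[OF slope_boundary]) (use that in auto)
  have bound: "norm (F' (Complex x (\<eta> n))) \<le> w x" if x: "x \<in> {u..v} - endpoints" for n x
  proof -
    have "(\<Sum>e\<in>endpoints. 1 / sqrt (norm (Complex x (\<eta> n) - of_real e))) \<le> (\<Sum>e\<in>endpoints. 1 / sqrt \<bar>x - e\<bar>)"
    proof (rule sum_mono)
      fix e assume "e \<in> endpoints"
      then have "0 < \<bar>x - e\<bar>" using x by auto
      moreover have "\<bar>x - e\<bar> \<le> norm (Complex x (\<eta> n) - of_real e)"
        using abs_Re_le_cmod[of "Complex x (\<eta> n) - of_real e"] by simp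
      ultimately show "1 / sqrt (norm (Complex x (\<eta> n) - of_real e)) \<le> 1 / sqrt \<bar>x - e\<bar>"
        by (intro divide_left_mono mult_pos_pos real_sqrt_gt_zero real_sqrt_le_mono) linarith+
    qed
    then have "W * (\<Sum>e\<in>endpoints. 1 / sqrt (norm (Complex x (\<eta> n) - of_real e))) \<le> W * (\<Sum>e\<in>endpoints. 1 / sqrt \<bar>x - e\<bar>)"
      using W(1) by (rule mult_left_mono)
    then show ?thesis
      using W(2)[of "Complex x (\<eta> n)"] \<eta>(1,2)[of n] x by (simp add: w_def)
  qed
  note FTC = FTC_dominated_limit[OF uv deriv cont finite_endpoints w borel_measurable_slope lim' bound
      lim[OF cauchy_transform_boundary_limit] lim[OF cauchy_transform_boundary_limit]]
  show "set_integrable lborel {u..v} (\<lambda>x. slope (of_real x))" by (rule FTC(1))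
  show "(LINT x:{u..v}|lborel. slope (of_real x))
      = boundary_extension F (of_real v) - boundary_extension F (of_real u)" by (rule FTC(2))
qed

lemma set_integral_density_poly:
  assumes uv: "u \<le> v"
  shows "(LINT x:{u..v}|lborel. poly density_poly (of_real x) / band_root (of_real x))
      = of_real (v - u) - (boundary_extension F (of_real v) - boundary_extension F (of_real u))"
proof -
  have 1: "set_integrable lborel {u..v} (\<lambda>x. 1 :: complex)"
    by (intro borel_integrable_atLeastAtMost' continuous_intros)
  have "(LINT x:{u..v}|lborel. poly density_poly (of_real x) / band_root (of_real x))
      = (LINT x:{u..v}|lborel. 1 - slope (of_real x))"
    by (simp add: slope_def)
  also have "\<dots> = (LINT x:{u..v}|lborel. 1) - (LINT x:{u..v}|lborel. slope (of_real x))"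
    by (rule set_integral_diff(2)[OF 1 set_integrable_slope[OF uv]])
  also have "(LINT x:{u..v}|lborel. 1 :: complex) = of_real (v - u)"
    using uv by (simp add: set_lebesgue_integral_def scaleR_conv_of_real)
  finally show ?thesis by (simp only: set_integral_slope[OF uv])
qed

lemma density_at_gap_ends:
  assumes k: "k \<in> {1..g}"
  shows "J (q k) = c k" "J (p k) = c k"
proof -
  have "closed {x. J x = c k}"
    using continuous_density by (intro closed_Collect_eq continuous_intros)
  moreover have "{q k<..<p k} \<subseteq> {x. J x = c k}"
    using on_gaps[OF k] by (auto simp: gap_def)
  ultimately have "closure {q k<..<p k} \<subseteq> {x. J x = c k}"
    by (intro closure_minimal)
  then show "J (q k) = c k" "J (p k) = c k"
    using gap_order[OF k] by (auto simp: subset_iff)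
qed

lemma density_at_outer_ends: "J (p 0) = 0" "J (q (g + 1)) = 0"
proof -
  have c: "closed {x. J x = 0}"
    using continuous_density by (intro closed_Collect_eq continuous_intros)
  have "closure {..<p 0} \<subseteq> {x. J x = 0}" "closure {q (g + 1)<..} \<subseteq> {x. J x = 0}"
    using density_outside by (intro closure_minimal c; force)+
  then show "J (p 0) = 0" "J (q (g + 1)) = 0" by auto
qed

lemma band_ends: "k \<le> g \<Longrightarrow> p k \<in> bands g p q" "k \<le> g \<Longrightarrow> q (k + 1) \<in> bands g p q"
  unfolding bands_def using band_order[of k] by (intro UN_I[of k]; simp)+

lemma boundary_cauchy_transform_band:
  "x \<in> bands g p q \<Longrightarrow> boundary_extension F (of_real x) = of_real (x - \<alpha>) - \<i> * of_real (pi * J x)"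
  using Re_boundary_cauchy_transform_band[of x] Im_boundary_cauchy_transform[of x] by (simp add: complex_eq_iff)

text \<open>The integrand has the primitive $x - F(x)$, which takes the same value $\alpha + i\pi c_k$ at both
ends of the gap, since the ends belong to bands.\<close>

lemma density_poly_gap_integral:
  assumes k: "k \<in> {1..g}"
  shows "(LINT x:{q k..p k}|lborel. poly density_poly (of_real x) / band_root (of_real x)) = 0"
proof -
  have b: "p k \<in> bands g p q" "q k \<in> bands g p q"
    using band_ends(1)[of k] band_ends(2)[of "k - 1"] k by auto
  show ?thesis
    unfolding set_integral_density_poly[OF less_imp_le[OF gap_order[OF k]]]
      boundary_cauchy_transform_band[OF b(1)] boundary_cauchy_transform_band[OF b(2)] density_at_gap_ends[OF k]
    by simp
qed

text \<open>Only the imaginary parts of the increments of the Cauchy transform survive. They telescope, as the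
density takes the same value at both ends of each gap and vanishes at the outermost endpoints.\<close>

lemma density_poly_bands_integral:
  "(LINT x:bands g p q|lborel. poly density_poly (of_real x) / band_root (of_real x)) = 0"
proof -
  have "(LINT x:bands g p q|lborel. poly density_poly (of_real x) / band_root (of_real x))
     = (\<Sum>k=0..g. LINT x:{p k..q (k + 1)}|lborel. poly density_poly (of_real x) / band_root (of_real x))"
    by (intro set_integral_bands(1) set_integrable_over_band_root continuous_intros)
  also have "\<dots> = (\<Sum>k=0..g. \<i> * of_real (pi * (J (q (k + 1)) - J (p k))))"
  proof (rule sum.cong[OF refl])
    fix k assume "k \<in> {0..g}"
    then have k: "k \<le> g" by simp
    show "(LINT x:{p k..q (k + 1)}|lborel. poly density_poly (of_real x) / band_root (of_real x))
        = \<i> * of_real (pi * (J (q (k + 1)) - J (p k)))"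
      unfolding set_integral_density_poly[OF less_imp_le[OF band_order[OF k]]]
        boundary_cauchy_transform_band[OF band_ends(1)[OF k]] boundary_cauchy_transform_band[OF band_ends(2)[OF k]]
      by (simp add: algebra_simps)
  qed
  also have "\<dots> = \<i> * of_real (pi * (\<Sum>k=0..g. J (q (k + 1)) - J (p k)))"
    by (simp only: sum_distrib_left of_real_sum)
  also have "(\<Sum>k=0..g. J (q (k + 1)) - J (p k)) = (\<Sum>k=1..g+1. J (q k)) - (\<Sum>k=0..g. J (p k))"
    using sum.shift_bounds_cl_nat_ivl[of "\<lambda>k. J (q k)" 0 1 g] by (simp add: sum_subtractf)
  also have "(\<Sum>k=1..g+1. J (q k)) = (\<Sum>k=1..g. c k)"
    using density_at_gap_ends(1) density_at_outer_ends(2) by simp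
  also have "(\<Sum>k=0..g. J (p k)) = (\<Sum>k=1..g. c k)"
    using density_at_gap_ends(2) density_at_outer_ends(1) by (simp add: sum.atLeast_Suc_atMost)
  finally show ?thesis by simp
qed

text \<open>Both polynomials are monic of degree \<open>g + 1\<close>, so their difference has the degree that
\<open>abelian_differential_unique\<close> allows.\<close>

lemma density_poly_eq:
  assumes deg: "degree P = g + 1" "lead_coeff P = 1" and real: "\<And>x. poly P (of_real x) \<in> \<real>"
    and gaps: "\<And>k. k \<in> {1..g} \<Longrightarrow> (LINT x:gap p q k|lborel. poly P (of_real x) / band_root (of_real x)) = 0"
    and bands: "(LINT x:bands g p q|lborel. poly P (of_real x) / band_root (of_real x)) = 0"
  shows "P = density_poly"
proof -
  have int: "set_integrable lborel {u..v} (\<lambda>x. poly r (of_real x) / band_root (of_real x))" for r u v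
    by (intro set_integrable_over_band_root continuous_intros)
  have meas: "(\<lambda>x. poly r (of_real x) / band_root (of_real x)) \<in> borel_measurable borel" for r
  proof -
    have [measurable]: "(\<lambda>x::real. poly r (of_real x)) \<in> borel_measurable borel"
      by (intro borel_measurable_continuous_onI continuous_intros)
    show ?thesis by measurable
  qed
  have "P - density_poly = 0"
  proof (rule abelian_differential_unique)
    show "degree (P - density_poly) \<le> g"
    proof (rule degree_le, intro allI impI)
      fix i assume "g < i"
      then consider "i = g + 1" | "g + 1 < i" by force
      then show "coeff (P - density_poly) i = 0"
      proof cases
        case 1
        then show ?thesis using deg degree_density_poly lead_coeff_density_poly by simp
      next
        case 2
        then show ?thesis using deg degree_density_poly by (simp add: coeff_eq_0)
      qed
    qed
    show "poly (P - density_poly) (of_real x) \<in> \<real>" if "x \<notin> endpoints" for x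
      using real real_density_poly[OF that] by simp
    show "(LINT x:gap p q k|lborel. poly (P - density_poly) (of_real x) / band_root (of_real x)) = 0"
      if k: "k \<in> {1..g}" for k
    proof -
      have "(LINT x:{q k..p k}|lborel. poly P (of_real x) / band_root (of_real x) - poly density_poly (of_real x) / band_root (of_real x)) = 0"
        using gaps[OF k] density_poly_gap_integral[OF k]
        by (subst set_integral_diff(2)[OF int int]) (simp add: set_integral_gap[OF meas])
      then show ?thesis
        by (subst set_integral_gap[OF meas]) (simp add: diff_divide_distrib)
    qed
    have "(LINT x:bands g p q|lborel. poly P (of_real x) / band_root (of_real x) - poly density_poly (of_real x) / band_root (of_real x)) = 0"
      using bands density_poly_bands_integral
      by (subst set_integral_diff(2)[OF set_integral_bands(2)[OF int] set_integral_bands(2)[OF int]]) simp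
    then show "(LINT x:bands g p q|lborel. poly (P - density_poly) (of_real x) / band_root (of_real x)) = 0"
      by (simp add: diff_divide_distrib)
  qed
  then show ?thesis by simp
qed

lemma slope_decay:
  assumes x: "2 * (\<bar>p 0\<bar> + \<bar>q (g + 1)\<bar> + 1) \<le> x"
  shows "norm (slope (of_real x)) \<le> decay_constant / x\<^sup>2"
    and "norm (boundary_extension F (of_real x)) \<le> decay_constant / x"
proof -
  have xp: "0 < x" by (rule less_le_trans[OF _ x]) (simp add: add_nonneg_pos)
  have far: "x \<le> norm (Complex x y)" for y using abs_Re_le_cmod[of "Complex x y"] by simp
  have e: "x \<notin> endpoints" using endpoints_bounds[of x] x by auto
  have "norm (F' (Complex x y)) \<le> decay_constant / x\<^sup>2" "norm (F (Complex x y)) \<le> decay_constant / x" if y: "0 < y" for y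
  proof -
    have "norm (F' (Complex x y)) \<le> decay_constant / (norm (Complex x y))\<^sup>2"
      by (rule cauchy_transform_decay(2)) (use y x far[of y] in auto)
    also have "\<dots> \<le> decay_constant / x\<^sup>2"
      using far[of y] xp decay_constant_nonneg
      by (intro divide_left_mono power_mono mult_pos_pos zero_less_power) linarith+
    finally show "norm (F' (Complex x y)) \<le> decay_constant / x\<^sup>2" .
    have "norm (F (Complex x y)) \<le> decay_constant / norm (Complex x y)"
      by (rule cauchy_transform_decay(1)) (use y x far[of y] in auto)
    also have "\<dots> \<le> decay_constant / x"
      using far[of y] xp decay_constant_nonneg by (intro divide_left_mono mult_pos_pos) linarith+
    finally show "norm (F (Complex x y)) \<le> decay_constant / x" .
  qed
  then have ev: "eventually (\<lambda>y. norm (F' (Complex x y)) \<le> decay_constant / x\<^sup>2) (at_right 0)"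
     "eventually (\<lambda>y. norm (F (Complex x y)) \<le> decay_constant / x) (at_right 0)"
    by (intro eventually_mono[OF eventually_at_right_less]; blast)+
  show "norm (slope (of_real x)) \<le> decay_constant / x\<^sup>2"
    by (rule tendsto_upperbound[OF tendsto_norm[OF tendsto_at_right_vertical_line[OF slope_boundary[OF e]]] ev(1)]) simp
  show "norm (boundary_extension F (of_real x)) \<le> decay_constant / x"
    by (rule tendsto_upperbound[OF tendsto_norm[OF tendsto_at_right_vertical_line[OF cauchy_transform_boundary_limit]] ev(2)]) simp
qed

text \<open>Since the Cauchy transform vanishes at infinity, its boundary value is minus the integral of its
derivative over the ray to the right.\<close>

lemma slope_improper_integral:
  shows set_integrable_slope_ray: "set_integrable lborel {x<..} (\<lambda>t. slope (of_real t))"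
    and set_integral_slope_ray: "(LINT t:{x<..}|lborel. slope (of_real t)) = - boundary_extension F (of_real x)"
proof -
  define K where "K = \<bar>x\<bar> + 2 * (\<bar>p 0\<bar> + \<bar>q (g + 1)\<bar> + 1)"
  have K: "x \<le> K" "1 \<le> K" "2 * (\<bar>p 0\<bar> + \<bar>q (g + 1)\<bar> + 1) \<le> K" by (auto simp: K_def)
  have tail: "integrable lborel (\<lambda>t. indicator {K..} t *\<^sub>R slope (of_real t))"
  proof (rule integrable_of_poisson_bound[where C="2 * decay_constant"])
    show "norm (indicator {K..} t *\<^sub>R slope (of_real t)) \<le> 2 * decay_constant / (1 + t\<^sup>2)" for t
    proof (cases "K \<le> t")
      case True
      have t: "1 \<le> t" using True K by simp
      have t2: "1 \<le> t\<^sup>2" using t by (simp add: one_le_power)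
      have "norm (slope (of_real t)) \<le> decay_constant / t\<^sup>2"
        by (rule slope_decay(1)) (use True K in linarith)
      also have "\<dots> = 2 * decay_constant / (2 * t\<^sup>2)" by simp
      also have "\<dots> \<le> 2 * decay_constant / (1 + t\<^sup>2)"
        using decay_constant_nonneg t2 by (intro divide_left_mono mult_pos_pos) linarith+
      finally show ?thesis using True by simp
    next
      case False
      have "0 \<le> 2 * decay_constant / (1 + t\<^sup>2)"
        using decay_constant_nonneg by (intro divide_nonneg_nonneg) auto
      then show ?thesis using False by simp
    qed
  qed measurable
  have "set_integrable lborel ({x..K} \<union> {K..}) (\<lambda>t. slope (of_real t))"
    by (rule set_integrable_Un[OF set_integrable_slope[OF K(1)]]) (use tail in \<open>auto simp: set_integrable_def\<close>)
  then show int: "set_integrable lborel {x<..} (\<lambda>t. slope (of_real t))"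
    by (rule set_integrable_subset) auto
  let ?s = "\<lambda>A t. indicat_real A t *\<^sub>R slope (complex_of_real t)"
  have "(\<lambda>n. integral\<^sup>L lborel (?s {x<..x + real n})) \<longlonglongrightarrow> integral\<^sup>L lborel (?s {x<..})"
  proof (rule integral_dominated_convergence[where w="\<lambda>t. norm (?s {x<..} t)"])
    show "integrable lborel (\<lambda>t. norm (?s {x<..} t))"
      using int by (intro integrable_norm) (simp add: set_integrable_def)
    show "AE t in lborel. (\<lambda>n. ?s {x<..x + real n} t) \<longlonglongrightarrow> ?s {x<..} t"
    proof (intro AE_I2 tendsto_eventually)
      fix t
      have "eventually (\<lambda>n. t - x \<le> real n) sequentially"
        using filterlim_real_sequentially by (simp add: filterlim_at_top)
      then show "eventually (\<lambda>n. ?s {x<..x + real n} t = ?s {x<..} t) sequentially"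
        by eventually_elim (auto simp: indicator_def)
    qed
  qed (auto simp: indicator_def)
  moreover have eq: "integral\<^sup>L lborel (?s {x<..x + real n}) = boundary_extension F (of_real (x + real n)) - boundary_extension F (of_real x)" for n
  proof -
    have "integral\<^sup>L lborel (?s {x<..x + real n}) = (LINT t:{x..x + real n}|lborel. slope (of_real t))"
      unfolding set_lebesgue_integral_def
    proof (rule integral_cong_AE)
      have "AE t in lborel. t \<notin> {x}" by (intro AE_not_in finite_imp_null_set_lborel) simp
      then show "AE t in lborel. ?s {x<..x + real n} t = ?s {x..x + real n} t"
        by eventually_elim (auto simp: indicator_def)
    qed measurable
    then show ?thesis by (simp only: set_integral_slope[of x "x + real n"] le_add_same_cancel1 of_nat_0_le_iff)
  qed
  have "(\<lambda>n. boundary_extension F (of_real (x + real n))) \<longlonglongrightarrow> 0"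
  proof (rule Lim_null_comparison)
    have f: "filterlim (\<lambda>n. x + real n) at_top sequentially"
      by (intro filterlim_tendsto_add_at_top[OF tendsto_const] filterlim_real_sequentially)
    then have "eventually (\<lambda>n. K \<le> x + real n) sequentially" by (simp add: filterlim_at_top)
    then show "eventually (\<lambda>n. norm (boundary_extension F (of_real (x + real n))) \<le> decay_constant / (x + real n)) sequentially"
      by eventually_elim (rule slope_decay(2), use K in linarith)
    show "(\<lambda>n. decay_constant / (x + real n)) \<longlonglongrightarrow> 0"
      by (rule real_tendsto_divide_at_top[OF tendsto_const f])
  qed
  from tendsto_diff[OF this tendsto_const[of "boundary_extension F (of_real x)"]]
  have "(\<lambda>n. integral\<^sup>L lborel (?s {x<..x + real n})) \<longlonglongrightarrow> 0 - boundary_extension F (of_real x)"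
    unfolding eq .
  ultimately have "integral\<^sup>L lborel (?s {x<..}) = 0 - boundary_extension F (of_real x)"
    by (rule LIMSEQ_unique)
  then show "(LINT t:{x<..}|lborel. slope (of_real t)) = - boundary_extension F (of_real x)"
    by (simp add: set_lebesgue_integral_def)
qed

end

section \<open>Improper contour integrals and the representation of the density\<close>

lemma Im_nonzero_same_sign:
  fixes \<gamma> :: "real \<Rightarrow> complex"
  assumes cont: "continuous_on {0..T} \<gamma>" and nz: "\<And>t. 0 \<le> t \<Longrightarrow> Im (\<gamma> t) \<noteq> 0" and t: "t \<in> {0..T}"
  shows "0 < Im (\<gamma> t) * Im (\<gamma> 0)"
proof (rule ccontr)
  let ?S = "(\<lambda>t. Im (\<gamma> t)) ` {0..T}"
  assume "\<not> ?thesis"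
  then have "Im (\<gamma> t) * Im (\<gamma> 0) < 0"
    using nz[of t] nz[of 0] t by (simp add: not_less le_less)
  then have s: "Im (\<gamma> t) \<le> 0 \<and> 0 \<le> Im (\<gamma> 0) \<or> Im (\<gamma> 0) \<le> 0 \<and> 0 \<le> Im (\<gamma> t)"
    by (auto simp: mult_less_0_iff)
  have c: "connected ?S"
    by (intro connected_continuous_image continuous_intros cont) simp
  have m: "Im (\<gamma> t) \<in> ?S" "Im (\<gamma> 0) \<in> ?S" using t by auto
  have "0 \<in> ?S"
    using s connectedD_interval[OF c m] connectedD_interval[OF c m(2,1)] by blast
  then show False using nz by (force simp: image_iff)
qed

text \<open>A primitive that vanishes at infinity gives the same value along every admissible path. That the
value is unique needs one admissible path, the horizontal ray.\<close>

lemma contour_integral_to_infinity_primitive: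
  fixes G G' :: "complex \<Rightarrow> complex"
  assumes deriv: "\<And>w. Im w \<noteq> 0 \<Longrightarrow> (G has_field_derivative G' w) (at w)"
    and decay: "\<And>w. Im w \<noteq> 0 \<Longrightarrow> K \<le> norm w \<Longrightarrow> norm (G w) \<le> C / norm w"
    and z: "Im z \<noteq> 0"
  shows has_integral_to_infinity_primitive: "has_integral_to_infinity G' z (- G z)"
    and integral_to_infinity_primitive: "integral_to_infinity G' z = - G z"
proof -
  show has: "has_integral_to_infinity G' z (- G z)"
    unfolding has_integral_to_infinity_def
  proof (intro allI impI)
    fix \<gamma> assume "path_to_infinity z \<gamma>"
    then have \<gamma>: "\<gamma> 0 = z" "\<And>T. 0 < T \<Longrightarrow> \<gamma> piecewise_C1_differentiable_on {0..T}"
      "\<And>t. 0 \<le> t \<Longrightarrow> Im (\<gamma> t) \<noteq> 0" "filterlim (\<lambda>t. Re (\<gamma> t)) at_top at_top"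
      by (auto simp: path_to_infinity_def)
    define U where "U = {w. 0 < Im w * Im z}"
    have int: "(G' has_contour_integral G (\<gamma> T) - G z) (subpath 0 T \<gamma>)" if T: "0 < T" for T
    proof -
      have image: "(\<lambda>x. T * x + 0) ` {0..1} = {0..T}"
        using T by (simp add: image_affinity_atLeastAtMost)
      have "(\<gamma> \<circ> (\<lambda>x. T *\<^sub>R x + 0)) piecewise_C1_differentiable_on {0..1}"
        by (rule piecewise_C1_differentiable_affine) (simp only: image \<gamma>(2)[OF T])
      then have "valid_path (subpath 0 T \<gamma>)"
        by (simp add: valid_path_def subpath_def o_def)
      moreover have "path_image (subpath 0 T \<gamma>) \<subseteq> U"
      proof
        fix w assume "w \<in> path_image (subpath 0 T \<gamma>)"
        then obtain t where "t \<in> {0..T}" "w = \<gamma> t"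
          using T by (auto simp: path_image_subpath split: if_splits)
        moreover have "continuous_on {0..T} \<gamma>"
          using \<gamma>(2)[OF T] by (simp add: piecewise_C1_differentiable_on_def)
        ultimately show "w \<in> U"
          using Im_nonzero_same_sign[of T \<gamma> t] \<gamma>(1,3) by (simp add: U_def)
      qed
      moreover have "(G has_field_derivative G' w) (at w within U)" if "w \<in> U" for w
        by (rule has_field_derivative_at_within, rule deriv) (use that in \<open>auto simp: U_def\<close>)
      ultimately have "(G' has_contour_integral G (pathfinish (subpath 0 T \<gamma>)) - G (pathstart (subpath 0 T \<gamma>))) (subpath 0 T \<gamma>)"
        by (intro contour_integral_primitive)
      then show ?thesis by (simp add: \<gamma>(1))
    qed
    have "((\<lambda>T. G (\<gamma> T)) \<longlongrightarrow> 0) at_top"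
    proof (rule Lim_null_comparison)
      have n: "filterlim (\<lambda>T. norm (\<gamma> T)) at_top at_top"
        by (rule filterlim_at_top_mono[OF \<gamma>(4)]) (simp add: complex_Re_le_cmod)
      then have "eventually (\<lambda>T. K \<le> norm (\<gamma> T)) at_top" by (simp add: filterlim_at_top)
      then show "eventually (\<lambda>T. norm (G (\<gamma> T)) \<le> C / norm (\<gamma> T)) at_top"
        using eventually_ge_at_top[of 0] by eventually_elim (use decay \<gamma>(3) in blast)
      show "((\<lambda>T. C / norm (\<gamma> T)) \<longlongrightarrow> 0) at_top"
        by (rule real_tendsto_divide_at_top[OF tendsto_const n])
    qed
    from tendsto_diff[OF this tendsto_const[of "G z"]]
    have "((\<lambda>T. G (\<gamma> T) - G z) \<longlongrightarrow> - G z) at_top" by simp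
    moreover have "eventually (\<lambda>T. G (\<gamma> T) - G z = contour_integral (subpath 0 T \<gamma>) G') at_top"
      using eventually_gt_at_top[of 0] by eventually_elim (simp add: contour_integral_unique[OF int])
    ultimately have "((\<lambda>T. contour_integral (subpath 0 T \<gamma>) G') \<longlongrightarrow> - G z) at_top"
      by (rule Lim_transform_eventually)
    then show "(\<forall>T>0. G' contour_integrable_on subpath 0 T \<gamma>) \<and>
        ((\<lambda>T. contour_integral (subpath 0 T \<gamma>) G') \<longlongrightarrow> - G z) at_top"
      using int by (auto simp: contour_integrable_on_def)
  qed
  define \<rho> where "\<rho> t = z + of_real t" for t
  have "path_to_infinity z \<rho>"
    unfolding path_to_infinity_def
  proof (intro conjI allI impI)
    show "\<rho> piecewise_C1_differentiable_on {0..T}" for T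
      unfolding \<rho>_def
      by (intro C1_differentiable_imp_piecewise)
         (auto simp: C1_differentiable_on_def intro!: exI[of _ "\<lambda>_. 1"] derivative_eq_intros)
    show "filterlim (\<lambda>t. Re (\<rho> t)) at_top at_top"
      unfolding \<rho>_def by (simp add: filterlim_tendsto_add_at_top[OF tendsto_const filterlim_ident])
  qed (use z in \<open>auto simp: \<rho>_def\<close>)
  then have "I = - G z" if "has_integral_to_infinity G' z I" for I
    using that has unfolding has_integral_to_infinity_def
    by (meson tendsto_unique trivial_limit_at_top_linorder)
  then show "integral_to_infinity G' z = - G z"
    unfolding integral_to_infinity_def using has by (intro the_equality)
qed

theorem theorem5:
  fixes g :: nat and p q \<sigma> c :: "nat \<Rightarrow> real" and a0 :: real
    and R P f :: "complex \<Rightarrow> complex" and J :: "real \<Rightarrow> real"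
  assumes band_order: "\<And>k. k \<le> g \<Longrightarrow> p k < q (k + 1)"
    and gap_order: "\<And>k. k \<in> {1..g} \<Longrightarrow> q k < p k"
    and R: "band_sqrt g p q R"
    and P: "\<And>z. P z = (\<Prod>i=1..g+1. z - of_real (\<sigma> i))"
    and P_gaps: "\<And>k. k \<in> {1..g} \<Longrightarrow> (LINT x:gap p q k|lborel. P (of_real x) / R (of_real x)) = 0"
    and P_bands: "(LINT x:bands g p q|lborel. P (of_real x) / R (of_real x)) = 0"
    and f: "\<And>z. Im z \<noteq> 0 \<Longrightarrow> f z = - \<i> / of_real pi * integral_to_infinity (\<lambda>w. 1 - P w / R w) z"
    and J_cont: "continuous_on UNIV J"
    and J_diff: "\<And>x. x \<notin> frontier (bands g p q) \<Longrightarrow> J differentiable (at x)"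
    and J_bands: "\<And>x. x \<in> bands g p q \<Longrightarrow>
          (\<exists>I. has_principal_value (\<lambda>\<mu>. J \<mu> / (x - \<mu>)) x I) \<and>
          x - a0 - principal_value (\<lambda>\<mu>. J \<mu> / (x - \<mu>)) x = 0"
    and J_gaps: "\<And>k x. k \<in> {1..g} \<Longrightarrow> x \<in> gap p q k \<Longrightarrow> J x = c k"
    and J_outside: "\<And>x. x \<notin> bands g p q \<union> gaps g p q \<Longrightarrow> J x = 0"
  shows "(\<forall>z. Im z \<noteq> 0 \<longrightarrow> (\<exists>I. has_integral_to_infinity (\<lambda>w. 1 - P w / R w) z I)) \<and>
    f holomorphic_on {z. Im z \<noteq> 0} \<and>
    (\<forall>x. \<exists>I. has_principal_value (\<lambda>\<mu>. J \<mu> / (x - \<mu>)) x I) \<and>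
    (\<forall>x. (f \<longlongrightarrow> of_real (J x) + \<i> * of_real (hilbert_transform J x))
           (at (of_real x) within {z. Im z > 0})) \<and>
    (\<forall>x. set_integrable lborel {x<..} (\<lambda>\<mu>. 1 - P (of_real \<mu>) / R (of_real \<mu>))) \<and>
    (\<forall>x. J x = 1 / pi * Im (LINT \<mu>:{x<..}|lborel. 1 - P (of_real \<mu>) / R (of_real \<mu>))) \<and>
    (\<forall>x. hilbert_transform J x =
           - 1 / pi * Re (LINT \<mu>:{x<..}|lborel. 1 - P (of_real \<mu>) / R (of_real \<mu>))) \<and>
    of_real (q (g + 1)) + (LINT \<mu>:{q (g + 1)<..}|lborel. 1 - P (of_real \<mu>) / R (of_real \<mu>))
      = of_real a0"
proof -
  have band_system: "band_system g p q"
    by unfold_locales (use band_order gap_order in auto)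
  interpret S: band_system g p q by (rule band_system)
  have J_zero: "J x = 0" if "x \<notin> {p 0..q (g + 1)}" for x
  proof (rule J_outside)
    show "x \<notin> bands g p q \<union> gaps g p q"
    proof
      assume "x \<in> bands g p q \<union> gaps g p q"
      then consider k where "k \<le> g" "p k \<le> x" "x \<le> q (k + 1)" | k where "k \<in> {1..g}" "q k < x" "x < p k"
        by (auto simp: bands_def gaps_def gap_def)
      then show False
      proof cases
        case (1 k)
        then show False using that S.p_mono[of 0 k] S.q_mono[of "k + 1" "g + 1"] by auto
      next
        case (2 k)
        then show False using that S.p_less_q[of 0 k] S.p_less_q[of k "g + 1"] by auto
      qed
    qed
  qed
  obtain B where B: "\<And>x. \<bar>J x\<bar> \<le> B"
  proof -
    have "bounded (J ` {p 0..q (g + 1)})"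
      by (intro compact_imp_bounded compact_continuous_image continuous_on_subset[OF J_cont]) auto
    then obtain B where B: "0 < B" "\<And>x. x \<in> {p 0..q (g + 1)} \<Longrightarrow> \<bar>J x\<bar> \<le> B"
      by (auto simp: bounded_pos)
    have "\<bar>J x\<bar> \<le> B" for x
      using B J_zero[of x] by (cases "x \<in> {p 0..q (g + 1)}") auto
    then show thesis by (rule that)
  qed
  interpret C: compact_density J "p 0" "q (g + 1)" B
    by unfold_locales (use S.outer_less J_cont J_zero B in auto)
  interpret D: band_density g p q J B a0 c
  proof unfold_locales
    fix x assume x: "x \<in> bands g p q"
    then obtain I where I: "has_principal_value (\<lambda>\<mu>. J \<mu> / (x - \<mu>)) x I" using J_bands by blast
    then have lim: "((\<lambda>y. Re (C.F (Complex x y))) \<longlongrightarrow> I) (at_right 0)"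
      by (simp add: C.has_principal_value_iff)
    then have "principal_value (\<lambda>\<mu>. J \<mu> / (x - \<mu>)) x = I"
      by (rule C.principal_value_eq)
    then have "I = x - a0" using J_bands[OF x] by simp
    then show "((\<lambda>y. Re (C.F (Complex x y))) \<longlongrightarrow> x - a0) (at_right 0)" using lim by simp
  qed (rule J_gaps)
  have R: "R = S.band_root" by (rule S.band_root_eq[OF R])
  define m where "m = (\<Prod>i=1..g+1. [:- complex_of_real (\<sigma> i), 1:])"
  have m: "poly m z = P z" for z
    unfolding m_def P poly_prod by (intro prod.cong refl) simp
  have "m = D.density_poly"
  proof (rule D.density_poly_eq)
    show "degree m = g + 1"
      unfolding m_def by (subst degree_prod_eq_sum_degree) auto
    show "lead_coeff m = 1"
      unfolding m_def lead_coeff_prod by simp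
    show "poly m (of_real x) \<in> \<real>" for x
      unfolding m P by (intro prod_in_Reals Reals_diff Reals_of_real)
    show "(LINT x:gap p q k|lborel. poly m (of_real x) / S.band_root (of_real x)) = 0" if "k \<in> {1..g}" for k
      using P_gaps[OF that] unfolding m R .
    show "(LINT x:bands g p q|lborel. poly m (of_real x) / S.band_root (of_real x)) = 0"
      using P_bands unfolding m R .
  qed
  then have slope: "1 - P z / R z = D.slope z" for z
    unfolding D.slope_def R by (simp flip: m)
  \<comment> \<open>the identity for the derivative is carried to the lower half-plane by conjugation, all data being real\<close>
  have slope_cnj: "D.slope (cnj z) = cnj (D.slope z)" if "Im z \<noteq> 0" for z
    using that unfolding slope[symmetric] R P by (simp add: S.band_root_cnj)
  have F': "C.F' z = D.slope z" if z: "Im z \<noteq> 0" for z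
  proof (cases "0 < Im z")
    case False
    then have "C.F' (cnj z) = D.slope (cnj z)" using z by (intro D.derivative_eq_slope) simp
    then show ?thesis using C.cauchy_transform_cnj(2) slope_cnj[OF z] by simp
  qed (rule D.derivative_eq_slope)
  have deriv: "(C.F has_field_derivative 1 - P z / R z) (at z)" if "Im z \<noteq> 0" for z
    unfolding slope using C.cauchy_transform_has_derivative[OF that] F'[OF that] by simp
  have has_int: "has_integral_to_infinity (\<lambda>w. 1 - P w / R w) z (- C.F z)"
    and f_eq: "f z = \<i> / of_real pi * C.F z" if z: "Im z \<noteq> 0" for z
  proof -
    show "has_integral_to_infinity (\<lambda>w. 1 - P w / R w) z (- C.F z)"
      by (rule has_integral_to_infinity_primitive[OF deriv C.cauchy_transform_decay(1) z])
    have "integral_to_infinity (\<lambda>w. 1 - P w / R w) z = - C.F z"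
      by (rule integral_to_infinity_primitive[OF deriv C.cauchy_transform_decay(1) z])
    then show "f z = \<i> / of_real pi * C.F z" unfolding f[OF z] by simp
  qed
  define b where "b x = boundary_extension C.F (complex_of_real x)" for x
  have Im_b: "Im (b x) = - pi * J x" for x
    unfolding b_def by (rule D.Im_boundary_cauchy_transform)
  have pv: "has_principal_value (\<lambda>\<mu>. J \<mu> / (x - \<mu>)) x (Re (b x))" for x
    unfolding C.has_principal_value_iff b_def by (rule D.Re_boundary_cauchy_transform)
  have H: "hilbert_transform J x = Re (b x) / pi" for x
    unfolding hilbert_transform_def b_def C.principal_value_eq[OF D.Re_boundary_cauchy_transform] by simp
  have b: "\<i> / of_real pi * b x = of_real (J x) + \<i> * of_real (hilbert_transform J x)" for x
    by (simp add: complex_eq_iff Im_b H)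
  have ray: "(LINT \<mu>:{x<..}|lborel. 1 - P (of_real \<mu>) / R (of_real \<mu>)) = - b x" for x
    unfolding slope b_def by (rule D.set_integral_slope_ray)
  have "q (g + 1) \<in> bands g p q" by (rule D.band_ends(2)) simp
  then have "b (q (g + 1)) = of_real (q (g + 1) - a0)"
    unfolding b_def by (simp add: D.boundary_cauchy_transform_band D.density_at_outer_ends(2)[simplified])
  then have "of_real (q (g + 1)) + (LINT \<mu>:{q (g + 1)<..}|lborel. 1 - P (of_real \<mu>) / R (of_real \<mu>)) = of_real a0"
    unfolding ray by simp
  moreover have "f holomorphic_on {z. Im z \<noteq> 0}"
  proof (rule holomorphic_transform)
    show "(\<lambda>z. \<i> / of_real pi * C.F z) holomorphic_on {z. Im z \<noteq> 0}"
      by (intro holomorphic_intros C.cauchy_transform_holomorphic) simp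
  qed (simp add: f_eq)
  moreover have "(f \<longlongrightarrow> of_real (J x) + \<i> * of_real (hilbert_transform J x)) (at (of_real x) within {z. Im z > 0})" for x
  proof -
    have "((\<lambda>z. \<i> / of_real pi * C.F z) \<longlongrightarrow> \<i> / of_real pi * b x) (at (of_real x) within {z. Im z > 0})"
      unfolding b_def by (intro tendsto_intros D.cauchy_transform_boundary_limit)
    moreover have "eventually (\<lambda>z. \<i> / of_real pi * C.F z = f z) (at (of_real x) within {z. Im z > 0})"
      unfolding eventually_at by (intro exI[of _ 1]) (auto simp: f_eq)
    ultimately show ?thesis unfolding b by (rule Lim_transform_eventually)
  qed
  moreover have "set_integrable lborel {x<..} (\<lambda>\<mu>. 1 - P (of_real \<mu>) / R (of_real \<mu>))" for x
    unfolding slope by (rule D.set_integrable_slope_ray)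
  moreover have "J x = 1 / pi * Im (LINT \<mu>:{x<..}|lborel. 1 - P (of_real \<mu>) / R (of_real \<mu>))" for x
    unfolding ray by (simp add: Im_b)
  moreover have "hilbert_transform J x = - 1 / pi * Re (LINT \<mu>:{x<..}|lborel. 1 - P (of_real \<mu>) / R (of_real \<mu>))" for x
    unfolding ray H by simp
  ultimately show ?thesis
    using has_int pv by blast
qed

end
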